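(* Let $\Omega=(-1,1)\subset\mathbb{R}$. For $m\in L^\infty_+(\Omega)$ and $d\in(0,1/\lambda_1(m))$, let $u_{d,m}$ be the solution of $$d\,u''+u(m(x)-u)=0,\quad u>0\ \text{ in }(-1,1),\qquad u(-1)=u(1)=0.$$ Then for every $m\in L^\infty_+(\Omega)$ and every $d\in(0,1/\lambda_1(m))$, $$\frac{\|u_{d,m}\|_{L^1(\Omega)}}{\|m\|_{L^1(\Omega)}}<3.$$ Moreover, $$\sup\left\{\frac{\|u_{d,m}\|_{L^1(\Omega)}}{\|m\|_{L^1(\Omega)}}\ :\ m\in L^\infty_+(\Omega),\ d\in(0,1/\lambda_1(m))\right\}=3.$$
   Context: $L^\infty_+(\Omega):=\{f\in L^\infty(\Omega): f(x)\ge 0\text{ for a.e. }x\in\Omega,\ \|f\|_{L^\infty}>0\}$. For $m\in L^\infty_+(\Omega)$, $\lambda_1(m)>0$ denotes the least eigenvalue of the weighted Dirichlet eigenvalue problem $\phi''+\lambda m(x)\phi=0$ in $(-1,1)$, $\phi(-1)=\phi(1)=0$. It is known (Cantrell–Cosner) that for every $m\in L^\infty_+(\Omega)$ and $d\in(0,1/\lambda_1(m))$ the boundary value problem has a unique solution $u_{d,m}$ in $W^{2,p}(\Omega)\cap W^{1,p}_0(\Omega)$ (any $p>1$); the equation is understood a.e. *)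

theory Defs
  imports "HOL-Analysis.Analysis" "HOL-Probability.Essential_Supremum"
begin

abbreviation Omega :: "real set" where
  "Omega \<equiv> {-1<..<1}"

subsection \<open>Lebesgue spaces on \<open>Omega\<close>\<close>

text \<open>Elements of the function spaces are represented by functions \<open>real \<Rightarrow> real\<close>; their values
  outside \<open>Omega\<close> play no role.\<close>

definition Linf_norm :: "(real \<Rightarrow> real) \<Rightarrow> ereal" where
  "Linf_norm f = esssup (lebesgue_on Omega) (\<lambda>x. ereal \<bar>f x\<bar>)"

definition Linf_plus :: "(real \<Rightarrow> real) set" where
  "Linf_plus = {f \<in> borel_measurable (lebesgue_on Omega).
     Linf_norm f < \<infinity> \<and> (AE x in lebesgue_on Omega. 0 \<le> f x) \<and> 0 < Linf_norm f}"

definition L1_norm :: "(real \<Rightarrow> real) \<Rightarrow> real" where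
  "L1_norm f = (LINT x|lebesgue_on Omega. \<bar>f x\<bar>)"

definition Lp :: "real \<Rightarrow> (real \<Rightarrow> real) set" where
  "Lp p = {f \<in> borel_measurable (lebesgue_on Omega).
     integrable (lebesgue_on Omega) (\<lambda>x. \<bar>f x\<bar> powr p)}"

definition Lp_norm :: "real \<Rightarrow> (real \<Rightarrow> real) \<Rightarrow> real" where
  "Lp_norm p f = (LINT x|lebesgue_on Omega. \<bar>f x\<bar> powr p) powr (1 / p)"

subsection \<open>Sobolev spaces on \<open>Omega\<close>\<close>

text \<open>The one-dimensional conventions are those of Brezis, Functional Analysis, Sobolev Spaces and
  Partial Differential Equations, Chapter 8: test functions are \<open>C\<^sup>1\<close> with compact support in
  \<open>Omega\<close>, and \<open>W01p p\<close> is the closure of the test functions in \<open>W1p p\<close>.\<close>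

definition test_functions :: "(real \<Rightarrow> real) set" where
  "test_functions = {\<phi>. \<phi> C1_differentiable_on UNIV \<and> compact (closure {x. \<phi> x \<noteq> 0}) \<and>
     closure {x. \<phi> x \<noteq> 0} \<subseteq> Omega}"

definition locally_integrable :: "(real \<Rightarrow> real) \<Rightarrow> bool" where
  "locally_integrable f \<longleftrightarrow> (\<forall>K. compact K \<and> K \<subseteq> Omega \<longrightarrow> set_integrable lebesgue K f)"

definition weak_derivative :: "(real \<Rightarrow> real) \<Rightarrow> (real \<Rightarrow> real) \<Rightarrow> bool" where
  "weak_derivative u v \<longleftrightarrow> locally_integrable u \<and> locally_integrable v \<and>
     (\<forall>\<phi>\<in>test_functions. (LINT x|lebesgue_on Omega. u x * deriv \<phi> x) =
        - (LINT x|lebesgue_on Omega. v x * \<phi> x))"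

definition weak_second_derivative :: "(real \<Rightarrow> real) \<Rightarrow> (real \<Rightarrow> real) \<Rightarrow> bool" where
  "weak_second_derivative u w \<longleftrightarrow> (\<exists>v. weak_derivative u v \<and> weak_derivative v w)"

definition W1p :: "real \<Rightarrow> (real \<Rightarrow> real) set" where
  "W1p p = {u \<in> Lp p. \<exists>v\<in>Lp p. weak_derivative u v}"

definition W2p :: "real \<Rightarrow> (real \<Rightarrow> real) set" where
  "W2p p = {u \<in> W1p p. \<exists>v\<in>W1p p. weak_derivative u v}"

definition W01p :: "real \<Rightarrow> (real \<Rightarrow> real) set" where
  "W01p p = {u \<in> Lp p. \<exists>v\<in>Lp p. weak_derivative u v \<and>
     (\<exists>\<phi> :: nat \<Rightarrow> real \<Rightarrow> real. (\<forall>n. \<phi> n \<in> test_functions) \<and>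
        (\<lambda>n. Lp_norm p (\<lambda>x. \<phi> n x - u x) + Lp_norm p (\<lambda>x. deriv (\<phi> n) x - v x))
          \<longlonglongrightarrow> 0)}"

text \<open>\<open>W\<^sup>2\<^sup>,\<^sup>p \<inter> W\<^sub>0\<^sup>1\<^sup>,\<^sup>p\<close>, with each class represented by its continuous representative, so that
  boundary values and pointwise positivity are meaningful. The boundary values are implied by the
  membership in \<open>W01p p\<close> and are recorded only because they are part of the
  boundary value problems.\<close>

definition dirichlet_space :: "real \<Rightarrow> (real \<Rightarrow> real) set" where
  "dirichlet_space p = {u \<in> W2p p \<inter> W01p p. continuous_on {-1..1} u \<and> u (-1) = 0 \<and> u 1 = 0}"

subsection \<open>The eigenvalue problem and the logistic equation\<close>

definition weighted_eigenvalue :: "real \<Rightarrow> (real \<Rightarrow> real) \<Rightarrow> real \<Rightarrow> bool" where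
  "weighted_eigenvalue p m \<mu> \<longleftrightarrow>
     (\<exists>\<phi>\<in>dirichlet_space p. (\<exists>x\<in>Omega. \<phi> x \<noteq> 0) \<and>
        (\<exists>\<phi>''. weak_second_derivative \<phi> \<phi>'' \<and>
           (AE x in lebesgue_on Omega. \<phi>'' x + \<mu> * m x * \<phi> x = 0)))"

definition lambda1 :: "real \<Rightarrow> (real \<Rightarrow> real) \<Rightarrow> real" where
  "lambda1 p m = (LEAST \<mu>. weighted_eigenvalue p m \<mu>)"

definition logistic_solution :: "real \<Rightarrow> real \<Rightarrow> (real \<Rightarrow> real) \<Rightarrow> (real \<Rightarrow> real) \<Rightarrow> bool" where
  "logistic_solution p d m u \<longleftrightarrow>
     u \<in> dirichlet_space p \<and> (\<forall>x\<in>Omega. 0 < u x) \<and>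
     (\<exists>u''. weak_second_derivative u u'' \<and>
        (AE x in lebesgue_on Omega. d * u'' x + u x * (m x - u x) = 0))"

end

theory Submission
  imports Defs "HOL-Real_Asymp.Real_Asymp"
begin

text \<open>
  By the equation \<open>d u'' = u (u - m)\<close>, the energy \<open>E = d u'\<^sup>2 - 2/3 u\<^sup>3\<close> has derivative
  \<open>- 2 u' u m\<close>.  Since \<open>m\<close> is nonnegative, \<open>E\<close> decreases where \<open>u\<close> increases and increases where
  \<open>u\<close> decreases.  At the maximum of \<open>u\<close> the energy is negative, at both endpoints
  it is positive, and monotonicity forces \<open>E > 0\<close> on exactly two end intervals \<open>[-1,c)\<close> and
  \<open>(e,1]\<close>, with \<open>u' > 0\<close> on the first and \<open>u' < 0\<close> on the second.
  Dividing the equation by \<open>u\<close> and integrating over \<open>[c,e]\<close> yields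
  \<open>\<integral> m = \<integral> u - d (u'(e)/u(e) - u'(c)/u(c)) - d \<integral> (u'/u)\<^sup>2\<close>,
  where \<open>E \<le> 0\<close> says \<open>d (u'/u)\<^sup>2 \<le> 2/3 u\<close>, strictly at the maximum; this bounds
  \<open>\<integral> u\<close> over \<open>[c,e]\<close> by three times \<open>\<integral> m\<close> plus boundary terms.  On the end intervals the mass of
  \<open>m\<close> is discarded, and \<open>u\<close> is paid for by those boundary terms: on \<open>[-1,c)\<close> the inequality \<open>E > 0\<close> reads
  \<open>u < \<surd>(6 d) (\<surd>u)'\<close>, and integrating it gives \<open>\<integral> u \<le> \<surd>(6 d u(c)) = 3 d u'(c)/u(c)\<close>, the last step because
  \<open>E(c) = 0\<close> (lemma \<open>left_part\<close>).  This is exactly three times the boundary term at \<open>c\<close>; the right end is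
  the mirror image, and everything adds up to \<open>L1_bound\<close>.

  The constant three is optimal.  Equality in both estimates would need \<open>E = 0\<close> and \<open>m = 0\<close>, that is
  \<open>u = 6 d/(\<bar>x\<bar> + \<delta>)\<^sup>2\<close>, with \<open>m\<close> a point mass at the origin.  For \<open>d = 1\<close> this profile is
  rounded off by a parabola on \<open>\<bar>x\<bar> \<le> \<delta>\<^sup>2\<close> and continued by its tangent line near the endpoints, and
  \<open>m = u - u''/u\<close> is the weight it solves the equation for.  The masses are about \<open>12/\<delta>\<close> and
  \<open>4/\<delta>\<close>, so the ratio tends to three.

  These solutions must be shown to be admissible.  The condition \<open>d < 1/\<lambda>\<^sub>1(m)\<close> speaks of a least eigenvalue,
  which must first be shown to exist.  The solutions of \<open>\<phi>'' + \<mu> m \<phi> = 0\<close>, \<open>\<phi>(-1) = 0\<close>,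
  \<open>\<phi>'(-1) = 1\<close> form a power series in \<open>\<mu>\<close>; the largest \<open>\<mu> \<le> 1/d\<close> for which \<open>\<phi>\<close> is
  nonnegative is an eigenvalue with positive eigenfunction.  It is below \<open>1/d\<close>, because the Wronskian of \<open>\<phi>\<close>
  with a positive logistic solution excludes \<open>\<mu> = 1/d\<close>, and it is the least eigenvalue by Sturm comparison
  (\<open>lambda1_bound\<close>).

  All of this is carried out for classical primitives instead of weak derivatives.  The relation
  \<open>primitive_on\<close> expresses that a Lipschitz function is the integral of a bounded measurable one; a product
  rule replaces differentiation almost everywhere.  Two lemmas translate:
  \<open>weak_second_derivative_imp_primitives\<close> turns a weak second derivative that is bounded into a double primitive, and
  \<open>dirichlet_space_primitives\<close> puts a double primitive with zero boundary values into the Sobolev spaces.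
\<close>

section \<open>Primitives of bounded measurable functions\<close>

text \<open>
  The integrand is required to be bounded and measurable rather than merely integrable: this is the regularity of
  the second derivatives below, it makes every primitive Lipschitz continuous, and it is preserved by products.
\<close>
definition primitive_on :: "real \<Rightarrow> real \<Rightarrow> (real \<Rightarrow> real) \<Rightarrow> (real \<Rightarrow> real) \<Rightarrow> bool" where
  "primitive_on a b F f \<longleftrightarrow> f \<in> borel_measurable (lebesgue_on {a..b}) \<and>
     (\<exists>K. \<forall>x\<in>{a..b}. \<bar>f x\<bar> \<le> K) \<and> (\<forall>x\<in>{a..b}. F x = F a + integral {a..x} f)"

lemma primitive_onD:
  assumes "primitive_on a b F f"
  shows "f \<in> borel_measurable (lebesgue_on {a..b})" "\<exists>K. \<forall>x\<in>{a..b}. \<bar>f x\<bar> \<le> K"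
    "\<And>x. x \<in> {a..b} \<Longrightarrow> F x = F a + integral {a..x} f"
  using assms unfolding primitive_on_def by blast+

lemma bounded_measurable_absolutely_integrable:
  fixes f :: "real \<Rightarrow> real"
  assumes "f \<in> borel_measurable (lebesgue_on {a..b})" "\<And>x. x \<in> {a..b} \<Longrightarrow> \<bar>f x\<bar> \<le> K"
  shows "f absolutely_integrable_on {a..b}"
  using assms by (intro measurable_bounded_by_integrable_imp_absolutely_integrable[where g = "\<lambda>_. K"]) auto

lemma primitive_on_integrable:
  assumes "primitive_on a b F f" "{x..y} \<subseteq> {a..b}"
  shows "f integrable_on {x..y}"
proof -
  obtain K where "f \<in> borel_measurable (lebesgue_on {a..b})" "\<And>x. x \<in> {a..b} \<Longrightarrow> \<bar>f x\<bar> \<le> K"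
    using assms unfolding primitive_on_def by blast
  then have "f absolutely_integrable_on {a..b}" by (rule bounded_measurable_absolutely_integrable)
  then have "f integrable_on {a..b}" by (simp add: absolutely_integrable_on_def)
  then show ?thesis using assms(2) by (rule integrable_on_subinterval)
qed

lemma primitive_on_diff:
  assumes "primitive_on a b F f" "a \<le> x" "x \<le> y" "y \<le> b"
  shows "F y - F x = integral {x..y} f"
proof -
  have "integral {a..x} f + integral {x..y} f = integral {a..y} f"
    by (rule Henstock_Kurzweil_Integration.integral_combine[OF assms(2,3)], rule primitive_on_integrable[OF assms(1)])
      (use assms in auto)
  moreover have "F x = F a + integral {a..x} f" "F y = F a + integral {a..y} f"
    using assms by (auto intro!: primitive_onD(3)[OF assms(1)])
  ultimately show ?thesis by simp
qed

lemma primitive_on_has_integral: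
  assumes "primitive_on a b F f" "a \<le> x" "x \<le> y" "y \<le> b"
  shows "(f has_integral F y - F x) {x..y}"
  using primitive_on_diff[OF assms] primitive_on_integrable[OF assms(1), of x y] assms
  by (auto simp: has_integral_iff)

lemma primitive_on_Lipschitz:
  assumes "primitive_on a b F f"
  obtains L where "0 \<le> L" "\<And>x y. x \<in> {a..b} \<Longrightarrow> y \<in> {a..b} \<Longrightarrow> \<bar>F x - F y\<bar> \<le> L * \<bar>x - y\<bar>"
    "\<And>x. x \<in> {a..b} \<Longrightarrow> \<bar>f x\<bar> \<le> L"
proof -
  obtain K :: real where K: "\<And>x. x \<in> {a..b} \<Longrightarrow> \<bar>f x\<bar> \<le> K"
    using assms unfolding primitive_on_def by blast
  define L where "L = \<bar>K\<bar>"
  have L: "\<bar>f x\<bar> \<le> L" if "x \<in> {a..b}" for x using K[OF that] by (simp add: L_def)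
  have 1: "\<bar>F y - F x\<bar> \<le> L * \<bar>y - x\<bar>" if "x \<in> {a..b}" "y \<in> {a..b}" "x \<le> y" for x y
  proof -
    have "norm (F y - F x) \<le> L * measure lborel (cbox x y)"
      using primitive_on_has_integral[OF assms, of x y] that L
      by (intro has_integral_bound[of L f]) (auto simp: L_def)
    then show ?thesis using that by simp
  qed
  show thesis
  proof (rule that[of L])
    fix x y assume "x \<in> {a..b}" "y \<in> {a..b}"
    then show "\<bar>F x - F y\<bar> \<le> L * \<bar>x - y\<bar>"
      using 1[of x y] 1[of y x] by (cases "x \<le> y") (auto simp: abs_minus_commute)
  qed (use L in \<open>auto simp: L_def\<close>)
qed

lemma Lipschitz_imp_continuous_on:
  fixes F :: "real \<Rightarrow> real"
  assumes "0 \<le> L" "\<And>x y. x \<in> S \<Longrightarrow> y \<in> S \<Longrightarrow> \<bar>F x - F y\<bar> \<le> L * \<bar>x - y\<bar>"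
  shows "continuous_on S F"
  using assms by (intro lipschitz_on_continuous_on[of L] lipschitz_onI) (auto simp: dist_real_def)

lemma primitive_on_continuous:
  assumes "primitive_on a b F f" shows "continuous_on {a..b} F"
  using primitive_on_Lipschitz[OF assms] Lipschitz_imp_continuous_on by metis

lemma continuous_on_Icc_bounded:
  fixes F :: "real \<Rightarrow> real"
  assumes "continuous_on {a..b} F"
  obtains K where "0 \<le> K" "\<And>x. x \<in> {a..b} \<Longrightarrow> \<bar>F x\<bar> \<le> K"
proof -
  have "bounded (F ` {a..b})" using assms by (intro compact_imp_bounded compact_continuous_image) auto
  then obtain K where "\<forall>y\<in>F ` {a..b}. norm y \<le> K" by (auto simp: bounded_iff)
  then show thesis by (intro that[of "\<bar>K\<bar>"]) force+
qed

lemma continuous_on_Icc_measurable: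
  fixes F :: "real \<Rightarrow> real"
  shows "continuous_on {a..b} F \<Longrightarrow> F \<in> borel_measurable (lebesgue_on {a..b})"
  by (rule continuous_imp_measurable_on_sets_lebesgue) auto

lemma primitive_on_subinterval:
  assumes "primitive_on a b F f" "a \<le> c" "d \<le> b"
  shows "primitive_on c d F f"
  unfolding primitive_on_def
proof (intro conjI ballI)
  have "f \<in> borel_measurable (lebesgue_on {a..b})" using primitive_onD(1)[OF assms(1)] .
  then show "f \<in> borel_measurable (lebesgue_on {c..d})"
    by (rule measurable_restrict_mono) (use assms in auto)
  show "\<exists>K. \<forall>x\<in>{c..d}. \<bar>f x\<bar> \<le> K" using primitive_onD(2)[OF assms(1)] assms(2,3) by fastforce
  show "F x = F c + integral {c..x} f" if "x \<in> {c..d}" for x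
    using primitive_on_diff[OF assms(1), of c x] assms that by auto
qed

text \<open>
  The difference quotients of such a function are \<open>O(y - x)\<close>, so its derivative vanishes everywhere.
\<close>
lemma constant_if_quadratic_increments:
  fixes H :: "real \<Rightarrow> real"
  assumes "\<And>x y. x \<in> {a..b} \<Longrightarrow> y \<in> {a..b} \<Longrightarrow> x \<le> y \<Longrightarrow> \<bar>H y - H x\<bar> \<le> C * (y - x)\<^sup>2"
    and "x \<in> {a..b}" "y \<in> {a..b}"
  shows "H x = H y"
proof -
  have sym: "\<bar>H y - H x\<bar> \<le> C * (y - x)\<^sup>2" if "x \<in> {a..b}" "y \<in> {a..b}" for x y
    using assms(1)[of x y] assms(1)[of y x] that
    by (cases "x \<le> y") (auto simp: abs_minus_commute power2_commute)
  have "(H has_field_derivative 0) (at x within {a..b})" if x: "x \<in> {a..b}" for x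
    unfolding has_field_derivative_iff
  proof (rule Lim_null_comparison)
    have "norm ((H y - H x) / (y - x)) \<le> C * \<bar>y - x\<bar>" if "y \<in> {a..b}" "y \<noteq> x" for y
    proof -
      have "\<bar>H y - H x\<bar> / \<bar>y - x\<bar> \<le> C * (y - x)\<^sup>2 / \<bar>y - x\<bar>"
        using sym[OF x that(1)] by (rule divide_right_mono) auto
      also have "\<dots> = C * \<bar>y - x\<bar>" using that by (simp add: power2_eq_square abs_if field_simps)
      finally show ?thesis by (simp add: abs_divide)
    qed
    then show "\<forall>\<^sub>F y in at x within {a..b}. norm ((H y - H x) / (y - x)) \<le> C * \<bar>y - x\<bar>"
      by (auto simp: eventually_at_filter)
    show "((\<lambda>y. C * \<bar>y - x\<bar>) \<longlongrightarrow> 0) (at x within {a..b})"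
      by (auto intro!: tendsto_eq_intros)
  qed
  then obtain c where "\<forall>x\<in>{a..b}. H x = c"
    using has_field_derivative_zero_constant[of "{a..b}" H] by auto
  with assms show ?thesis by simp
qed

text \<open>
  The product rule for functions that are differentiable only almost everywhere.  The difference between
  \<open>F G\<close> and the integral of \<open>f G + F g\<close> changes by at most a constant times \<open>(y - x)\<^sup>2\<close> over
  \<open>[x,y]\<close>, because \<open>F\<close> and \<open>G\<close> are Lipschitz; hence it is constant.
\<close>
lemma primitive_on_mult:
  assumes F: "primitive_on a b F f" and G: "primitive_on a b G g"
  shows "primitive_on a b (\<lambda>x. F x * G x) (\<lambda>x. f x * G x + F x * g x)"
proof -
  let ?h = "\<lambda>x. f x * G x + F x * g x"
  obtain L where L: "0 \<le> L" "\<And>x y. x \<in> {a..b} \<Longrightarrow> y \<in> {a..b} \<Longrightarrow> \<bar>F x - F y\<bar> \<le> L * \<bar>x - y\<bar>"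
    "\<And>x. x \<in> {a..b} \<Longrightarrow> \<bar>f x\<bar> \<le> L" using primitive_on_Lipschitz[OF F] by blast
  obtain M where M: "0 \<le> M" "\<And>x y. x \<in> {a..b} \<Longrightarrow> y \<in> {a..b} \<Longrightarrow> \<bar>G x - G y\<bar> \<le> M * \<bar>x - y\<bar>"
    "\<And>x. x \<in> {a..b} \<Longrightarrow> \<bar>g x\<bar> \<le> M" using primitive_on_Lipschitz[OF G] by blast
  obtain A where A: "0 \<le> A" "\<And>x. x \<in> {a..b} \<Longrightarrow> \<bar>F x\<bar> \<le> A"
    using continuous_on_Icc_bounded[OF primitive_on_continuous[OF F]] by blast
  obtain B where B: "0 \<le> B" "\<And>x. x \<in> {a..b} \<Longrightarrow> \<bar>G x\<bar> \<le> B"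
    using continuous_on_Icc_bounded[OF primitive_on_continuous[OF G]] by blast
  have meas: "?h \<in> borel_measurable (lebesgue_on {a..b})"
    using primitive_onD(1)[OF F] primitive_onD(1)[OF G] continuous_on_Icc_measurable[OF primitive_on_continuous[OF F]]
      continuous_on_Icc_measurable[OF primitive_on_continuous[OF G]]
    by (intro borel_measurable_add borel_measurable_times) auto
  have bd: "\<bar>?h x\<bar> \<le> L * B + A * M" if "x \<in> {a..b}" for x
  proof -
    have "\<bar>?h x\<bar> \<le> \<bar>f x\<bar> * \<bar>G x\<bar> + \<bar>F x\<bar> * \<bar>g x\<bar>" by (metis abs_mult abs_triangle_ineq)
    also have "\<dots> \<le> L * B + A * M"
      using that L M A B by (intro add_mono mult_mono) auto
    finally show ?thesis .
  qed
  have hint: "?h integrable_on {x..y}" if "a \<le> x" "y \<le> b" for x y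
  proof (rule integrable_on_subinterval)
    show "?h integrable_on {a..b}"
      using bounded_measurable_absolutely_integrable[OF meas bd] by (simp add: absolutely_integrable_on_def)
  qed (use that in auto)
  define H where "H x = F x * G x - integral {a..x} ?h" for x
  have "\<bar>H y - H x\<bar> \<le> (L * M + L * M) * (y - x)\<^sup>2"
    if xy: "x \<in> {a..b}" "y \<in> {a..b}" "x \<le> y" for x y
  proof -
    have "integral {a..x} ?h + integral {x..y} ?h = integral {a..y} ?h"
      using xy hint[of a y] by (intro Henstock_Kurzweil_Integration.integral_combine) auto
    then have 1: "H y - H x = F y * G y - F x * G x - integral {x..y} ?h"
      by (simp add: H_def)
    \<comment> \<open>Freezing the continuous factors at the endpoints costs a second order error only.\<close>
    have "((\<lambda>t. f t * G y + F x * g t - ?h t) has_integral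
           (F y - F x) * G y + F x * (G y - G x) - integral {x..y} ?h) {x..y}"
      using xy by (intro has_integral_diff has_integral_add has_integral_mult_left has_integral_mult_right
          primitive_on_has_integral[OF F] primitive_on_has_integral[OF G] integrable_integral hint) auto
    moreover have "norm (f t * G y + F x * g t - ?h t) \<le> (L * M + L * M) * (y - x)" if "t \<in> {x..y}" for t
    proof -
      have t: "t \<in> {a..b}" using that xy by auto
      have "f t * G y + F x * g t - ?h t = f t * (G y - G t) + (F x - F t) * g t"
        by (simp add: algebra_simps)
      then have "norm (f t * G y + F x * g t - ?h t) \<le> \<bar>f t\<bar> * \<bar>G y - G t\<bar> + \<bar>F x - F t\<bar> * \<bar>g t\<bar>"
        by (metis abs_mult abs_triangle_ineq real_norm_def)
      also have "\<dots> \<le> L * (M * (y - x)) + (L * (y - x)) * M"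
      proof (intro add_mono mult_mono)
        have "\<bar>G y - G t\<bar> \<le> M * \<bar>y - t\<bar>" using M t xy by auto
        also have "\<dots> \<le> M * (y - x)" using that M(1) by (intro mult_left_mono) auto
        finally show "\<bar>G y - G t\<bar> \<le> M * (y - x)" .
        have "\<bar>F x - F t\<bar> \<le> L * \<bar>x - t\<bar>" using L t xy by auto
        also have "\<dots> \<le> L * (y - x)" using that L(1) by (intro mult_left_mono) auto
        finally show "\<bar>F x - F t\<bar> \<le> L * (y - x)" .
      qed (use L M t xy in auto)
      finally show ?thesis by (simp add: algebra_simps)
    qed
    ultimately have "norm ((F y - F x) * G y + F x * (G y - G x) - integral {x..y} ?h)
        \<le> (L * M + L * M) * (y - x) * measure lborel (cbox x y)"
      by (intro has_integral_bound[where f = "\<lambda>t. f t * G y + F x * g t - ?h t"])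
        (use L M xy in auto)
    then show ?thesis using xy by (simp add: 1 algebra_simps power2_eq_square)
  qed
  then have H: "H x = H a" if "x \<in> {a..b}" for x
    by (rule constant_if_quadratic_increments) (use that in auto)
  have "F x * G x = F a * G a + integral {a..x} ?h" if "x \<in> {a..b}" for x
    using H[OF that] unfolding H_def by simp
  then show ?thesis unfolding primitive_on_def using meas bd by blast
qed

lemma primitive_on_add:
  assumes "primitive_on a b F f" "primitive_on a b G g"
  shows "primitive_on a b (\<lambda>x. F x + G x) (\<lambda>x. f x + g x)"
  unfolding primitive_on_def
proof (intro conjI ballI)
  show "(\<lambda>x. f x + g x) \<in> borel_measurable (lebesgue_on {a..b})"
    using assms[THEN primitive_onD(1)] by (intro borel_measurable_add) auto
  obtain K L where "\<forall>x\<in>{a..b}. \<bar>f x\<bar> \<le> K" "\<forall>x\<in>{a..b}. \<bar>g x\<bar> \<le> L"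
    using assms unfolding primitive_on_def by blast
  then have "\<forall>x\<in>{a..b}. \<bar>f x + g x\<bar> \<le> K + L" by fastforce
  then show "\<exists>K. \<forall>x\<in>{a..b}. \<bar>f x + g x\<bar> \<le> K" by blast
  show "F x + G x = F a + G a + integral {a..x} (\<lambda>x. f x + g x)" if "x \<in> {a..b}" for x
    using primitive_on_diff[OF assms(1), of a x] primitive_on_diff[OF assms(2), of a x] that
      integral_add[OF primitive_on_integrable[OF assms(1), of a x] primitive_on_integrable[OF assms(2), of a x]]
    by simp
qed

lemma primitive_on_const: "primitive_on a b (\<lambda>_. c) (\<lambda>_. 0)"
  by (auto simp: primitive_on_def)

lemma primitive_on_cmult:
  "primitive_on a b F f \<Longrightarrow> primitive_on a b (\<lambda>x. c * F x) (\<lambda>x. c * f x)"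
  using primitive_on_mult[OF primitive_on_const[of a b c]] by simp

lemma primitive_on_diff_fun:
  "primitive_on a b F f \<Longrightarrow> primitive_on a b G g \<Longrightarrow> primitive_on a b (\<lambda>x. F x - G x) (\<lambda>x. f x - g x)"
  using primitive_on_add[OF _ primitive_on_cmult[of a b G g "-1"]] by simp

lemma primitive_on_cong:
  assumes "primitive_on a b F f" "\<And>x. x \<in> {a..b} \<Longrightarrow> F x = G x" "\<And>x. x \<in> {a..b} \<Longrightarrow> f x = g x"
  shows "primitive_on a b G g"
  unfolding primitive_on_def
proof (intro conjI ballI)
  have "f \<in> borel_measurable (lebesgue_on {a..b})" using primitive_onD(1)[OF assms(1)] .
  moreover have "f \<in> borel_measurable (lebesgue_on {a..b}) \<longleftrightarrow> g \<in> borel_measurable (lebesgue_on {a..b})"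
    by (rule measurable_cong) (simp add: assms(3))
  ultimately show "g \<in> borel_measurable (lebesgue_on {a..b})" by simp
  show "\<exists>K. \<forall>x\<in>{a..b}. \<bar>g x\<bar> \<le> K" using primitive_onD(2)[OF assms(1)] assms(3) by metis
  show "G x = G a + integral {a..x} g" if "x \<in> {a..b}" for x
  proof -
    have "integral {a..x} f = integral {a..x} g" by (rule integral_cong) (use assms(3) that in auto)
    then show ?thesis using primitive_on_diff[OF assms(1), of a x] that assms(2)[of a] assms(2)[of x] by auto
  qed
qed

lemma primitive_on_integral:
  assumes "f \<in> borel_measurable (lebesgue_on {a..b})" "\<And>x. x \<in> {a..b} \<Longrightarrow> \<bar>f x\<bar> \<le> K"
  shows "primitive_on a b (\<lambda>x. C + integral {a..x} f) f"
  unfolding primitive_on_def using assms by (intro conjI ballI exI[of _ K]) auto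

lemma primitive_on_integral_continuous:
  assumes "continuous_on {a..b} f"
  shows "primitive_on a b (\<lambda>x. C + integral {a..x} f) f"
  using continuous_on_Icc_bounded[OF assms] continuous_on_Icc_measurable[OF assms] primitive_on_integral by metis

text \<open>
  Finitely many kinks are harmless; this covers piecewise defined functions.
\<close>
lemma primitive_on_strong:
  assumes "finite S" "\<And>x. x \<in> {a<..<b} - S \<Longrightarrow> (F has_real_derivative f x) (at x)"
    "continuous_on {a..b} F" "f \<in> borel_measurable (lebesgue_on {a..b})" "\<And>x. x \<in> {a..b} \<Longrightarrow> \<bar>f x\<bar> \<le> K"
  shows "primitive_on a b F f"
  unfolding primitive_on_def
proof (intro conjI ballI exI[of _ K])
  fix x assume x: "x \<in> {a..b}"
  have "(f has_integral F x - F a) {a..x}"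
    using x assms(1-3) by (intro fundamental_theorem_of_calculus_interior_strong[OF assms(1)])
      (auto simp flip: has_real_derivative_iff_has_vector_derivative intro: continuous_on_subset)
  then show "F x = F a + integral {a..x} f" by (simp add: has_integral_iff)
qed (use assms in auto)

lemma primitive_on_C1:
  assumes "\<And>x. x \<in> {a<..<b} \<Longrightarrow> (F has_real_derivative f x) (at x)"
    "continuous_on {a..b} F" "continuous_on {a..b} f"
  shows "primitive_on a b F f"
  using continuous_on_Icc_bounded[OF assms(3)] continuous_on_Icc_measurable[OF assms(3)]
    primitive_on_strong[of "{}" a b F f] assms by (metis Diff_empty finite.emptyI)

lemma primitive_on_DERIV_within:
  assumes "primitive_on a b F f" "continuous_on {a..b} f" "x \<in> {a..b}"
  shows "(F has_real_derivative f x) (at x within {a..b})"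
proof -
  have "((\<lambda>x. F a + integral {a..x} f) has_real_derivative 0 + f x) (at x within {a..b})"
    using assms by (intro DERIV_add DERIV_const integral_has_real_derivative) auto
  then have "((\<lambda>x. F a + integral {a..x} f) has_real_derivative f x) (at x within {a..b})" by simp
  then show ?thesis
    by (rule has_field_derivative_transform_within[OF _ zero_less_one assms(3)])
      (simp flip: primitive_onD(3)[OF assms(1)])
qed

lemma primitive_on_DERIV:
  assumes "primitive_on a b F f" "continuous_on {a..b} f" "a < x" "x < b"
  shows "(F has_real_derivative f x) (at x)"
  using primitive_on_DERIV_within[OF assms(1,2), of x] assms
  by (simp add: at_within_Icc_at)

lemma primitive_on_mono:
  assumes "primitive_on a b F f" "a \<le> x" "x \<le> y" "y \<le> b" "\<And>t. t \<in> {x..y} \<Longrightarrow> 0 \<le> f t"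
  shows "F x \<le> F y"
  using has_integral_nonneg[OF primitive_on_has_integral[OF assms(1-4)] assms(5)] by simp

lemma primitive_on_reflect:
  assumes "primitive_on (-r) r F f"
  shows "primitive_on (-r) r (\<lambda>x. F (-x)) (\<lambda>x. - f (-x))"
proof -
  obtain K :: real where K: "\<And>x. x \<in> {-r..r} \<Longrightarrow> \<bar>f x\<bar> \<le> K"
    using assms unfolding primitive_on_def by blast
  have "f absolutely_integrable_on {-r..r}"
    using primitive_onD(1)[OF assms] K by (intro bounded_measurable_absolutely_integrable) auto
  then have "(\<lambda>x. f (-x)) absolutely_integrable_on {-r..r}"
    using absolutely_integrable_reflect_real[where f = f and b = r and a = "-r"] by simp
  then have m: "(\<lambda>x. f (-x)) \<in> borel_measurable (lebesgue_on {-r..r})"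
    by (rule absolutely_integrable_imp_borel_measurable) auto
  show ?thesis unfolding primitive_on_def
  proof (intro conjI ballI exI)
    show "(\<lambda>x. - f (- x)) \<in> borel_measurable (lebesgue_on {- r..r})" using m by simp
    show "\<bar>- f (- x)\<bar> \<le> K" if "x \<in> {-r..r}" for x using K[of "-x"] that by auto
    show "F (- x) = F (- (- r)) + integral {- r..x} (\<lambda>x. - f (- x))" if "x \<in> {-r..r}" for x
      using primitive_on_diff[OF assms, of "-x" r] that Henstock_Kurzweil_Integration.integral_reflect_real[where b = r and a = "-x" and f = f]
      by simp
  qed
qed

section \<open>Primitives and weak derivatives\<close>

lemma primitive_on_bounded_measurable:
  assumes "primitive_on a b F f"
  shows "f \<in> borel_measurable (lebesgue_on {a..b})" "F \<in> borel_measurable (lebesgue_on {a..b})"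
  using assms continuous_on_Icc_measurable[OF primitive_on_continuous[OF assms]] primitive_onD(1) by auto

lemma lebesgue_on_Omega_integrable:
  fixes f :: "real \<Rightarrow> real"
  assumes "f \<in> borel_measurable (lebesgue_on {-1..1})" "\<And>x. x \<in> {-1..1} \<Longrightarrow> \<bar>f x\<bar> \<le> K"
  shows "integrable (lebesgue_on Omega) f" "(LINT x|lebesgue_on Omega. f x) = integral {-1..1} f"
proof -
  have "f absolutely_integrable_on {-1..1}" by (rule bounded_measurable_absolutely_integrable[OF assms])
  then have "f absolutely_integrable_on Omega" by (rule set_integrable_subset) auto
  then show i: "integrable (lebesgue_on Omega) f" by (simp add: integrable_restrict_space set_integrable_def)
  show "(LINT x|lebesgue_on Omega. f x) = integral {-1..1} f"
    using lebesgue_integral_eq_integral[OF i] integral_open_interval_real[of "-1" 1 f] by simp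
qed

lemma test_function_deriv:
  assumes "\<phi> \<in> test_functions"
  shows "(\<phi> has_real_derivative deriv \<phi> x) (at x)" "continuous_on UNIV (deriv \<phi>)" "\<phi> (-1) = 0" "\<phi> 1 = 0"
proof -
  from assms have C1: "\<phi> C1_differentiable_on UNIV" and S: "closure {x. \<phi> x \<noteq> 0} \<subseteq> Omega"
    by (auto simp: test_functions_def)
  obtain D where D: "\<And>x. (\<phi> has_vector_derivative D x) (at x)" "continuous_on UNIV D"
    using C1 unfolding C1_differentiable_on_def by auto
  have D': "(\<phi> has_real_derivative D x) (at x)" for x
    using D(1)[of x] by (simp add: has_real_derivative_iff_has_vector_derivative)
  then have *: "deriv \<phi> = D" by (auto intro: DERIV_imp_deriv)
  show "(\<phi> has_real_derivative deriv \<phi> x) (at x)" "continuous_on UNIV (deriv \<phi>)"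
    using D' D(2) by (simp_all add: *)
  show "\<phi> (-1) = 0" "\<phi> 1 = 0" using S closure_subset[of "{x. \<phi> x \<noteq> 0}"] by auto
qed

lemma test_function_primitive: "\<phi> \<in> test_functions \<Longrightarrow> primitive_on (-1) 1 \<phi> (deriv \<phi>)"
  using test_function_deriv[of \<phi>]
  by (intro primitive_on_C1) (auto intro: continuous_on_subset DERIV_continuous_on has_field_derivative_at_within)

lemma locally_integrable_bounded_measurable:
  fixes f :: "real \<Rightarrow> real"
  assumes "f \<in> borel_measurable (lebesgue_on {-1..1})" "\<And>x. x \<in> {-1..1} \<Longrightarrow> \<bar>f x\<bar> \<le> K"
  shows "locally_integrable f"
  unfolding locally_integrable_def
proof (intro allI impI)
  fix S :: "real set" assume S: "compact S \<and> S \<subseteq> Omega"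
  have "f absolutely_integrable_on {-1..1}" by (rule bounded_measurable_absolutely_integrable[OF assms])
  then show "f absolutely_integrable_on S"
    by (rule set_integrable_subset) (use S in \<open>auto simp: compact_imp_closed\<close>)
qed

lemma primitive_on_imp_weak_derivative:
  assumes "primitive_on (-1) 1 F f"
  shows "weak_derivative F f"
  unfolding weak_derivative_def
proof (intro conjI ballI)
  obtain K where K: "\<And>x. x \<in> {-1..1} \<Longrightarrow> \<bar>f x\<bar> \<le> K" using primitive_onD(2)[OF assms] by blast
  obtain B where B: "\<And>x. x \<in> {-1..1} \<Longrightarrow> \<bar>F x\<bar> \<le> B"
    using continuous_on_Icc_bounded[OF primitive_on_continuous[OF assms]] by blast
  note m = primitive_on_bounded_measurable[OF assms]
  show "locally_integrable F" "locally_integrable f"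
    using locally_integrable_bounded_measurable[OF m(1) K] locally_integrable_bounded_measurable[OF m(2) B] by auto
  fix \<phi> assume \<phi>: "\<phi> \<in> test_functions"
  note p = test_function_primitive[OF \<phi>]
  obtain L where L: "\<And>x. x \<in> {-1..1} \<Longrightarrow> \<bar>deriv \<phi> x\<bar> \<le> L" using primitive_onD(2)[OF p] by blast
  obtain M where M: "\<And>x. x \<in> {-1..1} \<Longrightarrow> \<bar>\<phi> x\<bar> \<le> M"
    using continuous_on_Icc_bounded[OF primitive_on_continuous[OF p]] by blast
  note m' = primitive_on_bounded_measurable[OF p]
  have 1: "(\<lambda>x. F x * deriv \<phi> x) \<in> borel_measurable (lebesgue_on {-1..1})"
    "(\<lambda>x. f x * \<phi> x) \<in> borel_measurable (lebesgue_on {-1..1})"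
    using m m' by (auto intro: borel_measurable_times)
  have 2: "\<bar>F x * deriv \<phi> x\<bar> \<le> \<bar>B\<bar> * \<bar>L\<bar>" "\<bar>f x * \<phi> x\<bar> \<le> \<bar>K\<bar> * \<bar>M\<bar>" if "x \<in> {-1..1}" for x
    unfolding abs_mult using B[OF that] L[OF that] M[OF that] K[OF that] by (auto intro!: mult_mono)
  have "((\<lambda>x. f x * \<phi> x + F x * deriv \<phi> x) has_integral F 1 * \<phi> 1 - F (-1) * \<phi> (-1)) {-1..1}"
    by (rule primitive_on_has_integral[OF primitive_on_mult[OF assms p]]) auto
  then have "integral {-1..1} (\<lambda>x. f x * \<phi> x + F x * deriv \<phi> x) = 0"
    using test_function_deriv(3,4)[OF \<phi>] by (simp add: integral_unique)
  moreover have "integral {-1..1} (\<lambda>x. f x * \<phi> x + F x * deriv \<phi> x) =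
      integral {-1..1} (\<lambda>x. f x * \<phi> x) + integral {-1..1} (\<lambda>x. F x * deriv \<phi> x)"
    using bounded_measurable_absolutely_integrable[OF 1(1) 2(1)] bounded_measurable_absolutely_integrable[OF 1(2) 2(2)]
    by (intro Henstock_Kurzweil_Integration.integral_add) (auto simp: absolutely_integrable_on_def)
  ultimately show "(LINT x|lebesgue_on Omega. F x * deriv \<phi> x) = - (LINT x|lebesgue_on Omega. f x * \<phi> x)"
    using lebesgue_on_Omega_integrable(2)[OF 1(1) 2(1)] lebesgue_on_Omega_integrable(2)[OF 1(2) 2(2)] by simp
qed

text \<open>
  \<open>ramp\<close> is a twice continuously differentiable version of the positive part, with derivative
  \<open>smooth_step\<close> and second derivative \<open>bump\<close>, a probability density on \<open>[-1,1]\<close>.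
\<close>
definition bump :: "real \<Rightarrow> real" where
  "bump s = (if \<bar>s\<bar> \<le> 1 then 3/4 * (1 - s\<^sup>2) else 0)"
definition smooth_step :: "real \<Rightarrow> real" where
  "smooth_step s = (if s \<le> -1 then 0 else if s \<le> 1 then (2 + 3 * s - s^3) / 4 else 1)"
definition ramp :: "real \<Rightarrow> real" where
  "ramp s = (if s \<le> -1 then 0 else if s \<le> 1 then (s + 1)^3 * (3 - s) / 16 else s)"

lemma continuous_bump: "continuous_on UNIV bump"
proof -
  have *: "bump = (\<lambda>s. max 0 (3/4 * (1 - s\<^sup>2)))"
  proof
    fix s :: real
    have "\<bar>s\<bar> \<le> 1 \<longleftrightarrow> s\<^sup>2 \<le> 1" by (simp add: abs_square_le_1)
    then show "bump s = max 0 (3/4 * (1 - s\<^sup>2))" by (auto simp: bump_def max_def)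
  qed
  show ?thesis unfolding * by (intro continuous_intros)
qed

lemma DERIV_If_le:
  fixes f g :: "real \<Rightarrow> real"
  assumes "\<And>x. x \<le> c \<Longrightarrow> (f has_real_derivative D x) (at x)"
    "\<And>x. c \<le> x \<Longrightarrow> (g has_real_derivative E x) (at x)" "f c = g c" "D c = E c"
  shows "((\<lambda>x. if x \<le> c then f x else g x) has_real_derivative (if x \<le> c then D x else E x)) (at x)"
proof -
  have "((\<lambda>x. if x \<in> {..c} then f x else g x) has_vector_derivative (if x \<in> {..c} then D x else E x)) (at x within UNIV)"
    by (rule has_vector_derivative_If_within_closures[where T = "{c<..}"])
      (use assms in \<open>auto simp: has_real_derivative_iff_has_vector_derivative intro: has_vector_derivative_at_within\<close>)
  then show ?thesis by (simp add: has_real_derivative_iff_has_vector_derivative)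
qed

lemma DERIV_smooth_step: "(smooth_step has_real_derivative bump s) (at s)"
proof -
  have 1: "((\<lambda>s. if s \<le> 1 then (2 + 3 * s - s^3) / 4 else 1) has_real_derivative
      (if s \<le> 1 then 3/4 * (1 - s\<^sup>2) else 0)) (at s)" for s :: real
    by (rule DERIV_If_le) (auto intro!: derivative_eq_intros simp: field_simps)
  have "((\<lambda>s. if s \<le> -1 then 0 else if s \<le> 1 then (2 + 3 * s - s^3) / 4 else 1) has_real_derivative
      (if s \<le> -1 then 0 else if s \<le> 1 then 3/4 * (1 - s\<^sup>2) else 0)) (at s)"
    by (rule DERIV_If_le[OF DERIV_const 1]) auto
  then show ?thesis
    unfolding smooth_step_def [abs_def] by (rule DERIV_cong) (auto simp: bump_def)
qed

lemma DERIV_ramp: "(ramp has_real_derivative smooth_step s) (at s)"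
proof -
  have 1: "((\<lambda>s. if s \<le> 1 then (s + 1)^3 * (3 - s) / 16 else s) has_real_derivative
      (if s \<le> 1 then (2 + 3 * s - s^3) / 4 else 1)) (at s)" for s :: real
    by (rule DERIV_If_le) (auto intro!: derivative_eq_intros simp: field_simps power2_eq_square power3_eq_cube)
  have "((\<lambda>s. if s \<le> -1 then 0 else if s \<le> 1 then (s + 1)^3 * (3 - s) / 16 else s) has_real_derivative
      (if s \<le> -1 then 0 else if s \<le> 1 then (2 + 3 * s - s^3) / 4 else 1)) (at s)"
    by (rule DERIV_If_le[OF DERIV_const 1]) auto
  then show ?thesis
    unfolding ramp_def [abs_def] by (rule DERIV_cong) (auto simp: smooth_step_def)
qed

lemma continuous_smooth_step: "continuous_on S smooth_step"
  by (rule DERIV_continuous_on[OF has_field_derivative_at_within[OF DERIV_smooth_step]])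

lemma bump_bounds: "0 \<le> bump s" "bump s \<le> 1"
proof -
  show "0 \<le> bump s" using abs_square_le_1[of s] by (auto simp: bump_def)
  show "bump s \<le> 1" using zero_le_power2[of s] unfolding bump_def by (simp, linarith)
qed

lemma smooth_step_bounds: "0 \<le> smooth_step s" "smooth_step s \<le> 1"
proof -
  have m: "smooth_step x \<le> smooth_step y" if "x \<le> y" for x y
  proof (rule DERIV_nonneg_imp_nondecreasing[OF that])
    fix t show "\<exists>y. (smooth_step has_real_derivative y) (at t) \<and> 0 \<le> y"
      using DERIV_smooth_step[of t] bump_bounds(1)[of t] by blast
  qed
  have "smooth_step (min s (-1)) = 0" "smooth_step (max s 1) = 1" by (auto simp: smooth_step_def)
  then show "0 \<le> smooth_step s" "smooth_step s \<le> 1" using m[of "min s (-1)" s] m[of s "max s 1"] by auto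
qed

lemma test_functionI:
  assumes "\<And>x. (\<phi> has_real_derivative D x) (at x)" "continuous_on UNIV D"
    "\<And>x. x \<notin> {a..b} \<Longrightarrow> \<phi> x = 0" "-1 < a" "b < 1"
  shows "\<phi> \<in> test_functions" "deriv \<phi> = D"
proof -
  have nz: "{x. \<phi> x \<noteq> 0} \<subseteq> {a..b}" using assms(3) by blast
  then have sub: "closure {x. \<phi> x \<noteq> 0} \<subseteq> {a..b}" by (intro closure_minimal) auto
  moreover have "compact (closure {x. \<phi> x \<noteq> 0})"
    by (simp add: bounded_subset[OF _ nz])
  moreover have "\<phi> C1_differentiable_on UNIV"
    unfolding C1_differentiable_on_def using assms(1,2)
    by (auto simp: has_real_derivative_iff_has_vector_derivative)
  ultimately show "\<phi> \<in> test_functions" using assms(4,5) by (auto simp: test_functions_def)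
  show "deriv \<phi> = D" using assms(1) by (auto intro: DERIV_imp_deriv)
qed

text \<open>
  The rescaled bumps have integral one and concentrate at \<open>a\<close>, so the continuity of \<open>h\<close> at \<open>a\<close> suffices.
\<close>
lemma integral_approximate_identity:
  assumes h: "continuous_on {-1..1} h" and a: "-1 < a" "a < (1::real)"
  shows "((\<lambda>e. integral {-1..1} (\<lambda>t. h t * (bump ((t - a) / e) / e))) \<longlongrightarrow> h a) (at_right 0)"
proof (rule tendstoI)
  fix r :: real assume r: "r > 0"
  have "\<exists>d>0. \<forall>t\<in>{-1..1}. dist t a < d \<longrightarrow> dist (h t) (h a) < r / 2"
    using h a r by (intro continuous_on_iff[THEN iffD1, rule_format]) auto
  then obtain d where d: "d > 0" "\<And>t. t \<in> {-1..1} \<Longrightarrow> \<bar>t - a\<bar> < d \<Longrightarrow> \<bar>h t - h a\<bar> < r / 2"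
    by (auto simp: dist_real_def)
  define e0 where "e0 = min d (min (1 - a) (1 + a))"
  have e0: "e0 > 0" using d a by (auto simp: e0_def)
  have "\<bar>integral {-1..1} (\<lambda>t. h t * (bump ((t - a) / e) / e)) - h a\<bar> < r" if e: "0 < e" "e < e0" for e
  proof -
    let ?k = "\<lambda>t. bump ((t - a) / e) / e"
    have k: "continuous_on {-1..1} ?k"
      using e by (intro continuous_intros continuous_on_compose2[OF continuous_bump]) auto
    have "(?k has_integral smooth_step ((1 - a) / e) - smooth_step ((-1 - a) / e)) {-1..1}"
    proof (rule fundamental_theorem_of_calculus)
      fix t :: real
      have "((\<lambda>t. smooth_step ((t - a) / e)) has_real_derivative bump ((t - a) / e) * (1 / e)) (at t)"
        by (rule DERIV_chain2[OF DERIV_smooth_step]) (use e in \<open>auto intro!: derivative_eq_intros\<close>)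
      then show "((\<lambda>t. smooth_step ((t - a) / e)) has_vector_derivative ?k t) (at t within {-1..1})"
        by (simp add: has_real_derivative_iff_has_vector_derivative has_vector_derivative_at_within)
    qed auto
    moreover have "smooth_step ((1 - a) / e) = 1" "smooth_step ((-1 - a) / e) = 0"
    proof -
      have "1 \<le> (1 - a) / e" "(-1 - a) / e \<le> -1"
        using e by (simp_all add: e0_def pos_le_divide_eq pos_divide_le_eq)
      then show "smooth_step ((1 - a) / e) = 1" "smooth_step ((-1 - a) / e) = 0" by (auto simp: smooth_step_def)
    qed
    ultimately have k1: "(?k has_integral 1) {-1..1}" by simp
    have i: "(\<lambda>t. h t * ?k t) integrable_on {-1..1}"
      by (intro integrable_continuous_real continuous_intros h k)
    have "((\<lambda>t. h t * ?k t - h a * ?k t) has_integral integral {-1..1} (\<lambda>t. h t * ?k t) - h a * 1) {-1..1}"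
      by (intro has_integral_diff has_integral_mult_right k1 integrable_integral i)
    then have 1: "integral {-1..1} (\<lambda>t. h t * ?k t - h a * ?k t) = integral {-1..1} (\<lambda>t. h t * ?k t) - h a"
      by (simp only: mult_1_right integral_unique)
    have "norm (integral {-1..1} (\<lambda>t. h t * ?k t) - h a) \<le> integral {-1..1} (\<lambda>t. r / 2 * ?k t)"
      unfolding 1[symmetric]
    proof (rule integral_norm_bound_integral)
      fix t :: real assume t: "t \<in> {-1..1}"
      show "norm (h t * ?k t - h a * ?k t) \<le> r / 2 * ?k t"
      proof (cases "\<bar>t - a\<bar> < d")
        case True
        have "norm (h t * ?k t - h a * ?k t) = \<bar>h t - h a\<bar> * ?k t"
          unfolding left_diff_distrib[symmetric] real_norm_def abs_mult
          using bump_bounds(1)[of "(t - a) / e"] e by simp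
        also have "\<dots> \<le> r / 2 * ?k t"
          using d(2)[OF t True] bump_bounds(1) e by (intro mult_right_mono) auto
        finally show ?thesis .
      next
        case False
        then have "\<bar>(t - a) / e\<bar> > 1" using e by (auto simp: e0_def abs_divide field_simps)
        then show ?thesis by (simp add: bump_def)
      qed
    qed (intro integrable_continuous_real continuous_intros h k)+
    also have "\<dots> = r / 2" using integral_unique[OF has_integral_mult_right[OF k1, of "r/2"]] by simp
    finally show ?thesis using r by simp
  qed
  then show "\<forall>\<^sub>F e in at_right 0. dist (integral {-1..1} (\<lambda>t. h t * (bump ((t - a) / e) / e))) (h a) < r"
    using e0 by (auto simp: eventually_at_right_field dist_real_def)
qed

section \<open>Regularity of weak solutions and membership in the Sobolev spaces\<close>

text \<open>
  Lebesgue measure is complete, so changing a function on a null set preserves measurability.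
\<close>
lemma measurable_lebesgue_on_AE_eq:
  fixes f g :: "real \<Rightarrow> real"
  assumes g: "g \<in> borel_measurable (lebesgue_on S)" and S: "S \<in> sets lebesgue"
    and ae: "AE x in lebesgue_on S. f x = g x"
  shows "f \<in> borel_measurable (lebesgue_on S)"
proof (rule measurableI)
  fix A :: "real set" assume A: "A \<in> sets borel"
  have s: "S \<inter> space lebesgue \<in> sets lebesgue" using S by simp
  have ae': "AE x in lebesgue. x \<in> S \<longrightarrow> f x = g x" using ae S by (subst (asm) AE_restrict_space_iff) auto
  have "g -` A \<inter> space (lebesgue_on S) \<in> sets (lebesgue_on S)" using g A by (rule measurable_sets)
  then have 1: "g -` A \<inter> S \<in> sets lebesgue" using s by (simp add: sets_restrict_space_iff)
  have 2: "AE x in lebesgue. x \<in> g -` A \<inter> S \<longleftrightarrow> x \<in> f -` A \<inter> S"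
    using ae' by eventually_elim auto
  have "f -` A \<inter> S \<in> sets lebesgue" by (rule completion.in_sets_AE[OF 2 1]) simp
  then show "f -` A \<inter> space (lebesgue_on S) \<in> sets (lebesgue_on S)" using s by (simp add: sets_restrict_space_iff)
qed auto

lemma LINT_Omega_continuous:
  fixes f :: "real \<Rightarrow> real"
  assumes "continuous_on {-1..1} f"
  shows "(LINT x|lebesgue_on Omega. f x) = integral {-1..1} f"
  using continuous_on_Icc_bounded[OF assms] continuous_on_Icc_measurable[OF assms] lebesgue_on_Omega_integrable(2)
  by metis

lemma measurable_Icc_imp_Omega:
  "f \<in> borel_measurable (lebesgue_on {-1..1}) \<Longrightarrow> f \<in> borel_measurable (lebesgue_on Omega)"
  by (rule measurable_restrict_mono) auto

text \<open>
  Let \<open>U0\<close> be a double primitive of \<open>w\<close>.  The continuous function \<open>h = u - U0\<close> satisfies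
  \<open>\<integral> h \<phi>'' = 0\<close> for all admissible \<open>\<phi>\<close>.  Choosing for \<open>\<phi>\<close> a smoothed tent over
  \<open>a < x < b\<close>, whose second derivative tends to a combination of point masses at these three points, shows
  that \<open>h(x)\<close> is the linear interpolation of \<open>h(a)\<close> and \<open>h(b)\<close>.  So \<open>h\<close> is affine, and its slope
  is added to the first primitive of \<open>w\<close>.
\<close>
lemma weak_second_derivative_imp_primitives:
  assumes u: "continuous_on {-1..1} u" and w0: "weak_second_derivative u w0"
    and ae: "AE x in lebesgue_on Omega. w0 x = w x"
    and w: "w \<in> borel_measurable (lebesgue_on {-1..1})" "\<And>x. x \<in> {-1..1} \<Longrightarrow> \<bar>w x\<bar> \<le> K"
  obtains V where "primitive_on (-1) 1 V w" "primitive_on (-1) 1 u V"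
proof -
  obtain v0 where v0: "weak_derivative u v0" "weak_derivative v0 w0" using w0 unfolding weak_second_derivative_def by blast
  define V0 where "V0 x = 0 + integral {-1..x} w" for x
  define U0 where "U0 x = 0 + integral {-1..x} V0" for x
  have V0: "primitive_on (-1) 1 V0 w" unfolding V0_def by (rule primitive_on_integral[OF w])
  have U0: "primitive_on (-1) 1 U0 V0" unfolding U0_def
    by (rule primitive_on_integral_continuous[OF primitive_on_continuous[OF V0]])
  note wd = primitive_on_imp_weak_derivative[OF V0] primitive_on_imp_weak_derivative[OF U0]
  note w' = measurable_Icc_imp_Omega[OF w(1)]
  note w0' = measurable_lebesgue_on_AE_eq[OF w' _ ae]
  define h where "h x = u x - U0 x" for x
  have h: "continuous_on {-1..1} h" unfolding h_def by (intro continuous_intros u primitive_on_continuous[OF U0])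
  have weak: "integral {-1..1} (\<lambda>t. h t * \<theta> t) = 0"
    if "\<And>t. (\<phi> has_real_derivative \<psi> t) (at t)" "\<And>t. (\<psi> has_real_derivative \<theta> t) (at t)"
      "continuous_on UNIV \<theta>" "\<And>t. t \<notin> {a..b} \<Longrightarrow> \<phi> t = 0" "\<And>t. t \<notin> {a..b} \<Longrightarrow> \<psi> t = 0" "-1 < a" "b < 1"
    for \<phi> \<psi> \<theta> a b
  proof -
    have "continuous_on UNIV \<psi>" by (rule DERIV_continuous_on[OF has_field_derivative_at_within[OF that(2)]])
    note t0 = test_functionI[OF that(1) this that(4,6,7)] and t1 = test_functionI[OF that(2,3,5-7)]
    have c: "continuous_on {-1..1} \<theta>" using that(3) continuous_on_subset by blast
    have 1: "(LINT x|lebesgue_on Omega. u x * \<theta> x) = (LINT x|lebesgue_on Omega. w0 x * \<phi> x)"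
      using v0 t0 t1 unfolding weak_derivative_def by force
    have 2: "(LINT x|lebesgue_on Omega. U0 x * \<theta> x) = (LINT x|lebesgue_on Omega. w x * \<phi> x)"
      using wd t0 t1 unfolding weak_derivative_def by force
    have m: "\<phi> \<in> borel_measurable (lebesgue_on Omega)"
      by (rule measurable_Icc_imp_Omega[OF primitive_on_bounded_measurable(2)[OF test_function_primitive[OF t0(1)]]])
    have 3: "(LINT x|lebesgue_on Omega. w0 x * \<phi> x) = (LINT x|lebesgue_on Omega. w x * \<phi> x)"
      by (rule integral_cong_AE) (use m w' w0' ae in \<open>auto intro!: borel_measurable_times\<close>)
    have "integral {-1..1} (\<lambda>t. h t * \<theta> t) = integral {-1..1} (\<lambda>t. u t * \<theta> t - U0 t * \<theta> t)"
      by (simp add: h_def left_diff_distrib)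
    also have "\<dots> = integral {-1..1} (\<lambda>t. u t * \<theta> t) - integral {-1..1} (\<lambda>t. U0 t * \<theta> t)"
      by (intro Henstock_Kurzweil_Integration.integral_diff integrable_continuous_real continuous_intros u c primitive_on_continuous[OF U0])
    also have "\<dots> = (LINT x|lebesgue_on Omega. u x * \<theta> x) - (LINT x|lebesgue_on Omega. U0 x * \<theta> x)"
      by (subst (1 2) LINT_Omega_continuous) (auto intro!: continuous_intros u c primitive_on_continuous[OF U0])
    finally show ?thesis using 1 2 3 by simp
  qed
  \<comment> \<open>Testing with a smoothed tent function whose second derivative concentrates at three points.\<close>
  have three: "(b - x) * h a - (b - a) * h x + (x - a) * h b = 0" if abx: "-1 < a" "a < x" "x < b" "b < 1" for a x b
  proof -
    let ?I = "\<lambda>c e. integral {-1..1} (\<lambda>t. h t * (bump ((t - c) / e) / e))"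
    have "((\<lambda>e. (b - x) * ?I a e - (b - a) * ?I x e + (x - a) * ?I b e) \<longlongrightarrow>
        (b - x) * h a - (b - a) * h x + (x - a) * h b) (at_right 0)"
      using abx by (intro tendsto_intros integral_approximate_identity h) auto
    moreover have "((\<lambda>e. (b - x) * ?I a e - (b - a) * ?I x e + (x - a) * ?I b e) \<longlongrightarrow> 0) (at_right 0)"
    proof (rule tendsto_eventually)
      have "(b - x) * ?I a e - (b - a) * ?I x e + (x - a) * ?I b e = 0"
        if e: "0 < e" "e < min (1 - b) (1 + a)" for e
      proof -
        let ?c = "\<lambda>F t. (b - x) * F ((t - a) / e) - (b - a) * F ((t - x) / e) + (x - a) * (F ((t - b) / e) :: real)"
        have d: "((\<lambda>t. F ((t - c) / e)) has_real_derivative f ((t - c) / e) / e) (at t)"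
          if "\<And>s. (F has_real_derivative f s) (at s)" for F f c t
        proof -
          have "((\<lambda>t. F ((t - c) / e)) has_real_derivative f ((t - c) / e) * (1 / e)) (at t)"
            by (rule DERIV_chain2[OF that]) (use e in \<open>auto intro!: derivative_eq_intros\<close>)
          then show ?thesis by simp
        qed
        have kd: "continuous_on S (\<lambda>t. bump ((t - c) / e) / e)" for S c
          using e by (intro continuous_intros continuous_on_compose2[OF continuous_bump]) auto
        have "integral {-1..1} (\<lambda>t. h t * (?c bump t / e)) = 0"
        proof (rule weak[where \<phi> = "\<lambda>t. e * ?c ramp t" and \<psi> = "?c smooth_step" and a = "a - e" and b = "b + e"])
          fix t
          have "((\<lambda>t. ?c ramp t) has_real_derivative
              (b - x) * (smooth_step ((t - a) / e) / e) - (b - a) * (smooth_step ((t - x) / e) / e) + (x - a) * (smooth_step ((t - b) / e) / e)) (at t)"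
            by (intro DERIV_add DERIV_diff DERIV_cmult d DERIV_ramp)
          from DERIV_cmult[OF this, of e]
          show "((\<lambda>t. e * ?c ramp t) has_real_derivative ?c smooth_step t) (at t)"
            by (rule DERIV_cong) (use e in \<open>simp add: field_simps\<close>)
          have "((\<lambda>t. ?c smooth_step t) has_real_derivative
              (b - x) * (bump ((t - a) / e) / e) - (b - a) * (bump ((t - x) / e) / e) + (x - a) * (bump ((t - b) / e) / e)) (at t)"
            by (intro DERIV_add DERIV_diff DERIV_cmult d DERIV_smooth_step)
          then show "(?c smooth_step has_real_derivative ?c bump t / e) (at t)"
            by (rule DERIV_cong) (simp add: add_divide_distrib diff_divide_distrib)
        next
          fix t assume t: "t \<notin> {a - e..b + e}"
          have "?c ramp t = 0 \<and> ?c smooth_step t = 0"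
          proof (cases "t < a - e")
            case True
            then have "(t - a) / e \<le> -1" "(t - x) / e \<le> -1" "(t - b) / e \<le> -1"
              using e abx by (auto simp: pos_divide_le_eq)
            then show ?thesis by (simp add: ramp_def smooth_step_def)
          next
            case False
            then have "1 < (t - a) / e" "1 < (t - x) / e" "1 < (t - b) / e"
              using t e abx by (auto simp: pos_less_divide_eq)
            then have 1: "?c ramp t = (b - x) * ((t - a) / e) - (b - a) * ((t - x) / e) + (x - a) * ((t - b) / e)"
              and 2: "?c smooth_step t = 0"
              by (simp_all add: ramp_def smooth_step_def)
            have "?c ramp t = ((b - x) * (t - a) - (b - a) * (t - x) + (x - a) * (t - b)) / e"
              unfolding 1 using e by (simp add: field_simps)
            moreover have "(b - x) * (t - a) - (b - a) * (t - x) + (x - a) * (t - b) = 0" by algebra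
            ultimately show ?thesis using 2 by simp
          qed
          then show "e * ?c ramp t = 0" "?c smooth_step t = 0" by simp_all
        next
          have "continuous_on UNIV (\<lambda>t. (b - x) * (bump ((t - a) / e) / e) - (b - a) * (bump ((t - x) / e) / e) + (x - a) * (bump ((t - b) / e) / e))"
            by (intro continuous_intros kd)
          then show "continuous_on UNIV (\<lambda>t. ?c bump t / e)"
            by (simp add: add_divide_distrib diff_divide_distrib)
        qed (use e in auto)
        also have "(\<lambda>t. h t * (?c bump t / e)) = (\<lambda>t. (b - x) * (h t * (bump ((t - a) / e) / e))
            - (b - a) * (h t * (bump ((t - x) / e) / e)) + (x - a) * (h t * (bump ((t - b) / e) / e)))"
          by (intro ext) (simp add: algebra_simps add_divide_distrib diff_divide_distrib)
        also have "integral {-1..1} \<dots> = (b - x) * ?I a e - (b - a) * ?I x e + (x - a) * ?I b e"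
          by (intro integral_unique has_integral_add has_integral_diff has_integral_mult_right integrable_integral
              integrable_continuous_real continuous_on_mult h kd)
        finally show ?thesis .
      qed
      then show "\<forall>\<^sub>F e in at_right 0. (b - x) * ?I a e - (b - a) * ?I x e + (x - a) * ?I b e = 0"
        using abx by (auto simp: eventually_at_right_field intro!: exI[of _ "min (1 - b) (1 + a)"])
    qed
    ultimately show ?thesis using tendsto_unique trivial_limit_at_right_real by blast
  qed
  \<comment> \<open>Letting the outer two points tend to the ends of the interval.\<close>
  have aff: "(1 - x) * h (-1) - 2 * h x + (x + 1) * h 1 = 0" if x: "-1 < x" "x < 1" for x
  proof -
    define r where "r = min (1 - x) (1 + x)"
    have r: "0 < r" using x by (auto simp: r_def)
    have cl: "closure {0<..<r} = {0..r}" using r by simp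
    let ?k = "\<lambda>s. ((1 - s) - x) * h (-1 + s) - ((1 - s) - (-1 + s)) * h x + (x - (-1 + s)) * h (1 - s)"
    have "?k 0 = 0"
    proof (rule continuous_constant_on_closure[where S = "{0<..<r}" and f = ?k])
      show "continuous_on (closure {0<..<r}) ?k" unfolding cl
        by (intro continuous_intros continuous_on_compose2[OF h]) (auto simp: r_def)
      show "?k s = 0" if "s \<in> {0<..<r}" for s
        by (rule three) (use that x in \<open>auto simp: r_def\<close>)
      show "0 \<in> closure {0<..<r}" using r by (simp add: cl)
    qed
    then show ?thesis by simp
  qed
  define \<beta> where "\<beta> = (h 1 - h (-1)) / 2"
  have hx: "h x = (h (-1) + \<beta>) + \<beta> * x" if x: "x \<in> {-1..1}" for x
  proof -
    consider "x = -1" | "x = 1" | "-1 < x" "x < 1" using x by force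
    then show ?thesis using aff[of x] by cases (auto simp: \<beta>_def field_simps)
  qed
  have lin: "primitive_on (-1) 1 (\<lambda>x. (h (-1) + \<beta>) + \<beta> * x) (\<lambda>_. \<beta>)"
    by (rule primitive_on_C1) (auto intro!: derivative_eq_intros continuous_intros)
  show thesis
  proof (rule that[of "\<lambda>x. V0 x + \<beta>"])
    show "primitive_on (-1) 1 (\<lambda>x. V0 x + \<beta>) w"
      using primitive_on_add[OF V0 primitive_on_const[of _ _ \<beta>]] by simp
    show "primitive_on (-1) 1 u (\<lambda>x. V0 x + \<beta>)"
      by (rule primitive_on_cong[OF primitive_on_add[OF U0 lin]]) (auto simp: hx[symmetric], simp add: h_def)
  qed
qed


lemma Lp_bounded:
  fixes f :: "real \<Rightarrow> real"
  assumes "f \<in> borel_measurable (lebesgue_on {-1..1})" "\<And>x. x \<in> {-1..1} \<Longrightarrow> \<bar>f x\<bar> \<le> K" "0 < p"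
  shows "f \<in> Lp p"
proof -
  have "\<bar>\<bar>f x\<bar> powr p\<bar> \<le> K powr p" if "x \<in> {-1..1}" for x
    using assms(2)[OF that] assms(3) by (simp add: powr_mono2)
  moreover have "(\<lambda>x. \<bar>f x\<bar> powr p) \<in> borel_measurable (lebesgue_on {-1..1})"
    using assms(1) by measurable
  ultimately show ?thesis
    unfolding Lp_def using lebesgue_on_Omega_integrable(1) measurable_Icc_imp_Omega[OF assms(1)] by blast
qed

lemma Lp_norm_tendsto_zero:
  fixes f :: "nat \<Rightarrow> real \<Rightarrow> real"
  assumes "\<And>n. f n \<in> borel_measurable (lebesgue_on Omega)" "\<And>n x. x \<in> Omega \<Longrightarrow> \<bar>f n x\<bar> \<le> K"
    "\<And>x. x \<in> Omega \<Longrightarrow> (\<lambda>n. f n x) \<longlonglongrightarrow> 0" "0 < p"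
  shows "(\<lambda>n. Lp_norm p (f n)) \<longlonglongrightarrow> 0"
proof -
  have "(\<lambda>n. LINT x|lebesgue_on Omega. \<bar>f n x\<bar> powr p) \<longlonglongrightarrow> (LINT x|lebesgue_on Omega. 0)"
  proof (rule integral_dominated_convergence[where w = "\<lambda>_. K powr p"])
    show "integrable (lebesgue_on Omega) (\<lambda>_. K powr p)"
      by (rule lebesgue_on_Omega_integrable(1)[where K = "K powr p"]) auto
    show "AE x in lebesgue_on Omega. (\<lambda>n. \<bar>f n x\<bar> powr p) \<longlonglongrightarrow> 0"
    proof (rule AE_I2)
      fix x assume "x \<in> space (lebesgue_on Omega)"
      then have "(\<lambda>n. f n x) \<longlonglongrightarrow> 0" using assms(3) by simp
      then have "(\<lambda>n. \<bar>f n x\<bar>) \<longlonglongrightarrow> 0" by (simp add: tendsto_rabs_zero_iff)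
      then show "(\<lambda>n. \<bar>f n x\<bar> powr p) \<longlonglongrightarrow> 0"
        by (rule tendsto_zero_powrI[OF _ tendsto_const]) (use assms(4) in auto)
    qed
    show "AE x in lebesgue_on Omega. norm (\<bar>f n x\<bar> powr p) \<le> K powr p" for n
      by (rule AE_I2) (use assms(2,4) in \<open>auto intro!: powr_mono2\<close>)
    show "(\<lambda>x. \<bar>f n x\<bar> powr p) \<in> borel_measurable (lebesgue_on Omega)" for n
      using assms(1)[of n] by measurable
  qed auto
  then have "(\<lambda>n. LINT x|lebesgue_on Omega. \<bar>f n x\<bar> powr p) \<longlonglongrightarrow> 0" by simp
  then show ?thesis unfolding Lp_norm_def
    by (rule tendsto_zero_powrI[OF _ tendsto_const]) (use assms(4) in auto)
qed

text \<open>
  The approximating test functions are \<open>u\<close> times a cutoff that vanishes where \<open>1 - x\<^sup>2 \<le> 1/n\<close> and is one where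
  \<open>1 - x\<^sup>2 \<ge> 3/n\<close>.  The derivative of the cutoff is of order \<open>n\<close>, but \<open>u\<close> is of order
  \<open>1/n\<close> where it does not vanish, because \<open>u\<close> is Lipschitz with zero boundary values.  Hence the error in the
  derivative is bounded and tends to zero at every interior point, and dominated convergence applies.
\<close>
lemma dirichlet_space_primitives:
  assumes p: "0 < p" and V: "primitive_on (-1) 1 V w" and u: "primitive_on (-1) 1 u V" and bc: "u (-1) = 0" "u 1 = 0"
  shows "u \<in> dirichlet_space p"
proof -
  have LP: "F \<in> Lp p" "f \<in> Lp p" if pr: "primitive_on (-1) 1 F f" for F f :: "real \<Rightarrow> real"
  proof -
    obtain K where "\<And>x. x \<in> {-1..1} \<Longrightarrow> \<bar>f x\<bar> \<le> K" using primitive_onD(2)[OF pr] by blast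
    then show "f \<in> Lp p" by (rule Lp_bounded[OF primitive_onD(1)[OF pr] _ p])
    obtain K where "\<And>x. x \<in> {-1..1} \<Longrightarrow> \<bar>F x\<bar> \<le> K"
      using continuous_on_Icc_bounded[OF primitive_on_continuous[OF pr]] by blast
    then show "F \<in> Lp p" by (rule Lp_bounded[OF primitive_on_bounded_measurable(2)[OF pr] _ p])
  qed
  note wd = primitive_on_imp_weak_derivative[OF V] primitive_on_imp_weak_derivative[OF u]
  have uc: "continuous_on {-1..1} u" and Vc: "continuous_on {-1..1} V"
    using V u by (auto intro: primitive_on_continuous)
  obtain L where L: "0 \<le> L" "\<And>x y. x \<in> {-1..1} \<Longrightarrow> y \<in> {-1..1} \<Longrightarrow> \<bar>u x - u y\<bar> \<le> L * \<bar>x - y\<bar>"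
    "\<And>x. x \<in> {-1..1} \<Longrightarrow> \<bar>V x\<bar> \<le> L" using primitive_on_Lipschitz[OF u] by blast
  have ub: "\<bar>u x\<bar> \<le> L * (1 - x\<^sup>2)" if x: "x \<in> {-1..1}" for x
  proof (cases "x \<ge> 0")
    case True
    have "\<bar>u x\<bar> \<le> L * (1 - x)" using L(2)[of x 1] x bc by auto
    also have "\<dots> \<le> L * (1 - x\<^sup>2)"
      using True x L(1) by (intro mult_left_mono) (auto simp: power2_eq_square mult_left_le_one_le)
    finally show ?thesis .
  next
    case False
    have "\<bar>u x\<bar> \<le> L * (1 + x)" using L(2)[of x "-1"] x bc by (auto simp: add.commute)
    also have "\<dots> \<le> L * (1 - x\<^sup>2)"
    proof (rule mult_left_mono)
      have "0 \<le> (1 + x) * (- x)" using False x by (intro mult_nonneg_nonneg) auto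
      then show "1 + x \<le> 1 - x\<^sup>2" by (simp add: power2_eq_square algebra_simps)
    qed (rule L(1))
    finally show ?thesis .
  qed
  \<comment> \<open>Composing with the projection to \<open>[-1,1]\<close> makes the test functions and their derivatives continuous on the
    whole line.\<close>
  define cl where "cl x = max (-1) (min 1 (x::real))" for x
  have cl: "cl x \<in> {-1..1}" "x \<in> {-1..1} \<Longrightarrow> cl x = x" for x by (auto simp: cl_def)
  have clc: "continuous_on UNIV cl" unfolding cl_def by (intro continuous_intros)
  define N where "N n = real (Suc n)" for n
  have N: "N n > 0" for n by (simp add: N_def)
  define s where "s n x = N n * (1 - x\<^sup>2) - 2" for n and x :: real
  define \<phi> where "\<phi> n x = u (cl x) * smooth_step (s n x)" for n x
  define D where "D n x = V (cl x) * smooth_step (s n x) + u (cl x) * (bump (s n x) * (N n * (- 2 * x)))" for n x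
  have sc: "continuous_on UNIV (s n)" for n unfolding s_def by (intro continuous_intros)
  have Dc: "continuous_on UNIV (D n)" for n
    unfolding D_def using cl(1)
    by (intro continuous_intros continuous_on_compose2[OF uc clc] continuous_on_compose2[OF Vc clc]
        continuous_on_compose2[OF continuous_smooth_step sc] continuous_on_compose2[OF continuous_bump sc]) auto
  have \<phi>c: "continuous_on UNIV (\<phi> n)" for n
    unfolding \<phi>_def using cl(1)
    by (intro continuous_intros continuous_on_compose2[OF uc clc] continuous_on_compose2[OF continuous_smooth_step sc]) auto
  have out: "\<phi> n x = 0" "D n x = 0" if "s n x < -1" for n x
    using that by (auto simp: \<phi>_def D_def smooth_step_def bump_def)
  have \<phi>D: "(\<phi> n has_real_derivative D n x) (at x)" for n x
  proof (cases "x \<in> Omega")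
    case True
    have ux: "(u has_real_derivative V x) (at x)" using primitive_on_DERIV[OF u Vc] True by auto
    have sx: "(s n has_real_derivative N n * (- 2 * x)) (at x)"
      unfolding s_def by (auto intro!: derivative_eq_intros)
    have "((\<lambda>x. u x * smooth_step (s n x)) has_real_derivative
        V x * smooth_step (s n x) + u x * (bump (s n x) * (N n * (- 2 * x)))) (at x)"
      using DERIV_mult[OF ux DERIV_chain2[OF DERIV_smooth_step sx]] by (rule DERIV_cong) simp
    then have "((\<lambda>x. u x * smooth_step (s n x)) has_real_derivative D n x) (at x)"
      using True by (simp add: D_def cl)
    then show ?thesis
      by (rule has_field_derivative_transform_within_open[OF _ open_greaterThanLessThan True])
        (auto simp: \<phi>_def cl)
  next
    case False
    then have "1 \<le> \<bar>x\<bar>" by auto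
    then have "1 \<le> x\<^sup>2" using abs_square_less_1[of x] by linarith
    then have sx: "s n x < -1" using N[of n] mult_nonneg_nonpos[of "N n" "1 - x\<^sup>2"] by (simp add: s_def)
    have "open {y. s n y < -1}" using sc by (intro open_Collect_less continuous_intros) auto
    then show ?thesis
      using has_field_derivative_transform_within_open[of "\<lambda>_. 0" "D n x" x "{y. s n y < -1}" "\<phi> n"] sx out
      by auto
  qed
  have test: "\<phi> n \<in> test_functions" "deriv (\<phi> n) = D n" for n
  proof -
    define r where "r = sqrt (1 - 1 / (N n + 1))"
    have r: "0 \<le> r" "r < 1" "r\<^sup>2 = 1 - 1 / (N n + 1)" using N[of n] by (auto simp: r_def field_simps real_less_lsqrt)
    have z: "\<phi> n x = 0" if "x \<notin> {-r..r}" for x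
    proof -
      have "r\<^sup>2 < \<bar>x\<bar>\<^sup>2" using that r by (intro power_strict_mono) auto
      then have "1 - x\<^sup>2 < 1 / (N n + 1)" using r(3) by simp
      then have "N n * (1 - x\<^sup>2) \<le> N n * (1 / (N n + 1))" using N[of n] by (intro mult_left_mono) auto
      also have "\<dots> < 1" using N[of n] by (simp add: field_simps)
      finally show ?thesis by (intro out) (simp add: s_def)
    qed
    show "\<phi> n \<in> test_functions" "deriv (\<phi> n) = D n"
      using test_functionI[of "\<phi> n" "D n" "-r" r, OF \<phi>D Dc z] r by auto
  qed
  have ev: "\<forall>\<^sub>F n in sequentially. 1 < s n x" if x: "x \<in> Omega" for x
  proof -
    have "\<bar>x\<bar> < 1" using x by auto
    then have "x\<^sup>2 < 1" by (simp add: abs_square_less_1)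
    then obtain k :: nat where k: "3 / (1 - x\<^sup>2) < real k" using reals_Archimedean2 by blast
    have "1 < s n x" if "k \<le> n" for n
    proof -
      have "3 / (1 - x\<^sup>2) < N n" using k that by (simp add: N_def)
      then show ?thesis using \<open>x\<^sup>2 < 1\<close> by (simp add: s_def pos_divide_less_eq)
    qed
    then show ?thesis by (auto simp: eventually_sequentially)
  qed
  have lim: "(\<lambda>n. \<phi> n x - u x) \<longlonglongrightarrow> 0" "(\<lambda>n. D n x - V x) \<longlonglongrightarrow> 0" if x: "x \<in> Omega" for x
    by (rule tendsto_eventually, use ev[OF x] in eventually_elim,
      use x in \<open>simp add: \<phi>_def D_def cl smooth_step_def bump_def\<close>)+
  obtain B where B: "\<And>x. x \<in> {-1..1} \<Longrightarrow> \<bar>u x\<bar> \<le> B" using continuous_on_Icc_bounded[OF uc] by blast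
  have b1: "\<bar>\<phi> n x - u x\<bar> \<le> B" if x: "x \<in> Omega" for n x
  proof -
    have "\<phi> n x - u x = - (u x * (1 - smooth_step (s n x)))" using x by (simp add: \<phi>_def cl algebra_simps)
    then have "\<bar>\<phi> n x - u x\<bar> = \<bar>u x\<bar> * (1 - smooth_step (s n x))"
      using smooth_step_bounds[of "s n x"] by (simp add: abs_mult)
    also have "\<dots> \<le> \<bar>u x\<bar> * 1" using smooth_step_bounds[of "s n x"] by (intro mult_left_mono) auto
    finally show ?thesis using B[of x] x by auto
  qed
  have b2: "\<bar>D n x - V x\<bar> \<le> L + 6 * L" if x: "x \<in> Omega" for n x
  proof -
    have e: "D n x - V x = - (V x * (1 - smooth_step (s n x))) + u x * (bump (s n x) * (N n * (- 2 * x)))"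
      using x by (simp add: D_def cl algebra_simps)
    have "\<bar>V x * (1 - smooth_step (s n x))\<bar> \<le> L * 1"
      unfolding abs_mult using L(1) L(3)[of x] x smooth_step_bounds[of "s n x"] by (intro mult_mono) auto
    moreover have "\<bar>u x * (bump (s n x) * (N n * (- 2 * x)))\<bar> \<le> 6 * L"
    proof (cases "\<bar>s n x\<bar> \<le> 1")
      case True
      then have "N n * (1 - x\<^sup>2) \<le> 3" by (simp add: s_def)
      then have "L * (N n * (1 - x\<^sup>2)) \<le> L * 3" using L(1) by (rule mult_left_mono)
      moreover have "\<bar>u x\<bar> * N n \<le> L * (1 - x\<^sup>2) * N n" using ub[of x] x N[of n] by (intro mult_right_mono) auto
      ultimately have un: "\<bar>u x\<bar> * N n \<le> 3 * L" by (simp add: algebra_simps)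
      have "\<bar>u x * (bump (s n x) * (N n * (- 2 * x)))\<bar> = (\<bar>u x\<bar> * N n) * (bump (s n x) * (2 * \<bar>x\<bar>))"
        using N[of n] bump_bounds(1)[of "s n x"] by (simp add: abs_mult)
      also have "\<dots> \<le> (3 * L) * (1 * (2 * 1))"
      proof (rule mult_mono[OF un])
        show "bump (s n x) * (2 * \<bar>x\<bar>) \<le> 1 * (2 * 1)"
          using bump_bounds[of "s n x"] x by (intro mult_mono) auto
      qed (use bump_bounds[of "s n x"] L(1) in auto)
      finally show ?thesis by simp
    next
      case False
      then show ?thesis using L(1) by (simp add: bump_def)
    qed
    ultimately show ?thesis unfolding e by linarith
  qed
  have meas: "f \<in> borel_measurable (lebesgue_on Omega)" if "continuous_on UNIV f" for f :: "real \<Rightarrow> real"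
    by (rule continuous_imp_measurable_on_sets_lebesgue) (use that continuous_on_subset in auto)
  have "(\<lambda>n. Lp_norm p (\<lambda>x. \<phi> n x - u x) + Lp_norm p (\<lambda>x. deriv (\<phi> n) x - V x)) \<longlonglongrightarrow> 0 + 0"
  proof (intro tendsto_add)
    show "(\<lambda>n. Lp_norm p (\<lambda>x. \<phi> n x - u x)) \<longlonglongrightarrow> 0"
      by (rule Lp_norm_tendsto_zero[OF _ b1 lim(1) p])
        (intro borel_measurable_diff meas \<phi>c measurable_Icc_imp_Omega primitive_on_bounded_measurable(2)[OF u])
    show "(\<lambda>n. Lp_norm p (\<lambda>x. deriv (\<phi> n) x - V x)) \<longlonglongrightarrow> 0"
      unfolding test by (rule Lp_norm_tendsto_zero[OF _ b2 lim(2) p])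
        (intro borel_measurable_diff meas Dc measurable_Icc_imp_Omega primitive_on_bounded_measurable(2)[OF V])
  qed
  then have "u \<in> W01p p"
    unfolding W01p_def using LP[OF u] wd test(1) by auto
  moreover have "u \<in> W2p p"
    unfolding W2p_def W1p_def using LP[OF u] LP[OF V] wd by auto
  ultimately show ?thesis unfolding dirichlet_space_def using uc bc by simp
qed

text \<open>
  Replacing a weight by a representative with pointwise bounds turns the differential equations, which hold almost
  everywhere, into pointwise formulas for the second derivative.
\<close>
lemma Linf_plus_representative:
  assumes "m \<in> Linf_plus"
  obtains m' K where "\<And>x. 0 \<le> m' x" "\<And>x. m' x \<le> K" "m' \<in> borel_measurable (lebesgue_on {-1..1})"
    "AE x in lebesgue_on Omega. m x = m' x"
proof -
  have m: "m \<in> borel_measurable (lebesgue_on Omega)" "Linf_norm m < \<infinity>" "0 < Linf_norm m"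
    "AE x in lebesgue_on Omega. 0 \<le> m x" using assms by (auto simp: Linf_plus_def)
  define K where "K = real_of_ereal (Linf_norm m)"
  have K: "Linf_norm m = ereal K" using m(2,3) by (cases "Linf_norm m") (auto simp: K_def)
  have K0: "0 < K" using m(3) K by simp
  define m' where "m' x = (if x \<in> Omega then min (max (m x) 0) K else 0)" for x
  have "AE x in lebesgue_on Omega. ereal \<bar>m x\<bar> \<le> ereal K"
    using esssup_AE[of "\<lambda>x. ereal \<bar>m x\<bar>" "lebesgue_on Omega"] K by (simp add: Linf_norm_def)
  then have "AE x in lebesgue_on Omega. x \<in> Omega \<longrightarrow> m x = m' x"
    using m(4) by eventually_elim (auto simp: m'_def)
  then have ae: "AE x in lebesgue_on Omega. m x = m' x"
    using AE_space by eventually_elim simp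
  have "(\<lambda>x. min (max (m x) 0) K) \<in> borel_measurable (lebesgue_on Omega)" using m(1) by measurable
  then have "m' \<in> borel_measurable lebesgue"
    unfolding m'_def by (subst borel_measurable_if) auto
  then have "m' \<in> borel_measurable (lebesgue_on {-1..1})" by (rule measurable_restrict_space1)
  then show thesis using that[of m' K] ae K0 by (auto simp: m'_def)
qed

section \<open>The upper bound\<close>

lemma last_zero_before:
  fixes f :: "real \<Rightarrow> real"
  assumes f: "continuous_on {a..b} f" and y: "y \<in> {a..b}" "f y \<le> 0" and b: "0 < f b"
  obtains z where "y \<le> z" "z < b" "f z = 0" "\<And>t. z < t \<Longrightarrow> t \<le> b \<Longrightarrow> 0 < f t"
proof -
  define N where "N = {a..b} \<inter> f -` {..0}"
  have N: "closed N" unfolding N_def by (intro continuous_closed_preimage f) auto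
  have yN: "y \<in> N" using y by (simp add: N_def)
  have bdd: "bdd_above N" by (rule bdd_aboveI[of _ b]) (auto simp: N_def)
  define z where "z = Sup N"
  have z: "z \<in> N" unfolding z_def using closed_contains_Sup[OF _ bdd N] yN by auto
  have yz: "y \<le> z" unfolding z_def by (rule cSup_upper[OF yN bdd])
  have zb: "z \<le> b" "a \<le> z" "f z \<le> 0" using z by (auto simp: N_def)
  have pos: "0 < f t" if "z < t" "t \<le> b" for t
  proof (rule ccontr)
    assume "\<not> 0 < f t"
    then have "t \<in> N" using that zb by (auto simp: N_def)
    then have "t \<le> z" unfolding z_def by (rule cSup_upper[OF _ bdd])
    with that show False by simp
  qed
  obtain x where x: "z \<le> x" "x \<le> b" "f x = 0"
    using IVT'[of f z 0 b] zb b continuous_on_subset[OF f, of "{z..b}"] by auto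
  have "x = z" using pos[of x] x by force
  moreover have "z \<noteq> b" using zb b by auto
  ultimately show thesis using that[of z] x yz zb pos by auto
qed

lemma first_zero_after:
  fixes f :: "real \<Rightarrow> real"
  assumes f: "continuous_on {a..b} f" and y: "y \<in> {a..b}" "f y \<le> 0" and a: "0 < f a"
  obtains z where "a < z" "z \<le> y" "f z = 0" "\<And>t. a \<le> t \<Longrightarrow> t < z \<Longrightarrow> 0 < f t"
proof -
  have "continuous_on {-b..-a} (\<lambda>x. f (-x))"
    by (rule continuous_on_compose2[OF f]) (auto intro: continuous_intros)
  then obtain z where z: "-y \<le> z" "z < -a" "f (-z) = 0" "\<And>t. z < t \<Longrightarrow> t \<le> -a \<Longrightarrow> 0 < f (-t)"
    using last_zero_before[of "-b" "-a" "\<lambda>x. f (-x)" "-y"] y a by (metis (no_types, lifting) atLeastAtMost_iff minus_minus neg_le_iff_le)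
  show thesis
  proof (rule that[of "-z"])
    show "0 < f t" if "a \<le> t" "t < -z" for t using z(4)[of "-t"] that by simp
  qed (use z in auto)
qed

text \<open>
  The classical form of a positive solution.  The weight is bounded at every point, so that the equation can serve
  as a formula for the derivative of \<open>V\<close>, which is the derivative of \<open>u\<close>.
\<close>
locale logistic_profile =
  fixes d K :: real and m u V :: "real \<Rightarrow> real"
  assumes d: "0 < d"
    and m_measurable: "m \<in> borel_measurable (lebesgue_on {-1..1})"
    and m_bounds: "0 \<le> m x" "m x \<le> K"
    and V: "primitive_on (-1) 1 V (\<lambda>x. u x * (u x - m x) / d)"
    and u: "primitive_on (-1) 1 u V"
    and boundary: "u (-1) = 0" "u 1 = 0"
    and u_pos: "x \<in> Omega \<Longrightarrow> 0 < u x"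
begin

lemma u_nonneg: "x \<in> {-1..1} \<Longrightarrow> 0 \<le> u x"
  using u_pos[of x] boundary by (cases "x = -1 \<or> x = 1") (auto simp: less_eq_real_def)

lemma u_continuous: "continuous_on {-1..1} u" by (rule primitive_on_continuous[OF u])
lemma V_continuous: "continuous_on {-1..1} V" by (rule primitive_on_continuous[OF V])

lemma reflect: "logistic_profile d K (\<lambda>x. m (-x)) (\<lambda>x. u (-x)) (\<lambda>x. - V (-x))"
proof
  have c: "continuous_on {-1..1} (\<lambda>x. u (-x))"
    by (rule continuous_on_compose2[OF u_continuous]) (auto intro: continuous_intros)
  have "primitive_on (-1) 1 (\<lambda>x. integral {-1..x} m) m"
    using primitive_on_integral[OF m_measurable, of K 0] m_bounds by auto
  from primitive_on_reflect[OF this]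
  have "(\<lambda>x. - m (-x)) \<in> borel_measurable (lebesgue_on {-1..1})" by (rule primitive_onD(1))
  then show "(\<lambda>x. m (-x)) \<in> borel_measurable (lebesgue_on {-1..1})" by simp
  show "primitive_on (-1) 1 (\<lambda>x. - V (-x)) (\<lambda>x. u (-x) * (u (-x) - m (-x)) / d)"
    using primitive_on_cmult[OF primitive_on_reflect[OF V], of "-1"] by simp
  show "primitive_on (-1) 1 (\<lambda>x. u (-x)) (\<lambda>x. - V (-x))"
    by (rule primitive_on_reflect[OF u])
  show "0 < u (- x)" if "x \<in> Omega" for x using that by (intro u_pos) auto
qed (use d m_bounds boundary in auto)

text \<open>
  This is the first integral of \<open>d u'' = u\<^sup>2\<close>, the equation where the weight vanishes.
\<close>
definition energy :: "real \<Rightarrow> real" where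
  "energy x = d * (V x * V x) - 2 / 3 * (u x * (u x * u x))"

lemma energy_primitive: "primitive_on (-1) 1 energy (\<lambda>x. - 2 * V x * u x * m x)"
  by (rule primitive_on_cong[OF primitive_on_diff_fun[OF
        primitive_on_cmult[OF primitive_on_mult[OF V V], of d]
        primitive_on_cmult[OF primitive_on_mult[OF u primitive_on_mult[OF u u]], of "2/3"]]])
    (use d in \<open>auto simp: energy_def field_simps\<close>)

lemma energy_continuous: "continuous_on {-1..1} energy" by (rule primitive_on_continuous[OF energy_primitive])

lemma energy_pos_imp_V_nonzero: "x \<in> {-1..1} \<Longrightarrow> 0 < energy x \<Longrightarrow> V x \<noteq> 0"
  using u_nonneg[of x] by (auto simp: energy_def mult_less_0_iff)

lemma energy_antimono:
  assumes "-1 \<le> x" "x \<le> y" "y \<le> 1" "\<And>t. t \<in> {x..y} \<Longrightarrow> 0 \<le> V t"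
  shows "energy y \<le> energy x"
proof -
  have "- energy x \<le> - energy y"
    using primitive_on_mono[OF primitive_on_cmult[OF energy_primitive, of "-1"] assms(1-3)]
      assms u_nonneg m_bounds by (auto intro!: mult_nonneg_nonneg)
  then show ?thesis by simp
qed

text \<open>
  Moving left from \<open>x\<close>, the energy grows as long as \<open>V\<close> is nonnegative.  At a first zero of \<open>V\<close> it would
  therefore still be positive, which is impossible because \<open>energy\<close> is nonpositive where \<open>V\<close> vanishes.
\<close>
lemma energy_pos_left:
  assumes x: "x \<in> {-1..1}" "0 < energy x" "0 < V x" and y: "-1 \<le> y" "y \<le> x"
  shows "0 < energy y" "0 < V y"
proof -
  have V0: "0 < V y" if y: "-1 \<le> y" "y \<le> x" for y
  proof (rule ccontr)
    assume "\<not> 0 < V y"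
    then obtain z where z: "y \<le> z" "z < x" "V z = 0" "\<And>t. z < t \<Longrightarrow> t \<le> x \<Longrightarrow> 0 < V t"
      using last_zero_before[OF continuous_on_subset[OF V_continuous, of "{-1..x}"], of y] x y by auto
    have "0 \<le> V t" if "t \<in> {z..x}" for t using z(3) z(4)[of t] that by (cases "t = z") auto
    then have "energy x \<le> energy z" using x y z by (intro energy_antimono) auto
    then have "0 < energy z" using x(2) by simp
    then show False using energy_pos_imp_V_nonzero[of z] z x y by auto
  qed
  show "0 < V y" by (rule V0[OF y])
  have "energy x \<le> energy y" using V0 x y by (intro energy_antimono) (auto simp: less_eq_real_def)
  then show "0 < energy y" using x(2) by simp
qed

end

lemma (in logistic_profile) energy_reflect: "logistic_profile.energy d (\<lambda>x. u (- x)) (\<lambda>x. - V (- x)) x = energy (- x)"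
  using logistic_profile.energy_def[OF reflect] by (simp add: energy_def)

context logistic_profile
begin

lemma energy_pos_right:
  assumes x: "x \<in> {-1..1}" "0 < energy x" "V x < 0" and y: "x \<le> y" "y \<le> 1"
  shows "0 < energy y" "V y < 0"
  using logistic_profile.energy_pos_left[OF reflect, of "-x" "-y"] x y by (auto simp: energy_reflect)

lemma obtain_maximum:
  obtains a where "-1 < a" "a < 1" "V a = 0" "energy a < 0"
proof -
  obtain a where a: "a \<in> {-1..1}" "\<And>x. x \<in> {-1..1} \<Longrightarrow> u x \<le> u a"
    using continuous_attains_sup[OF _ _ u_continuous] by auto
  have ua: "0 < u a" using a(2)[of 0] u_pos[of 0] by simp
  then have ab: "-1 < a" "a < 1" using a(1) boundary by (auto simp: less_eq_real_def)
  have "V a = 0"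
  proof (rule DERIV_local_max)
    show "(u has_real_derivative V a) (at a)" by (rule primitive_on_DERIV[OF u V_continuous ab])
    show "0 < min (a + 1) (1 - a)" using ab by simp
    show "\<forall>y. \<bar>a - y\<bar> < min (a + 1) (1 - a) \<longrightarrow> u y \<le> u a" using a(2) by (auto simp: abs_if split: if_splits)
  qed
  then show thesis using that[of a] ab ua by (simp add: energy_def)
qed

text \<open>
  If the energy vanished at the left end, it would be nonpositive up to the maximum of \<open>u\<close>.  Then
  \<open>V \<le> C u\<close> there, since \<open>V\<^sup>2\<close> is bounded by \<open>u\<^sup>3\<close>, and Gronwall's argument with
  \<open>u(-1) = 0\<close> gives \<open>u \<le> 0\<close>.
\<close>
lemma energy_left_end: "0 < energy (-1)"
proof (rule ccontr)
  assume neg: "\<not> 0 < energy (-1)"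
  obtain a where a: "-1 < a" "a < 1" "V a = 0" "energy a < 0" using obtain_maximum by blast
  have energy: "energy x \<le> 0" if "x \<in> {-1..a}" for x
  proof (rule ccontr)
    assume "\<not> energy x \<le> 0"
    then have p: "0 < energy x" by simp
    show False
    proof (cases "0 < V x")
      case True
      then show False using energy_pos_left[of x "-1"] p that a neg by auto
    next
      case False
      then have "V x < 0" using energy_pos_imp_V_nonzero[of x] p that a by auto
      then show False using energy_pos_right[of x a] p that a by auto
    qed
  qed
  obtain B where B: "0 \<le> B" "\<And>x. x \<in> {-1..1} \<Longrightarrow> \<bar>u x\<bar> \<le> B" using continuous_on_Icc_bounded[OF u_continuous] by blast
  define C where "C = sqrt (2 * B / (3 * d))"
  have C: "0 \<le> C" "C\<^sup>2 = 2 * B / (3 * d)" using B(1) d by (auto simp: C_def)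
  have VC: "V x \<le> C * u x" if x: "x \<in> {-1..a}" for x
  proof (rule power2_le_imp_le)
    have x1: "x \<in> {-1..1}" using x a by auto
    have "d * (V x)\<^sup>2 \<le> 2 / 3 * (u x * (u x * u x))" using energy[OF x] by (simp add: energy_def power2_eq_square)
    also have "\<dots> \<le> 2 / 3 * (B * (u x * u x))"
      using B(2)[OF x1] by (intro mult_left_mono mult_right_mono) auto
    also have "\<dots> = d * (C * u x)\<^sup>2" using d C(2) by (simp add: power_mult_distrib power2_eq_square[of "u x"])
    finally show "(V x)\<^sup>2 \<le> (C * u x)\<^sup>2" using d by simp
    show "0 \<le> C * u x" using C u_nonneg[OF x1] by simp
  qed
  have ex: "primitive_on (-1) 1 (\<lambda>x. exp (- C * x)) (\<lambda>x. - C * exp (- C * x))"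
    by (rule primitive_on_C1) (auto intro!: derivative_eq_intros continuous_intros)
  have "- (u (-1) * exp (- C * (-1))) \<le> - (u a * exp (- C * a))"
    using primitive_on_mono[OF primitive_on_cmult[OF primitive_on_mult[OF u ex], of "-1"], of "-1" a] a VC
    by (simp add: algebra_simps)
  then show False using u_pos[of a] a boundary by (simp add: mult_le_0_iff)
qed

lemma energy_right_end: "0 < energy 1"
  using logistic_profile.energy_left_end[OF reflect] by (simp add: energy_reflect)

text \<open>
  Positive energy means \<open>u \<surd>u \<le> k V\<close> with \<open>k\<^sup>2 = 3 d/2\<close>, that is
  \<open>u \<le> (2 k \<surd>u)'\<close>, and at \<open>c\<close> the same inequality turns \<open>2 k \<surd>u\<close> into \<open>3 d V/u\<close>.
  The square root need not be differentiable at \<open>-1\<close>, where \<open>u\<close> vanishes, but it is continuous.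
\<close>
lemma left_part:
  assumes c: "-1 < c" "c < 1" and E0: "energy c = 0" and pos: "\<And>t. -1 \<le> t \<Longrightarrow> t < c \<Longrightarrow> 0 < energy t \<and> 0 < V t"
  shows "integral {-1..c} u \<le> 3 * (d * V c / u c)"
proof -
  define k where "k = sqrt (3 * d / 2)"
  have k: "0 < k" "k\<^sup>2 = 3 * d / 2" using d by (auto simp: k_def)
  have Vc: "0 \<le> V c"
  proof (rule ccontr)
    assume "\<not> 0 \<le> V c"
    then have n: "0 < - V c" by simp
    have "continuous_on {-1..c} (\<lambda>x. - V x)"
      using continuous_on_subset[OF V_continuous, of "{-1..c}"] c by (intro continuous_intros) auto
    from last_zero_before[OF this, of "-1"] obtain z where "-1 \<le> z" "z < c" "V z = 0"
      using pos[of "-1"] c n by force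
    then show False using pos[of z] by auto
  qed
  have key: "u x * sqrt (u x) \<le> k * V x" if "-1 \<le> x" "x \<le> c" "0 \<le> energy x" for x
  proof (rule power2_le_imp_le)
    have ux: "0 \<le> u x" using u_nonneg that c by auto
    have "2 / 3 * (u x * (u x * u x)) \<le> d * (V x * V x)" using that(3) by (simp add: energy_def)
    moreover have "(u x * sqrt (u x))\<^sup>2 = u x * (u x * u x)"
      using ux by (simp add: power_mult_distrib) (simp add: power2_eq_square)
    moreover have "(k * V x)\<^sup>2 = 3 / 2 * (d * (V x * V x))"
      unfolding power_mult_distrib k(2) by (simp add: power2_eq_square)
    ultimately show "(u x * sqrt (u x))\<^sup>2 \<le> (k * V x)\<^sup>2" by linarith
    have "0 \<le> V x" using pos[of x] that Vc by (cases "x = c") auto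
    then show "0 \<le> k * V x" using k by simp
  qed
  have uc: "continuous_on {-1..c} u" using continuous_on_subset[OF u_continuous, of "{-1..c}"] c by auto
  note I = primitive_on_integral_continuous[OF uc, of 0]
  define D where "D x = 2 * k * sqrt (u x) - (0 + integral {-1..x} u)" for x
  have "D (-1) \<le> D c"
  proof (rule DERIV_nonneg_imp_increasing_open[of "-1" c D])
    show "continuous_on {-1..c} D"
      unfolding D_def by (intro continuous_intros uc primitive_on_continuous[OF I])
    fix x assume x: "-1 < x" "x < c"
    have ux: "0 < u x" using u_pos x c by auto
    have "(u has_real_derivative V x) (at x)" by (rule primitive_on_DERIV[OF u V_continuous]) (use x c in auto)
    moreover have "((\<lambda>x. 0 + integral {-1..x} u) has_real_derivative u x) (at x)"
      by (rule primitive_on_DERIV[OF I uc x])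
    ultimately have "(D has_real_derivative 2 * k * (V x * (inverse (sqrt (u x)) / 2)) - u x) (at x)"
      unfolding D_def using ux by (auto intro!: derivative_eq_intros simp: field_simps)
    moreover have "0 \<le> 2 * k * (V x * (inverse (sqrt (u x)) / 2)) - u x"
      using key[of x] pos[of x] x ux by (simp add: field_simps)
    ultimately show "\<exists>y. (D has_real_derivative y) (at x) \<and> 0 \<le> y" by blast
  qed (use c in auto)
  then have "integral {-1..c} u \<le> 2 * k * sqrt (u c)" using boundary by (simp add: D_def)
  also have "\<dots> \<le> 3 * (d * V c / u c)"
  proof -
    have uc: "0 < u c" using u_pos c by auto
    have kk: "k * k = 3 * d / 2" using k(2) by (simp add: power2_eq_square)
    have "2 * k * (u c * sqrt (u c)) \<le> 2 * k * (k * V c)"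
      using key[of c] c E0 k by (intro mult_left_mono) auto
    also have "\<dots> = 2 * (k * k) * V c" by (simp only: mult.assoc)
    also have "\<dots> = 3 * (d * V c)" unfolding kk by simp
    finally show ?thesis using uc by (simp add: field_simps)
  qed
  finally show ?thesis .
qed

text \<open>
  The interval is cut at the first and the last zero of the energy.  The strict inequality comes from a neighbourhood
  of the maximum of \<open>u\<close>, where the energy is negative.
\<close>
theorem L1_bound: "integral {-1..1} u < 3 * integral {-1..1} m"
proof -
  obtain a where a: "-1 < a" "a < 1" "V a = 0" "energy a < 0" using obtain_maximum by blast
  obtain c where c: "-1 < c" "c \<le> a" "energy c = 0" "\<And>t. -1 \<le> t \<Longrightarrow> t < c \<Longrightarrow> 0 < energy t"
    using first_zero_after[OF energy_continuous _ _ energy_left_end, of a] a by auto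
  obtain e where e: "a \<le> e" "e < 1" "energy e = 0" "\<And>t. e < t \<Longrightarrow> t \<le> 1 \<Longrightarrow> 0 < energy t"
    using last_zero_before[OF energy_continuous _ _ energy_right_end, of a] a by auto
  have ce: "c < a" "a < e" using a(4) c(2,3) e(1,3) by (auto simp: less_eq_real_def)
  have left: "0 < energy t \<and> 0 < V t" if t: "-1 \<le> t" "t < c" for t
  proof -
    have p: "0 < energy t" by (rule c(4)[OF t])
    have "V t < 0 \<Longrightarrow> False" using energy_pos_right[of t c] p t c a by auto
    then show ?thesis using p energy_pos_imp_V_nonzero[of t] t c a by force
  qed
  have right: "0 < energy t \<and> V t < 0" if t: "e < t" "t \<le> 1" for t
  proof -
    have p: "0 < energy t" by (rule e(4)[OF t])
    have "0 < V t \<Longrightarrow> False" using energy_pos_left[of t e] p t e a by auto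
    then show ?thesis using p energy_pos_imp_V_nonzero[of t] t e a by force
  qed
  have mid: "energy t \<le> 0" if t: "c \<le> t" "t \<le> e" for t
  proof (rule ccontr)
    assume "\<not> energy t \<le> 0"
    then have p: "0 < energy t" by simp
    have "V t < 0 \<Longrightarrow> False" using energy_pos_right[of t e] p t c e a by auto
    moreover have "0 < V t \<Longrightarrow> False" using energy_pos_left[of t c] p t c e a by auto
    ultimately show False using energy_pos_imp_V_nonzero[of t] p t c e a by force
  qed
  have L: "integral {-1..c} u \<le> 3 * (d * V c / u c)"
    by (rule left_part) (use c a left in auto)
  have R: "integral {e..1} u \<le> - 3 * (d * V e / u e)"
  proof -
    have "integral {-1..-e} (\<lambda>x. u (-x)) \<le> 3 * (d * (- V (- (-e))) / u (- (-e)))"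
    proof (rule logistic_profile.left_part[OF reflect], unfold energy_reflect)
      fix t assume "-1 \<le> t" "t < -e"
      then show "0 < energy (-t) \<and> 0 < - V (-t)" using right[of "-t"] by simp
    qed (use e a in auto)
    then show ?thesis using Henstock_Kurzweil_Integration.integral_reflect_real[where a = e and b = 1 and f = u] by simp
  qed
  have upos: "0 < u t" if "t \<in> {c..e}" for t using u_pos that c e by auto
  have sub: "{c..e} \<subseteq> {-1..1}" using c e by auto
  have uce: "continuous_on {c..e} u" and Vce: "continuous_on {c..e} V"
    using continuous_on_subset[OF u_continuous sub] continuous_on_subset[OF V_continuous sub] by auto
  have inv: "primitive_on c e (\<lambda>t. 1 / u t) (\<lambda>t. - V t / (u t * u t))"
  proof (rule primitive_on_C1)
    fix t assume t: "t \<in> {c<..<e}"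
    have "(u has_real_derivative V t) (at t)" by (rule primitive_on_DERIV[OF u V_continuous]) (use t c e in auto)
    then show "((\<lambda>t. 1 / u t) has_real_derivative - V t / (u t * u t)) (at t)"
      using upos[of t] t by (auto intro!: derivative_eq_intros simp: field_simps)
  qed (use upos in \<open>fastforce intro!: continuous_intros uce Vce\<close>)+
  note VI = primitive_on_mult[OF primitive_on_subinterval[OF V, of c e] inv]
  \<comment> \<open>\<open>g\<close> is \<open>- energy / u\<^sup>2\<close>, the loss in the estimate on the middle interval.\<close>
  define g where "g t = 2 / 3 * u t - d * (V t * V t) / (u t * u t)" for t
  have gc: "continuous_on {c..e} g"
    unfolding g_def using upos by (fastforce intro!: continuous_intros uce Vce)
  have g0: "0 \<le> g t" if "t \<in> {c..e}" for t
    using mid[of t] upos[OF that] that by (auto simp: g_def energy_def field_simps)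
  have "0 < integral {c..e} g"
  proof (rule ccontr)
    assume "\<not> 0 < integral {c..e} g"
    moreover have "0 \<le> integral {c..e} g"
      using g0 by (intro Henstock_Kurzweil_Integration.integral_nonneg integrable_continuous_real gc) auto
    ultimately have "(g has_integral 0) (cbox c e)"
      using integrable_integral[OF integrable_continuous_real[OF gc]] by simp
    then have "g a = 0"
      using has_integral_0_cbox_imp_0[of c e g a] gc g0 ce by auto
    then show False using a ce upos[of a] by (simp add: g_def)
  qed
  have m_int: "m integrable_on {x..y}" if "-1 \<le> x" "y \<le> 1" for x y
    using primitive_on_integrable[OF primitive_on_integral[OF m_measurable, of K 0], of x y] that m_bounds by auto
  have "((\<lambda>t. u t - d * (u t * (u t - m t) / d * (1 / u t) + V t * (- V t / (u t * u t))) - (2 / 3 * u t - g t))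
      has_integral integral {c..e} u - d * (V e * (1 / u e) - V c * (1 / u c)) - (2 / 3 * integral {c..e} u - integral {c..e} g)) {c..e}"
    using ce c e by (intro has_integral_diff has_integral_mult_right integrable_integral integrable_continuous_real
        uce gc primitive_on_has_integral[OF VI]) auto
  moreover have "u t - d * (u t * (u t - m t) / d * (1 / u t) + V t * (- V t / (u t * u t))) - (2 / 3 * u t - g t) = m t"
    if "t \<in> {c..e}" for t
    using upos[OF that] d by (simp add: g_def field_simps)
  ultimately have "(m has_integral integral {c..e} u - d * (V e * (1 / u e) - V c * (1 / u c)) - (2 / 3 * integral {c..e} u - integral {c..e} g)) {c..e}"
    by (rule has_integral_eq[rotated])
  then have M: "3 * integral {c..e} m = integral {c..e} u + 3 * (d * V c / u c) - 3 * (d * V e / u e) + 3 * integral {c..e} g"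
    by (simp add: integral_unique algebra_simps)
  have "integral {c..e} m \<le> integral {-1..1} m"
    by (rule integral_subset_le[OF sub]) (use m_int m_bounds c e in auto)
  moreover have "integral {-1..1} u = integral {-1..c} u + integral {c..e} u + integral {e..1} u"
  proof -
    have ui: "u integrable_on {-1..1}" by (rule integrable_continuous_real[OF u_continuous])
    then have "u integrable_on {-1..e}" by (rule integrable_on_subinterval) (use e in auto)
    then show ?thesis
      using Henstock_Kurzweil_Integration.integral_combine[of "-1" c e u]
        Henstock_Kurzweil_Integration.integral_combine[of "-1" e 1 u] ui c e ce by simp
  qed
  ultimately show ?thesis using L R M \<open>0 < integral {c..e} g\<close> by linarith
qed

end

section \<open>Shooting for the linear eigenvalue problem\<close>

locale bounded_weight =
  fixes K :: real and m :: "real \<Rightarrow> real"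
  assumes m_measurable: "m \<in> borel_measurable (lebesgue_on {-1..1})"
    and m_bounds: "0 \<le> m x" "m x \<le> K"
begin

text \<open>
  Picard iteration: these are the coefficients of \<open>(-\<mu>)\<^sup>k\<close> in the derivative of the solution of
  \<open>\<phi>'' + \<mu> m \<phi> = 0\<close>, \<open>\<phi>(-1) = 0\<close>, \<open>\<phi>'(-1) = 1\<close>; \<open>shoot_coeff\<close> gives those of
  \<open>\<phi>\<close> itself.
\<close>
fun slope_coeff :: "nat \<Rightarrow> real \<Rightarrow> real" where
  "slope_coeff 0 s = 1"
| "slope_coeff (Suc k) s = integral {-1..s} (\<lambda>t. m t * integral {-1..t} (slope_coeff k))"

definition shoot_coeff :: "nat \<Rightarrow> real \<Rightarrow> real" where "shoot_coeff k x = integral {-1..x} (slope_coeff k)"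

lemma K_nonneg: "0 \<le> K" using m_bounds[of 0] by linarith

lemma m_times_integrable:
  assumes "f \<in> borel_measurable (lebesgue_on {-1..1})" "\<And>x. x \<in> {-1..1} \<Longrightarrow> \<bar>f x\<bar> \<le> B"
  shows "(\<lambda>t. m t * f t) \<in> borel_measurable (lebesgue_on {-1..1})" "\<And>x. x \<in> {-1..1} \<Longrightarrow> \<bar>m x * f x\<bar> \<le> K * B"
proof -
  show "(\<lambda>t. m t * f t) \<in> borel_measurable (lebesgue_on {-1..1})"
    using m_measurable assms(1) by (rule borel_measurable_times)
  show "\<bar>m x * f x\<bar> \<le> K * B" if "x \<in> {-1..1}" for x
    unfolding abs_mult using assms(2)[OF that] m_bounds[of x] by (intro mult_mono) auto
qed

lemma m_times_primitive:
  assumes "continuous_on {-1..1} f"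
  shows "primitive_on (-1) 1 (\<lambda>x. C + integral {-1..x} (\<lambda>t. m t * f t)) (\<lambda>t. m t * f t)"
proof -
  obtain B where "\<And>x. x \<in> {-1..1} \<Longrightarrow> \<bar>f x\<bar> \<le> B" using continuous_on_Icc_bounded[OF assms] by blast
  from m_times_integrable[OF continuous_on_Icc_measurable[OF assms] this]
  show ?thesis by (rule primitive_on_integral)
qed

lemma slope_coeff_continuous: "continuous_on {-1..1} (slope_coeff k)"
proof (induction k)
  case (Suc k)
  have "continuous_on {-1..1} (\<lambda>x. 0 + integral {-1..x} (slope_coeff k))"
    by (rule primitive_on_continuous[OF primitive_on_integral_continuous[OF Suc]])
  then have "continuous_on {-1..1} (\<lambda>x. integral {-1..x} (slope_coeff k))" by simp
  from primitive_on_continuous[OF m_times_primitive[OF this, of 0]] show ?case by simp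
qed (simp add: continuous_on_const)

lemma shoot_coeff_primitive: "primitive_on (-1) 1 (shoot_coeff k) (slope_coeff k)"
  using primitive_on_integral_continuous[OF slope_coeff_continuous, of 0 k] by (simp add: shoot_coeff_def[abs_def])

lemma slope_coeff_Suc_primitive: "primitive_on (-1) 1 (slope_coeff (Suc k)) (\<lambda>t. m t * shoot_coeff k t)"
proof -
  have "slope_coeff (Suc k) = (\<lambda>s. 0 + integral {-1..s} (\<lambda>t. m t * shoot_coeff k t))" by (rule ext) (simp add: shoot_coeff_def)
  then show ?thesis using m_times_primitive[OF primitive_on_continuous[OF shoot_coeff_primitive], of 0 k] by simp
qed

text \<open>The largest value of \<open>2 K (x + 1)\<close> on \<open>[-1,1]\<close>.\<close>
definition rate :: real where "rate = 4 * K"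

text \<open>
  The factor \<open>1/k!\<close> makes the series converge for every \<open>\<mu>\<close>; the factor \<open>x + 1\<close> in the second
  bound keeps control of the solution near its zero at \<open>-1\<close>.
\<close>
lemma coeff_power_bounds:
  assumes "x \<in> {-1..1}"
  shows "0 \<le> slope_coeff k x \<and> slope_coeff k x \<le> (2 * K * (x + 1)) ^ k / fact k"
    "0 \<le> shoot_coeff k x \<and> shoot_coeff k x \<le> (x + 1) * (2 * K * (x + 1)) ^ k / fact k"
proof -
  have *: "0 \<le> shoot_coeff k x \<and> shoot_coeff k x \<le> (x + 1) * (2 * K * (x + 1)) ^ k / fact k"
    if "\<And>x. x \<in> {-1..1} \<Longrightarrow> 0 \<le> slope_coeff k x \<and> slope_coeff k x \<le> (2 * K * (x + 1)) ^ k / fact k" "x \<in> {-1..1}" for k x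
  proof -
    have i: "(slope_coeff k has_integral shoot_coeff k x) {-1..x}"
      using primitive_on_has_integral[OF shoot_coeff_primitive, of "-1" x k] that(2) by (simp add: shoot_coeff_def)
    have "0 \<le> shoot_coeff k x" by (rule has_integral_nonneg[OF i]) (use that in auto)
    moreover have "shoot_coeff k x \<le> (2 * K * (x + 1)) ^ k / fact k * (x - (-1))"
    proof (rule has_integral_le[OF i])
      show "((\<lambda>_. (2 * K * (x + 1)) ^ k / fact k) has_integral (2 * K * (x + 1)) ^ k / fact k * (x - (-1))) {-1..x}"
        using has_integral_const_real[of "(2 * K * (x + 1)) ^ k / fact k" "-1" x] that(2) by (simp add: mult.commute)
      fix t assume t: "t \<in> {-1..x}"
      have "slope_coeff k t \<le> (2 * K * (t + 1)) ^ k / fact k" using that t by auto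
      also have "\<dots> \<le> (2 * K * (x + 1)) ^ k / fact k"
        using t K_nonneg by (intro divide_right_mono power_mono mult_left_mono) auto
      finally show "slope_coeff k t \<le> (2 * K * (x + 1)) ^ k / fact k" .
    qed
    ultimately show ?thesis by (simp add: mult.commute)
  qed
  have bound: "0 \<le> slope_coeff k x \<and> slope_coeff k x \<le> (2 * K * (x + 1)) ^ k / fact k" if "x \<in> {-1..1}" for k x
    using that
  proof (induction k arbitrary: x)
    case (Suc k)
    have i: "((\<lambda>t. m t * shoot_coeff k t) has_integral slope_coeff (Suc k) x) {-1..x}"
      using primitive_on_has_integral[OF slope_coeff_Suc_primitive, of "-1" x k] Suc.prems by simp
    have "0 \<le> slope_coeff (Suc k) x"
      by (rule has_integral_nonneg[OF i]) (use *[OF Suc.IH] Suc.prems m_bounds in auto)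
    moreover have "slope_coeff (Suc k) x \<le> (2 * K * (x + 1)) ^ Suc k / fact (Suc k) - (2 * K * (-1 + 1)) ^ Suc k / fact (Suc k)"
    proof (rule has_integral_le[OF i])
      show "((\<lambda>t. 2 * K * (2 * K * (t + 1)) ^ k / fact k) has_integral
          (2 * K * (x + 1)) ^ Suc k / fact (Suc k) - (2 * K * (-1 + 1)) ^ Suc k / fact (Suc k)) {-1..x}"
      proof (rule fundamental_theorem_of_calculus)
        fix t :: real
        have "((\<lambda>t. 2 * K * (t + 1)) has_real_derivative 2 * K) (at t within {-1..x})"
          by (auto intro!: derivative_eq_intros)
        from DERIV_cdivide[OF DERIV_power[OF this, of "Suc k"], of "fact (Suc k)"]
        have "((\<lambda>t. (2 * K * (t + 1)) ^ Suc k / fact (Suc k)) has_real_derivative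
            2 * K * (2 * K * (t + 1)) ^ k / fact k) (at t within {-1..x})"
          by (rule DERIV_cong) (simp del: of_nat_Suc)
        then show "((\<lambda>t. (2 * K * (t + 1)) ^ Suc k / fact (Suc k)) has_vector_derivative
            2 * K * (2 * K * (t + 1)) ^ k / fact k) (at t within {-1..x})"
          by (simp only: has_real_derivative_iff_has_vector_derivative)
      qed (use Suc.prems in auto)
      fix t assume t: "t \<in> {-1..x}"
      then have t1: "t \<in> {-1..1}" using Suc.prems by auto
      have "m t * shoot_coeff k t \<le> K * ((t + 1) * (2 * K * (t + 1)) ^ k / fact k)"
        using m_bounds[of t] *[OF Suc.IH t1] K_nonneg by (intro mult_mono) auto
      also have "\<dots> = (t + 1) * (K * (2 * K * (t + 1)) ^ k / fact k)" by simp
      also have "\<dots> \<le> 2 * (K * (2 * K * (t + 1)) ^ k / fact k)"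
        using t1 K_nonneg by (intro mult_right_mono) auto
      finally show "m t * shoot_coeff k t \<le> 2 * K * (2 * K * (t + 1)) ^ k / fact k" by simp
    qed
    ultimately show ?case by simp
  qed simp
  show "0 \<le> slope_coeff k x \<and> slope_coeff k x \<le> (2 * K * (x + 1)) ^ k / fact k" by (rule bound[OF assms])
  show "0 \<le> shoot_coeff k x \<and> shoot_coeff k x \<le> (x + 1) * (2 * K * (x + 1)) ^ k / fact k" by (rule *[OF bound assms])
qed

lemma slope_coeff_bounds: "x \<in> {-1..1} \<Longrightarrow> \<bar>slope_coeff k x\<bar> \<le> rate ^ k / fact k"
  and shoot_coeff_bounds: "x \<in> {-1..1} \<Longrightarrow> \<bar>shoot_coeff k x\<bar> \<le> (x + 1) * (rate ^ k / fact k)"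
proof -
  assume x: "x \<in> {-1..1}"
  have "2 * K * (x + 1) \<le> 2 * K * 2" using x K_nonneg by (intro mult_left_mono) auto
  then have *: "(2 * K * (x + 1)) ^ k / fact k \<le> rate ^ k / fact k"
    using x K_nonneg by (intro divide_right_mono power_mono) (auto simp: rate_def)
  then show "\<bar>slope_coeff k x\<bar> \<le> rate ^ k / fact k" using coeff_power_bounds(1)[OF x, of k] by linarith
  have "(x + 1) * ((2 * K * (x + 1)) ^ k / fact k) \<le> (x + 1) * (rate ^ k / fact k)"
    using * x by (intro mult_left_mono) auto
  then show "\<bar>shoot_coeff k x\<bar> \<le> (x + 1) * (rate ^ k / fact k)" using coeff_power_bounds(2)[OF x, of k] by simp
qed

lemma rate_nonneg: "0 \<le> rate" using K_nonneg by (simp add: rate_def)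

definition shoot :: "real \<Rightarrow> real \<Rightarrow> real" where "shoot \<mu> x = (\<Sum>k. (-\<mu>) ^ k * shoot_coeff k x)"
definition slope :: "real \<Rightarrow> real \<Rightarrow> real" where "slope \<mu> x = (\<Sum>k. (-\<mu>) ^ k * slope_coeff k x)"

lemma exp_sums: "(\<lambda>k. \<bar>\<mu>\<bar> ^ k * (rate ^ k / fact k)) sums exp (\<bar>\<mu>\<bar> * rate)"
  using exp_converges[of "\<bar>\<mu>\<bar> * rate"] by (simp add: power_mult_distrib field_simps)

lemma term_bounds:
  assumes "x \<in> {-1..1}"
  shows "norm ((-\<mu>) ^ k * slope_coeff k x) \<le> \<bar>\<mu>\<bar> ^ k * (rate ^ k / fact k)"
    "norm ((-\<mu>) ^ k * shoot_coeff k x) \<le> 2 * (\<bar>\<mu>\<bar> ^ k * (rate ^ k / fact k))"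
proof -
  show "norm ((-\<mu>) ^ k * slope_coeff k x) \<le> \<bar>\<mu>\<bar> ^ k * (rate ^ k / fact k)"
    using mult_left_mono[OF slope_coeff_bounds[OF assms, of k], of "\<bar>\<mu>\<bar> ^ k"] by (simp add: abs_mult power_abs)
  have "\<bar>shoot_coeff k x\<bar> \<le> 2 * (rate ^ k / fact k)"
    by (rule order_trans[OF shoot_coeff_bounds[OF assms]], rule mult_right_mono) (use assms rate_nonneg in auto)
  then have "\<bar>\<mu>\<bar> ^ k * \<bar>shoot_coeff k x\<bar> \<le> \<bar>\<mu>\<bar> ^ k * (2 * (rate ^ k / fact k))" by (rule mult_left_mono) auto
  then show "norm ((-\<mu>) ^ k * shoot_coeff k x) \<le> 2 * (\<bar>\<mu>\<bar> ^ k * (rate ^ k / fact k))"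
    by (simp add: abs_mult power_abs algebra_simps)
qed

lemma series_summable:
  assumes "x \<in> {-1..1}"
  shows "summable (\<lambda>k. (-\<mu>) ^ k * slope_coeff k x)" "summable (\<lambda>k. (-\<mu>) ^ k * shoot_coeff k x)"
  using summable_comparison_test'[OF sums_summable[OF exp_sums] term_bounds(1)[OF assms]]
    summable_comparison_test'[OF summable_mult[OF sums_summable[OF exp_sums]] term_bounds(2)[OF assms]] by auto

lemma partial_bounds:
  assumes "x \<in> {-1..1}"
  shows "\<bar>\<Sum>k<n. (-\<mu>) ^ k * slope_coeff k x\<bar> \<le> exp (\<bar>\<mu>\<bar> * rate)" "\<bar>\<Sum>k<n. (-\<mu>) ^ k * shoot_coeff k x\<bar> \<le> 2 * exp (\<bar>\<mu>\<bar> * rate)"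
proof -
  have s: "(\<Sum>k<n. \<bar>\<mu>\<bar> ^ k * (rate ^ k / fact k)) \<le> exp (\<bar>\<mu>\<bar> * rate)"
    unfolding sums_unique[OF exp_sums] using rate_nonneg
    by (intro sum_le_suminf sums_summable[OF exp_sums]) auto
  show "\<bar>\<Sum>k<n. (-\<mu>) ^ k * slope_coeff k x\<bar> \<le> exp (\<bar>\<mu>\<bar> * rate)"
    using sum_norm_le[of "{..<n}" "\<lambda>k. (-\<mu>) ^ k * slope_coeff k x", OF term_bounds(1)[OF assms]] s by simp
  show "\<bar>\<Sum>k<n. (-\<mu>) ^ k * shoot_coeff k x\<bar> \<le> 2 * exp (\<bar>\<mu>\<bar> * rate)"
    using sum_norm_le[of "{..<n}" "\<lambda>k. (-\<mu>) ^ k * shoot_coeff k x", OF term_bounds(2)[OF assms]] s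
    unfolding sum_distrib_left[symmetric] by simp
qed

lemma partial_limits:
  assumes "x \<in> {-1..1}"
  shows "(\<lambda>n. \<Sum>k<n. (-\<mu>) ^ k * slope_coeff k x) \<longlonglongrightarrow> slope \<mu> x" "(\<lambda>n. \<Sum>k<n. (-\<mu>) ^ k * shoot_coeff k x) \<longlonglongrightarrow> shoot \<mu> x"
  unfolding slope_def shoot_def using series_summable[OF assms] by (auto intro: summable_LIMSEQ)

lemma shoot_slope_bounds:
  assumes "x \<in> {-1..1}"
  shows "\<bar>slope \<mu> x\<bar> \<le> exp (\<bar>\<mu>\<bar> * rate)" "\<bar>shoot \<mu> x\<bar> \<le> 2 * exp (\<bar>\<mu>\<bar> * rate)"
  using LIMSEQ_le_const2[OF tendsto_rabs[OF partial_limits(1)[OF assms]]]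
    LIMSEQ_le_const2[OF tendsto_rabs[OF partial_limits(2)[OF assms]]] partial_bounds[OF assms] by blast+

lemma shoot_slope_measurable:
  "slope \<mu> \<in> borel_measurable (lebesgue_on {-1..1})" "shoot \<mu> \<in> borel_measurable (lebesgue_on {-1..1})"
proof -
  have "slope_coeff k \<in> borel_measurable (lebesgue_on {-1..1})" "shoot_coeff k \<in> borel_measurable (lebesgue_on {-1..1})" for k
    using primitive_on_bounded_measurable[OF shoot_coeff_primitive] by auto
  then show "slope \<mu> \<in> borel_measurable (lebesgue_on {-1..1})" "shoot \<mu> \<in> borel_measurable (lebesgue_on {-1..1})"
    unfolding slope_def[abs_def] shoot_def[abs_def] by (auto intro!: borel_measurable_suminf borel_measurable_times)
qed

lemma shoot_left: "shoot \<mu> (-1) = 0"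
  by (simp add: shoot_def shoot_coeff_def)

lemma slope_left: "slope \<mu> (-1) = 1"
proof -
  have "slope \<mu> (-1) = (\<Sum>k. (-\<mu>) ^ k * slope_coeff k (-1))" by (simp add: slope_def)
  also have "\<dots> = (\<Sum>k\<in>{0}. (-\<mu>) ^ k * slope_coeff k (-1))"
    by (rule suminf_finite) (auto simp: gr0_conv_Suc)
  finally show ?thesis by simp
qed

lemma shoot_primitive: "primitive_on (-1) 1 (shoot \<mu>) (slope \<mu>)"
  unfolding primitive_on_def
proof (intro conjI ballI exI)
  fix x :: real assume x: "x \<in> {-1..1}"
  let ?f = "\<lambda>n t. \<Sum>k<n. (-\<mu>) ^ k * slope_coeff k t"
  have i: "(?f n has_integral (\<Sum>k<n. (-\<mu>) ^ k * shoot_coeff k x)) {-1..x}" for n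
    using primitive_on_has_integral[OF shoot_coeff_primitive, of "-1" x] x
    by (intro has_integral_sum has_integral_mult_right) (auto simp: shoot_coeff_def)
  have "(\<lambda>n. integral {-1..x} (?f n)) \<longlonglongrightarrow> integral {-1..x} (slope \<mu>)"
    by (rule dominated_convergence(2)[where h = "\<lambda>_. exp (\<bar>\<mu>\<bar> * rate)"])
      (use x partial_bounds(1) partial_limits(1) has_integral_integrable[OF i] in auto)
  moreover have "integral {-1..x} (?f n) = (\<Sum>k<n. (-\<mu>) ^ k * shoot_coeff k x)" for n
    by (rule integral_unique[OF i])
  ultimately have "(\<lambda>n. \<Sum>k<n. (-\<mu>) ^ k * shoot_coeff k x) \<longlonglongrightarrow> integral {-1..x} (slope \<mu>)" by simp
  then have "shoot \<mu> x = integral {-1..x} (slope \<mu>)" using partial_limits(2)[OF x] LIMSEQ_unique by blast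
  then show "shoot \<mu> x = shoot \<mu> (-1) + integral {-1..x} (slope \<mu>)" by (simp add: shoot_left)
  show "\<bar>slope \<mu> x\<bar> \<le> exp (\<bar>\<mu>\<bar> * rate)" by (rule shoot_slope_bounds(1)[OF x])
qed (rule shoot_slope_measurable)

lemma slope_primitive: "primitive_on (-1) 1 (slope \<mu>) (\<lambda>x. - \<mu> * m x * shoot \<mu> x)"
  unfolding primitive_on_def
proof (intro conjI ballI exI)
  note mp = m_times_integrable[OF shoot_slope_measurable(2)[of \<mu>], OF shoot_slope_bounds(2)[of _ \<mu>], simplified]
  show "(\<lambda>x. - \<mu> * m x * shoot \<mu> x) \<in> borel_measurable (lebesgue_on {-1..1})"
    using mp(1) by (simp add: mult.assoc)
  fix x :: real assume x: "x \<in> {-1..1}"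
  show "\<bar>- \<mu> * m x * shoot \<mu> x\<bar> \<le> \<bar>\<mu>\<bar> * (K * (2 * exp (\<bar>\<mu>\<bar> * rate)))"
    using mult_left_mono[OF mp(2)[of x], of "\<bar>\<mu>\<bar>"] x by (simp add: abs_mult mult.assoc)
  let ?f = "\<lambda>n t. \<Sum>k<n. (-\<mu>) ^ Suc k * (m t * shoot_coeff k t)"
  have f: "?f n t = - \<mu> * m t * (\<Sum>k<n. (-\<mu>) ^ k * shoot_coeff k t)" for n t
    by (simp add: sum_distrib_left algebra_simps)
  have i: "(?f n has_integral (\<Sum>k<n. (-\<mu>) ^ Suc k * slope_coeff (Suc k) x)) {-1..x}" for n
    using primitive_on_has_integral[OF slope_coeff_Suc_primitive, of "-1" x] x
    by (intro has_integral_sum has_integral_mult_right) auto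
  have "(\<lambda>n. integral {-1..x} (?f n)) \<longlonglongrightarrow> integral {-1..x} (\<lambda>x. - \<mu> * m x * shoot \<mu> x)"
  proof (rule dominated_convergence(2)[where h = "\<lambda>_. \<bar>\<mu>\<bar> * (K * (2 * exp (\<bar>\<mu>\<bar> * rate)))"])
    show "?f n integrable_on {-1..x}" for n using i by (rule has_integral_integrable)
    fix t assume "t \<in> {-1..x}"
    then have t: "t \<in> {-1..1}" using x by auto
    show "norm (?f n t) \<le> \<bar>\<mu>\<bar> * (K * (2 * exp (\<bar>\<mu>\<bar> * rate)))" for n
      unfolding f real_norm_def abs_mult mult.assoc abs_minus_cancel
      using partial_bounds(2)[OF t] m_bounds[of t] by (intro mult_left_mono mult_mono) auto
    show "(\<lambda>n. ?f n t) \<longlonglongrightarrow> - \<mu> * m t * shoot \<mu> t"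
      unfolding f by (intro tendsto_intros partial_limits(2) t)
  qed auto
  moreover have "integral {-1..x} (?f n) = (\<Sum>k<Suc n. (-\<mu>) ^ k * slope_coeff k x) - 1" for n
    unfolding integral_unique[OF i] sum.lessThan_Suc_shift by simp
  ultimately have "(\<lambda>n. (\<Sum>k<Suc n. (-\<mu>) ^ k * slope_coeff k x) - 1) \<longlonglongrightarrow> integral {-1..x} (\<lambda>x. - \<mu> * m x * shoot \<mu> x)" by simp
  moreover have "(\<lambda>n. (\<Sum>k<Suc n. (-\<mu>) ^ k * slope_coeff k x) - 1) \<longlonglongrightarrow> slope \<mu> x - 1"
    using partial_limits(1)[OF x, of \<mu>] by (intro tendsto_intros) (rule LIMSEQ_Suc)
  ultimately have "slope \<mu> x - 1 = integral {-1..x} (\<lambda>x. - \<mu> * m x * shoot \<mu> x)" using LIMSEQ_unique by blast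
  then show "slope \<mu> x = slope \<mu> (-1) + integral {-1..x} (\<lambda>x. - \<mu> * m x * shoot \<mu> x)" by (simp add: slope_left)
qed

lemma shoot_zero: "shoot 0 x = shoot_coeff 0 x"
proof -
  have "shoot 0 x = (\<Sum>k\<in>{0}. (-0) ^ k * shoot_coeff k x)" unfolding shoot_def by (rule suminf_finite) auto
  then show ?thesis by simp
qed

text \<open>
  All coefficients are nonnegative, so the difference of the alternating series is bounded by the difference of the
  series with positive signs, which is majorised by exponential series.  The factor \<open>x + 1\<close> is needed to preserve
  positivity near \<open>-1\<close> when \<open>\<mu>\<close> is perturbed.
\<close>
lemma shoot_Lipschitz:
  assumes x: "x \<in> {-1..1}" and "0 \<le> \<mu>" "\<mu> \<le> \<nu>"
  shows "\<bar>shoot \<nu> x - shoot \<mu> x\<bar> \<le> (x + 1) * (exp (\<nu> * rate) - exp (\<mu> * rate))"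
proof -
  have e: "(\<lambda>k. (x + 1) * (\<nu> ^ k * (rate ^ k / fact k) - \<mu> ^ k * (rate ^ k / fact k))) sums ((x + 1) * (exp (\<nu> * rate) - exp (\<mu> * rate)))"
    using exp_sums[of \<nu>] exp_sums[of \<mu>] assms by (intro sums_mult sums_diff) auto
  have s: "summable (\<lambda>k. (-\<nu>) ^ k * shoot_coeff k x - (-\<mu>) ^ k * shoot_coeff k x)"
    by (intro summable_diff series_summable x)
  have "norm (\<Sum>k. (-\<nu>) ^ k * shoot_coeff k x - (-\<mu>) ^ k * shoot_coeff k x) \<le> (x + 1) * (exp (\<nu> * rate) - exp (\<mu> * rate))"
    unfolding sums_unique[OF e]
  proof (rule norm_suminf_le)
    fix k
    have "norm ((-\<nu>) ^ k * shoot_coeff k x - (-\<mu>) ^ k * shoot_coeff k x) = \<bar>(-\<nu>) ^ k - (-\<mu>) ^ k\<bar> * \<bar>shoot_coeff k x\<bar>"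
      by (simp only: left_diff_distrib[symmetric] real_norm_def abs_mult)
    also have "\<bar>(-\<nu>) ^ k - (-\<mu>) ^ k\<bar> = \<nu> ^ k - \<mu> ^ k"
    proof -
      have "(-\<nu>) ^ k - (-\<mu>) ^ k = (-1) ^ k * (\<nu> ^ k - \<mu> ^ k)"
        by (simp add: power_minus[of \<nu>] power_minus[of \<mu>] right_diff_distrib)
      then have "\<bar>(-\<nu>) ^ k - (-\<mu>) ^ k\<bar> = \<bar>\<nu> ^ k - \<mu> ^ k\<bar>" by (simp add: abs_mult power_abs)
      then show ?thesis using power_mono[of \<mu> \<nu> k] assms by simp
    qed
    also have "(\<nu> ^ k - \<mu> ^ k) * \<bar>shoot_coeff k x\<bar> \<le> (\<nu> ^ k - \<mu> ^ k) * ((x + 1) * (rate ^ k / fact k))"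
      using power_mono[of \<mu> \<nu> k] assms shoot_coeff_bounds[OF x, of k] by (intro mult_left_mono) auto
    also have "\<dots> = (x + 1) * (\<nu> ^ k * (rate ^ k / fact k) - \<mu> ^ k * (rate ^ k / fact k))"
    proof -
      have "(a - b) * (y * r) = y * (a * r - b * r)" for a b y r :: real by algebra
      then show ?thesis .
    qed
    finally show "norm ((-\<nu>) ^ k * shoot_coeff k x - (-\<mu>) ^ k * shoot_coeff k x) \<le> (x + 1) * (\<nu> ^ k * (rate ^ k / fact k) - \<mu> ^ k * (rate ^ k / fact k))" .
  qed (rule sums_summable[OF e])
  then show ?thesis
    unfolding shoot_def by (subst suminf_diff) (auto intro: series_summable[OF x])
qed

end

section \<open>The principal eigenvalue\<close>

lemma slope_nonpos_at_zero:
  assumes F: "primitive_on (-1) 1 F f" "continuous_on {-1..1} f" and z: "-1 \<le> y" "y < z" "z \<le> 1" "F z = 0"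
    and pos: "\<And>t. y < t \<Longrightarrow> t < z \<Longrightarrow> 0 < F t"
  shows "f z \<le> 0"
proof (rule ccontr)
  assume "\<not> f z \<le> 0"
  then have fz: "0 < f z" by simp
  have "\<exists>e>0. \<forall>t\<in>{-1..1}. dist t z < e \<longrightarrow> dist (f t) (f z) < f z"
    using F(2) z fz by (intro continuous_on_iff[THEN iffD1, rule_format]) auto
  then obtain e where e: "e > 0" "\<And>t. t \<in> {-1..1} \<Longrightarrow> \<bar>t - z\<bar> < e \<Longrightarrow> \<bar>f t - f z\<bar> < f z"
    by (auto simp: dist_real_def)
  define s where "s = max ((y + z) / 2) (z - e / 2)"
  have s: "y < s" "s < z" "z - s < e" 
  proof -
    have "z - e / 2 \<le> s" "(y + z) / 2 \<le> s" by (simp_all add: s_def)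
    then show "y < s" "z - s < e" using z e(1) by simp_all
    show "s < z" using z e(1) by (simp add: s_def)
  qed
  have "F s \<le> F z"
    using s z e(2) by (intro primitive_on_mono[OF F(1)]) (auto simp: abs_if less_imp_le split: if_splits, smt (verit))
  then show False using pos[of s] s z by simp
qed

lemma slope_nonneg_at_zero:
  assumes F: "primitive_on (-1) 1 F f" "continuous_on {-1..1} f" and z: "-1 \<le> z" "z < y" "y \<le> 1" "F z = 0"
    and pos: "\<And>t. z < t \<Longrightarrow> t < y \<Longrightarrow> 0 < F t"
  shows "0 \<le> f z"
proof -
  have "continuous_on {-1..1} (\<lambda>x. - f (-x))"
    by (intro continuous_intros continuous_on_compose2[OF F(2)]) auto
  from slope_nonpos_at_zero[OF primitive_on_reflect[OF F(1)] this, of "-y" "-z"]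
  show ?thesis using z pos by auto
qed

context bounded_weight
begin

lemma shoot_continuous: "continuous_on {-1..1} (shoot \<mu>)" by (rule primitive_on_continuous[OF shoot_primitive])
lemma slope_continuous: "continuous_on {-1..1} (slope \<mu>)" by (rule primitive_on_continuous[OF slope_primitive])

lemma shoot_straight_if_no_mass:
  assumes z: "\<And>x. x \<in> {-1..y} \<Longrightarrow> integral {-1..x} (\<lambda>t. - \<mu> * m t * shoot \<mu> t) = 0" and y: "y \<in> {-1..1}"
  shows "shoot \<mu> y = y + 1"
proof -
  have s: "slope \<mu> x = 1" if "x \<in> {-1..y}" for x
    using primitive_on_diff[OF slope_primitive, of "-1" x \<mu>] z[OF that] that y by (simp add: slope_left)
  have "shoot \<mu> y = integral {-1..y} (slope \<mu>)"
    using primitive_on_diff[OF shoot_primitive, of "-1" y \<mu>] y by (simp add: shoot_left)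
  also have "\<dots> = integral {-1..y} (\<lambda>_. 1)" by (rule integral_cong) (rule s)
  also have "\<dots> = y + 1" using y by simp
  finally show ?thesis .
qed

text \<open>
  Where the solution vanishes identically its slope would stay equal to the initial slope one.
\<close>
lemma shoot_not_flat:
  assumes "-1 < y" "y \<le> 1" shows "\<exists>x\<in>{-1<..y}. shoot \<mu> x \<noteq> 0"
proof (rule ccontr)
  assume "\<not> ?thesis"
  then have 0: "shoot \<mu> t = 0" if "t \<in> {-1..y}" for t using that shoot_left by (cases "t = -1") auto
  have "integral {-1..x} (\<lambda>t. - \<mu> * m t * shoot \<mu> t) = integral {-1..x} (\<lambda>_. 0)" if "x \<in> {-1..y}" for x
    by (rule integral_cong) (use 0 that in auto)
  then have "shoot \<mu> y = y + 1" using assms by (intro shoot_straight_if_no_mass) auto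
  then show False using 0[of y] assms by auto
qed

text \<open>
  As long as it is nonnegative, the solution is concave.
\<close>
lemma shoot_above_chord:
  assumes \<mu>: "0 \<le> \<mu>" and nn: "\<And>x. x \<in> {-1..1} \<Longrightarrow> 0 \<le> shoot \<mu> x" and ab: "-1 \<le> a" "a \<le> x" "x \<le> b" "b \<le> 1"
  shows "(b - x) * shoot \<mu> a + (x - a) * shoot \<mu> b \<le> (b - a) * shoot \<mu> x"
proof -
  have anti: "slope \<mu> t \<le> slope \<mu> s" if "-1 \<le> s" "s \<le> t" "t \<le> 1" for s t
  proof -
    have "- slope \<mu> s \<le> - slope \<mu> t"
      using primitive_on_mono[OF primitive_on_cmult[OF slope_primitive, of "-1"] that] \<mu> nn m_bounds that
      by (auto intro!: mult_nonneg_nonneg)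
    then show ?thesis by simp
  qed
  have I: "(slope \<mu> has_integral shoot \<mu> t - shoot \<mu> s) {s..t}" if "-1 \<le> s" "s \<le> t" "t \<le> 1" for s t
    by (rule primitive_on_has_integral[OF shoot_primitive that])
  have "slope \<mu> x * (x - a) \<le> shoot \<mu> x - shoot \<mu> a"
  proof (rule has_integral_le[OF _ I])
    show "((\<lambda>_. slope \<mu> x) has_integral slope \<mu> x * (x - a)) {a..x}"
      using has_integral_const_real[of "slope \<mu> x" a x] ab by (simp add: mult.commute)
  qed (use ab anti in auto)
  then have 1: "(b - x) * (slope \<mu> x * (x - a)) \<le> (b - x) * (shoot \<mu> x - shoot \<mu> a)"
    using ab by (intro mult_left_mono) auto
  have "shoot \<mu> b - shoot \<mu> x \<le> slope \<mu> x * (b - x)"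
  proof (rule has_integral_le[OF I])
    show "((\<lambda>_. slope \<mu> x) has_integral slope \<mu> x * (b - x)) {x..b}"
      using has_integral_const_real[of "slope \<mu> x" x b] ab by (simp add: mult.commute)
  qed (use ab anti in auto)
  then have "(x - a) * (shoot \<mu> b - shoot \<mu> x) \<le> (x - a) * (slope \<mu> x * (b - x))"
    using ab by (intro mult_left_mono) auto
  with 1 show ?thesis by (simp add: algebra_simps)
qed

text \<open>
  Sturm comparison.  Suppose \<open>\<nu> < \<mu>\<close>.  On an interval \<open>[\<alpha>,\<beta>]\<close> between consecutive zeros of \<open>\<psi>\<close>
  where \<open>\<psi> > 0\<close>, the Wronskian with the positive eigenfunction is nondecreasing, nonnegative at \<open>\<alpha>\<close> and
  nonpositive at \<open>\<beta>\<close>, so it vanishes.  Then both functions are proportional, the interval is the whole of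
  \<open>[-1,1]\<close>, and two different eigenvalues with the same eigenfunction force \<open>m \<phi> = 0\<close>; but then
  \<open>\<phi>\<close> is the line \<open>x + 1\<close>, which is not zero at \<open>1\<close>.
\<close>
lemma principal_eigenvalue_least:
  assumes \<mu>: "\<And>x. x \<in> Omega \<Longrightarrow> 0 < shoot \<mu> x" "shoot \<mu> 1 = 0"
    and P: "primitive_on (-1) 1 P (\<lambda>x. - \<nu> * m x * \<psi> x)" and \<psi>: "primitive_on (-1) 1 \<psi> P"
    and bc: "\<psi> (-1) = 0" "\<psi> 1 = 0" and nz: "x0 \<in> Omega" "\<psi> x0 \<noteq> 0"
  shows "\<mu> \<le> \<nu>"
proof -
  have main: "\<mu> \<le> \<nu>"
    if P: "primitive_on (-1) 1 P (\<lambda>x. - \<nu> * m x * \<psi> x)" and \<psi>: "primitive_on (-1) 1 \<psi> P"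
      and bc: "\<psi> (-1) = 0" "\<psi> 1 = 0" and nz: "0 < \<psi> x0" for P \<psi>
  proof (rule ccontr)
    assume "\<not> \<mu> \<le> \<nu>"
    then have lt: "\<nu> < \<mu>" by simp
    have \<psi>c: "continuous_on {-1..1} \<psi>" and Pc: "continuous_on {-1..1} P"
      using P \<psi> by (auto intro: primitive_on_continuous)
    obtain \<alpha> where \<alpha>: "-1 \<le> \<alpha>" "\<alpha> < x0" "\<psi> \<alpha> = 0" "\<And>t. \<alpha> < t \<Longrightarrow> t \<le> x0 \<Longrightarrow> 0 < \<psi> t"
      using last_zero_before[OF continuous_on_subset[OF \<psi>c, of "{-1..x0}"], of "-1"] bc nz \<open>x0 \<in> Omega\<close> by auto
    obtain \<beta> where \<beta>: "x0 < \<beta>" "\<beta> \<le> 1" "\<psi> \<beta> = 0" "\<And>t. x0 \<le> t \<Longrightarrow> t < \<beta> \<Longrightarrow> 0 < \<psi> t"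
      using first_zero_after[OF continuous_on_subset[OF \<psi>c, of "{x0..1}"], of 1] bc nz \<open>x0 \<in> Omega\<close> by auto
    have pos: "0 < \<psi> t" if "\<alpha> < t" "t < \<beta>" for t using \<alpha>(4)[of t] \<beta>(4)[of t] that by (cases "t \<le> x0") auto
    have sh: "0 \<le> shoot \<mu> t" if "t \<in> {-1..1}" for t
      using \<mu> that shoot_left[of \<mu>] by (cases "t = -1 \<or> t = 1") (auto simp: less_eq_real_def)
    define Q where "Q x = shoot \<mu> x * P x - \<psi> x * slope \<mu> x" for x
    have Q: "primitive_on (-1) 1 Q (\<lambda>x. (\<mu> - \<nu>) * m x * (shoot \<mu> x * \<psi> x))"
      by (rule primitive_on_cong[OF primitive_on_diff_fun[OF primitive_on_mult[OF shoot_primitive[of \<mu>] P]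
              primitive_on_mult[OF \<psi> slope_primitive[of \<mu>]]]])
        (auto simp: Q_def algebra_simps)
    have Qmono: "Q s \<le> Q t" if "\<alpha> \<le> s" "s \<le> t" "t \<le> \<beta>" for s t
    proof (rule primitive_on_mono[OF Q])
      fix x assume x: "x \<in> {s..t}"
      have "0 \<le> \<psi> x" using pos[of x] \<alpha>(3) \<beta>(3) x that by (cases "x = \<alpha> \<or> x = \<beta>") (auto simp: less_eq_real_def)
      then show "0 \<le> (\<mu> - \<nu>) * m x * (shoot \<mu> x * \<psi> x)"
        using lt m_bounds[of x] sh[of x] x that \<alpha> \<beta> by (intro mult_nonneg_nonneg) auto
    qed (use that \<alpha> \<beta> in auto)
    have "P \<beta> \<le> 0" by (rule slope_nonpos_at_zero[OF \<psi> Pc, of \<alpha>]) (use \<alpha> \<beta> pos in auto)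
    then have Qb: "Q \<beta> \<le> 0" using sh[of \<beta>] \<alpha> \<beta> by (simp add: Q_def mult_nonneg_nonpos)
    have "0 \<le> P \<alpha>" by (rule slope_nonneg_at_zero[OF \<psi> Pc, of _ \<beta>]) (use \<alpha> \<beta> pos in auto)
    then have Qa: "0 \<le> Q \<alpha>" using sh[of \<alpha>] \<alpha> \<beta> by (simp add: Q_def)
    have Q0: "Q x = 0" if "x \<in> {\<alpha>..\<beta>}" for x
      using Qmono[of \<alpha> x] Qmono[of x \<beta>] Qa Qb that by auto
    define \<kappa> where "\<kappa> = \<psi> x0 / shoot \<mu> x0"
    have \<kappa>: "0 < \<kappa>" using nz \<mu>(1)[OF \<open>x0 \<in> Omega\<close>] by (simp add: \<kappa>_def)
    have ratio: "\<psi> x = \<kappa> * shoot \<mu> x" if x: "x \<in> {\<alpha><..<\<beta>}" for x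
    proof -
      have "((\<lambda>t. \<psi> t / shoot \<mu> t) has_field_derivative 0) (at t within {\<alpha><..<\<beta>})" if t: "t \<in> {\<alpha><..<\<beta>}" for t
      proof -
        have t1: "t \<in> Omega" using t \<alpha> \<beta> by auto
        have "(\<psi> has_real_derivative P t) (at t)" by (rule primitive_on_DERIV[OF \<psi> Pc]) (use t1 in auto)
        moreover have "(shoot \<mu> has_real_derivative slope \<mu> t) (at t)"
          by (rule primitive_on_DERIV[OF shoot_primitive slope_continuous]) (use t1 in auto)
        ultimately have "((\<lambda>t. \<psi> t / shoot \<mu> t) has_real_derivative
            (P t * shoot \<mu> t - \<psi> t * slope \<mu> t) / (shoot \<mu> t * shoot \<mu> t)) (at t)"
          using \<mu>(1)[OF t1] by (intro DERIV_divide) auto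
        then show ?thesis
          using Q0[of t] t by (simp add: Q_def mult.commute has_field_derivative_at_within)
      qed
      then obtain k where k: "\<forall>t\<in>{\<alpha><..<\<beta>}. \<psi> t / shoot \<mu> t = k"
        using has_field_derivative_zero_constant[of "{\<alpha><..<\<beta>}" "\<lambda>t. \<psi> t / shoot \<mu> t"] by auto
      then have "\<psi> x / shoot \<mu> x = \<kappa>" using x \<alpha> \<beta> by (auto simp: \<kappa>_def)
      then show ?thesis using \<mu>(1)[of x] x \<alpha> \<beta> by (auto simp: field_simps)
    qed
    have cl: "closure {\<alpha><..<\<beta>} = {\<alpha>..\<beta>}" using \<alpha> \<beta> by simp
    have sub: "{\<alpha>..\<beta>} \<subseteq> {-1..1}" using \<alpha> \<beta> by auto
    have ratio': "\<psi> x - \<kappa> * shoot \<mu> x = 0" if "x \<in> {\<alpha>..\<beta>}" for x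
    proof (rule continuous_constant_on_closure[where S = "{\<alpha><..<\<beta>}" and f = "\<lambda>x. \<psi> x - \<kappa> * shoot \<mu> x"])
      show "continuous_on (closure {\<alpha><..<\<beta>}) (\<lambda>x. \<psi> x - \<kappa> * shoot \<mu> x)" unfolding cl
        by (intro continuous_intros continuous_on_subset[OF \<psi>c sub] continuous_on_subset[OF shoot_continuous sub])
    qed (use ratio that cl in auto)
    have "shoot \<mu> \<alpha> = 0" "shoot \<mu> \<beta> = 0" using ratio'[of \<alpha>] ratio'[of \<beta>] \<alpha> \<beta> \<kappa> by auto
    then have ends: "\<alpha> = -1" "\<beta> = 1" using \<mu>(1)[of \<alpha>] \<mu>(1)[of \<beta>] \<alpha> \<beta> \<open>x0 \<in> Omega\<close>
      by (auto simp: less_eq_real_def)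
    have eq: "\<psi> x = \<kappa> * shoot \<mu> x" if "x \<in> {-1..1}" for x using ratio'[of x] that ends by simp
    have Peq: "P x = \<kappa> * slope \<mu> x" if x: "x \<in> {-1..1}" for x
    proof (rule vector_derivative_unique_within_closed_interval[of "-1" 1 x \<psi>])
      show "(\<psi> has_vector_derivative P x) (at x within cbox (-1) 1)"
        using primitive_on_DERIV_within[OF \<psi> Pc x] by (simp add: has_real_derivative_iff_has_vector_derivative)
      have "((\<lambda>x. \<kappa> * shoot \<mu> x) has_real_derivative \<kappa> * slope \<mu> x) (at x within {-1..1})"
        by (intro DERIV_cmult primitive_on_DERIV_within[OF shoot_primitive slope_continuous x])
      then have "(\<psi> has_real_derivative \<kappa> * slope \<mu> x) (at x within {-1..1})"
        by (rule has_field_derivative_transform_within[OF _ zero_less_one x]) (simp add: eq)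
      then show "(\<psi> has_vector_derivative \<kappa> * slope \<mu> x) (at x within cbox (-1) 1)"
        by (simp add: has_real_derivative_iff_has_vector_derivative)
    qed (use x in auto)
    have "integral {-1..x} (\<lambda>t. - \<mu> * m t * shoot \<mu> t) = 0" if x: "x \<in> {-1..1}" for x
    proof -
      have Qx: "((\<lambda>t. (\<mu> - \<nu>) * m t * (shoot \<mu> t * \<psi> t)) has_integral 0) {-1..x}"
        using primitive_on_has_integral[OF Q, of "-1" x] Q0[of x] Q0[of "-1"] x ends by simp
      have 1: "((\<lambda>t. - \<nu> * m t * \<psi> t) has_integral P x - P (-1)) {-1..x}"
        by (rule primitive_on_has_integral[OF P]) (use x in auto)
      have 2: "((\<lambda>t. \<kappa> * (- \<mu> * m t * shoot \<mu> t)) has_integral \<kappa> * (slope \<mu> x - slope \<mu> (-1))) {-1..x}"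
        by (intro has_integral_mult_right primitive_on_has_integral[OF slope_primitive]) (use x in auto)
      have 3: "P x - P (-1) - \<kappa> * (slope \<mu> x - slope \<mu> (-1)) = 0"
        using Peq[of x] Peq[of "-1"] x by (simp add: right_diff_distrib)
      have "((\<lambda>t. - \<nu> * m t * \<psi> t - \<kappa> * (- \<mu> * m t * shoot \<mu> t)) has_integral 0) {-1..x}"
        using has_integral_diff[OF 1 2] unfolding 3 .
      then have "((\<lambda>t. \<kappa> * (\<mu> - \<nu>) * (m t * shoot \<mu> t)) has_integral 0) {-1..x}"
        by (rule has_integral_eq[rotated]) (use x in \<open>auto simp: eq algebra_simps\<close>)
      from has_integral_mult_right[OF this, of "- \<mu> / (\<kappa> * (\<mu> - \<nu>))"]
      have "((\<lambda>t. - \<mu> * m t * shoot \<mu> t) has_integral 0) {-1..x}"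
        using \<kappa> lt by (simp add: mult.assoc)
      then show ?thesis by (rule integral_unique)
    qed
    then have "shoot \<mu> 1 = 1 + 1" by (intro shoot_straight_if_no_mass) auto
    then show False using \<mu>(2) by simp
  qed
  show ?thesis
  proof (cases "0 < \<psi> x0")
    case True then show ?thesis by (rule main[OF P \<psi> bc])
  next
    case False
    have "primitive_on (-1) 1 (\<lambda>x. - P x) (\<lambda>x. - \<nu> * m x * (- \<psi> x))" "primitive_on (-1) 1 (\<lambda>x. - \<psi> x) (\<lambda>x. - P x)"
      using primitive_on_cmult[OF P, of "-1"] primitive_on_cmult[OF \<psi>, of "-1"] by simp_all
    then show ?thesis using main[of "\<lambda>x. - P x" "\<lambda>x. - \<psi> x"] bc nz False by simp
  qed
qed

end

sublocale logistic_profile \<subseteq> bounded_weight K m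
  by unfold_locales (rule m_measurable m_bounds)+

context logistic_profile
begin

lemma V_right_end: "V 1 \<le> 0"
proof (rule ccontr)
  assume "\<not> V 1 \<le> 0"
  obtain a where "-1 < a" "a < 1" "V a = 0" using obtain_maximum by blast
  then show False using energy_pos_left[of 1 a] energy_right_end \<open>\<not> V 1 \<le> 0\<close> by auto
qed

text \<open>
  The Wronskian of the shooting solution \<open>\<phi>\<close> for \<open>\<mu> = 1/d\<close> and \<open>u\<close> has derivative \<open>\<phi> u\<^sup>2/d\<close>.  If
  \<open>\<phi>\<close> were nonnegative, its total increase would be nonnegative as well, while its value at the right end,
  \<open>\<phi>(1) V(1)\<close>, is nonpositive; so \<open>\<phi> u\<^sup>2\<close> and hence \<open>\<phi>\<close> would vanish.
\<close>
lemma shoot_changes_sign: "\<exists>x\<in>{-1..1}. shoot (1 / d) x < 0"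
proof (rule ccontr)
  assume neg: "\<not> ?thesis"
  have nn: "0 \<le> shoot (1 / d) x" if "x \<in> {-1..1}" for x using neg that not_le by blast
  have "primitive_on (-1) 1 (\<lambda>x. shoot (1 / d) x * V x - u x * slope (1 / d) x) (\<lambda>x. shoot (1 / d) x * (u x * u x) / d)"
    by (rule primitive_on_cong[OF primitive_on_diff_fun[OF primitive_on_mult[OF shoot_primitive[of "1 / d"] V]
            primitive_on_mult[OF u slope_primitive[of "1 / d"]]]])
      (use d in \<open>auto simp: field_simps\<close>)
  from primitive_on_has_integral[OF this, of "-1" 1]
  have i: "((\<lambda>x. shoot (1 / d) x * (u x * u x) / d) has_integral shoot (1 / d) 1 * V 1) {-1..1}"
    using boundary by (simp add: shoot_left)
  have "shoot (1 / d) 1 * V 1 \<le> 0" using nn[of 1] V_right_end by (simp add: mult_nonneg_nonpos)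
  moreover have "0 \<le> shoot (1 / d) 1 * V 1"
    by (rule has_integral_nonneg[OF i]) (use nn d in auto)
  ultimately have "shoot (1 / d) 1 * V 1 = 0" by linarith
  with i have i0: "((\<lambda>x. shoot (1 / d) x * (u x * u x) / d) has_integral 0) (cbox (-1) 1)" by (simp only: box_real)
  have "shoot (1 / d) x = 0" if "x \<in> {-1<..0}" for x
  proof -
    have "shoot (1 / d) x * (u x * u x) / d = 0"
    proof (rule has_integral_0_cbox_imp_0[OF _ _ i0])
      show "continuous_on (cbox (-1) 1) (\<lambda>x. shoot (1 / d) x * (u x * u x) / d)"
        using d by (auto intro!: continuous_intros shoot_continuous u_continuous)
    qed (use that nn d in auto)
    then show ?thesis using u_pos[of x] that d by auto
  qed
  then show False using shoot_not_flat[of 0 "1 / d"] by auto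
qed

text \<open>
  The eigenvalue is the largest \<open>\<mu> \<le> 1/d\<close> whose shooting solution is nonnegative.  If that solution were positive
  at \<open>1\<close>, it would lie above a positive multiple of \<open>x + 1\<close> by concavity, and \<open>\<mu>\<close> could be increased.
\<close>
lemma obtain_principal_eigenvalue:
  obtains \<mu> where "0 < \<mu>" "\<mu> < 1 / d" "\<And>x. x \<in> Omega \<Longrightarrow> 0 < shoot \<mu> x" "shoot \<mu> 1 = 0"
proof -
  define S where "S = {\<mu> \<in> {0..1 / d}. \<forall>x\<in>{-1..1}. 0 \<le> shoot \<mu> x}"
  have "slope_coeff 0 = (\<lambda>_. 1)" by (rule ext) simp
  then have s0: "shoot 0 x = x + 1" if "x \<in> {-1..1}" for x using that by (simp add: shoot_zero shoot_coeff_def)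
  have S0: "0 \<in> S" using d s0 by (auto simp: S_def)
  have bdd: "bdd_above S" by (rule bdd_aboveI[of _ "1 / d"]) (auto simp: S_def)
  define \<mu> where "\<mu> = Sup S"
  have \<mu>0: "0 \<le> \<mu>" unfolding \<mu>_def by (rule cSup_upper[OF S0 bdd])
  have \<mu>1: "\<mu> \<le> 1 / d" unfolding \<mu>_def by (rule cSup_least) (use S0 in blast, simp add: S_def)
  have expc: "\<exists>\<delta>>0. \<forall>\<nu>. \<bar>\<nu> - \<mu>\<bar> < \<delta> \<longrightarrow> \<bar>exp (\<nu> * rate) - exp (\<mu> * rate)\<bar> < e" if "0 < e" for e
  proof -
    have "continuous_on UNIV (\<lambda>\<nu>. exp (\<nu> * rate))" by (intro continuous_intros)
    then show ?thesis using that unfolding continuous_on_iff dist_real_def by simp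
  qed
  have \<mu>S: "\<mu> \<in> S"
  proof -
    have "0 \<le> shoot \<mu> x" if x: "x \<in> {-1..1}" for x
    proof (rule ccontr)
      assume n: "\<not> 0 \<le> shoot \<mu> x"
      then obtain \<delta> where \<delta>: "\<delta> > 0" "\<And>\<nu>. \<bar>\<nu> - \<mu>\<bar> < \<delta> \<Longrightarrow> \<bar>exp (\<nu> * rate) - exp (\<mu> * rate)\<bar> < - shoot \<mu> x / 2"
        using expc[of "- shoot \<mu> x / 2"] by auto
      obtain \<nu> where \<nu>: "\<nu> \<in> S" "\<mu> - \<delta> < \<nu>"
        using less_cSup_iff[of S "\<mu> - \<delta>"] S0 bdd \<delta>(1) by (auto simp: \<mu>_def)
      have le: "\<nu> \<le> \<mu>" unfolding \<mu>_def by (rule cSup_upper[OF \<nu>(1) bdd])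
      have "\<bar>shoot \<mu> x - shoot \<nu> x\<bar> \<le> (x + 1) * (exp (\<mu> * rate) - exp (\<nu> * rate))"
        by (rule shoot_Lipschitz[OF x _ le]) (use \<nu> in \<open>auto simp: S_def\<close>)
      also have "\<dots> \<le> 2 * (exp (\<mu> * rate) - exp (\<nu> * rate))"
        using x le rate_nonneg by (intro mult_right_mono) (auto intro: mult_right_mono)
      also have "\<dots> < - shoot \<mu> x" using \<delta>(2)[of \<nu>] \<nu>(2) le by auto
      finally have "shoot \<nu> x < 0" by linarith
      moreover have "0 \<le> shoot \<nu> x" using \<nu>(1) x unfolding S_def by blast
      ultimately show False by simp
    qed
    then show ?thesis using \<mu>0 \<mu>1 by (auto simp: S_def)
  qed
  have nn: "0 \<le> shoot \<mu> x" if "x \<in> {-1..1}" for x using \<mu>S that by (auto simp: S_def)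
  have lt: "\<mu> < 1 / d"
    using shoot_changes_sign nn \<mu>1 by (cases "\<mu> = 1 / d") force+
  have end0: "shoot \<mu> 1 = 0"
  proof (rule ccontr)
    assume "shoot \<mu> 1 \<noteq> 0"
    then have p: "0 < shoot \<mu> 1" using nn[of 1] by auto
    then obtain \<delta> where \<delta>: "\<delta> > 0" "\<And>\<nu>. \<bar>\<nu> - \<mu>\<bar> < \<delta> \<Longrightarrow> \<bar>exp (\<nu> * rate) - exp (\<mu> * rate)\<bar> < shoot \<mu> 1 / 2"
      using expc[of "shoot \<mu> 1 / 2"] by auto
    define \<nu> where "\<nu> = min (1 / d) (\<mu> + \<delta> / 2)"
    have \<nu>: "\<mu> < \<nu>" "\<nu> \<le> 1 / d" "\<bar>\<nu> - \<mu>\<bar> < \<delta>" using lt \<delta>(1) by (auto simp: \<nu>_def)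
    have "0 \<le> shoot \<nu> x" if x: "x \<in> {-1..1}" for x
    proof -
      have "\<bar>shoot \<nu> x - shoot \<mu> x\<bar> \<le> (x + 1) * (exp (\<nu> * rate) - exp (\<mu> * rate))"
        by (rule shoot_Lipschitz[OF x \<mu>0]) (use \<nu> in simp)
      also have "\<dots> \<le> (x + 1) * (shoot \<mu> 1 / 2)"
        using abs_ge_self[of "exp (\<nu> * rate) - exp (\<mu> * rate)"] \<delta>(2)[OF \<nu>(3)] x by (intro mult_left_mono) auto
      also have "\<dots> \<le> shoot \<mu> x"
        using shoot_above_chord[OF \<mu>0 nn, of "-1" x 1] x by (simp add: shoot_left)
      finally show ?thesis by linarith
    qed
    then have "\<nu> \<in> S" using \<mu>0 \<nu> by (auto simp: S_def)
    then have "\<nu> \<le> \<mu>" unfolding \<mu>_def by (rule cSup_upper[OF _ bdd])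
    then show False using \<nu>(1) by simp
  qed
  have "0 < shoot \<mu> x" if x: "x \<in> Omega" for x
  proof (rule ccontr)
    assume "\<not> 0 < shoot \<mu> x"
    then have x0: "shoot \<mu> x = 0" using nn[of x] x by auto
    have "shoot \<mu> y = 0" if y: "y \<in> {-1<..x}" for y
    proof -
      have "(1 - x) * shoot \<mu> y \<le> 0"
        using shoot_above_chord[OF \<mu>0 nn, of y x 1] x y x0 end0 by simp
      then show ?thesis using x y nn[of y] by (simp add: mult_le_0_iff)
    qed
    then show False using shoot_not_flat[of x \<mu>] x by auto
  qed
  moreover have "\<mu> \<noteq> 0" using end0 s0[of 1] by auto
  ultimately show thesis using that[of \<mu>] \<mu>0 lt end0 by auto
qed

theorem lambda1_bound:
  assumes p: "0 < p" and ae: "AE x in lebesgue_on Omega. m0 x = m x"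
  shows "0 < lambda1 p m0" "lambda1 p m0 < 1 / d"
proof -
  obtain \<mu> where \<mu>: "0 < \<mu>" "\<mu> < 1 / d" "\<And>x. x \<in> Omega \<Longrightarrow> 0 < shoot \<mu> x" "shoot \<mu> 1 = 0"
    using obtain_principal_eigenvalue by blast
  have "lambda1 p m0 = \<mu>"
    unfolding lambda1_def
  proof (rule Least_equality)
    show "weighted_eigenvalue p m0 \<mu>"
      unfolding weighted_eigenvalue_def
    proof (rule bexI[of _ "shoot \<mu>"], intro conjI exI[of _ "\<lambda>x. - \<mu> * m x * shoot \<mu> x"])
      show "shoot \<mu> \<in> dirichlet_space p"
        by (rule dirichlet_space_primitives[OF p slope_primitive shoot_primitive shoot_left \<mu>(4)])
      show "\<exists>x\<in>Omega. shoot \<mu> x \<noteq> 0" using \<mu>(3)[of 0] by (intro bexI[of _ 0]) auto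
      show "weak_second_derivative (shoot \<mu>) (\<lambda>x. - \<mu> * m x * shoot \<mu> x)"
        unfolding weak_second_derivative_def
        using primitive_on_imp_weak_derivative[OF shoot_primitive] primitive_on_imp_weak_derivative[OF slope_primitive] by blast
      show "AE x in lebesgue_on Omega. - \<mu> * m x * shoot \<mu> x + \<mu> * m0 x * shoot \<mu> x = 0"
        using ae by eventually_elim simp
    qed
    fix \<nu> assume "weighted_eigenvalue p m0 \<nu>"
    then obtain \<psi> w where \<psi>: "\<psi> \<in> dirichlet_space p" "\<exists>x\<in>Omega. \<psi> x \<noteq> 0" "weak_second_derivative \<psi> w"
      "AE x in lebesgue_on Omega. w x + \<nu> * m0 x * \<psi> x = 0"
      unfolding weighted_eigenvalue_def by blast
    have \<psi>c: "continuous_on {-1..1} \<psi>" and bc: "\<psi> (-1) = 0" "\<psi> 1 = 0" using \<psi>(1) by (auto simp: dirichlet_space_def)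
    have ae': "AE x in lebesgue_on Omega. w x = - \<nu> * m x * \<psi> x"
      using \<psi>(4) ae by eventually_elim simp
    have "primitive_on (-1) 1 (\<lambda>x. - \<nu> * (0 + integral {-1..x} (\<lambda>t. m t * \<psi> t))) (\<lambda>t. - \<nu> * (m t * \<psi> t))"
      by (rule primitive_on_cmult[OF m_times_primitive[OF \<psi>c]])
    note w = primitive_onD[OF this]
    obtain B where B: "\<And>x. x \<in> {-1..1} \<Longrightarrow> \<bar>- \<nu> * m x * \<psi> x\<bar> \<le> B"
      using w(2) unfolding mult.assoc by blast
    obtain P where "primitive_on (-1) 1 P (\<lambda>x. - \<nu> * m x * \<psi> x)" "primitive_on (-1) 1 \<psi> P"
      by (rule weak_second_derivative_imp_primitives[OF \<psi>c \<psi>(3) ae' _ B]) (use w(1) in \<open>simp_all add: mult.assoc\<close>)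
    then show "\<mu> \<le> \<nu>" using principal_eigenvalue_least[OF \<mu>(3,4)] bc \<psi>(2) by blast
  qed
  then show "0 < lambda1 p m0" "lambda1 p m0 < 1 / d" using \<mu> by auto
qed

end

section \<open>A concentrated weight\<close>

text \<open>
  The profile \<open>6/(\<bar>x\<bar> + \<delta>)\<^sup>2\<close> solves \<open>U'' = U\<^sup>2\<close> with zero energy.  Its corner at the origin is replaced by a
  parabola on \<open>\<bar>x\<bar> \<le> \<eta>\<close>, where \<open>\<eta> = \<delta>\<^sup>2\<close> is small compared with \<open>\<delta>\<close>; the constants \<open>A\<close>
  and \<open>B\<close> match value and slope at \<open>\<eta>\<close>.  The point \<open>c\<close> is the one whose tangent line meets the axis at
  \<open>1\<close>, and \<open>- k\<close> is the slope there.
\<close>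
locale concentrated =
  fixes \<delta> :: real
  assumes \<delta>: "0 < \<delta>" "\<delta> < 1 / 4"
begin

definition \<eta> :: real where "\<eta> = \<delta>\<^sup>2"
definition r :: real where "r = \<eta> + \<delta>"
definition c :: real where "c = (2 - \<delta>) / 3"
definition k :: real where "k = 12 / (c + \<delta>) ^ 3"
definition B :: real where "B = 6 / (\<eta> * r ^ 3)"
definition A :: real where "A = 6 / r\<^sup>2 + B * \<eta>\<^sup>2"

definition U :: "real \<Rightarrow> real" where
  "U x = (if \<bar>x\<bar> \<le> \<eta> then A - B * x\<^sup>2 else if \<bar>x\<bar> \<le> c then 6 / (\<bar>x\<bar> + \<delta>)\<^sup>2 else k * (1 - \<bar>x\<bar>))"
definition V :: "real \<Rightarrow> real" where
  "V x = (if \<bar>x\<bar> \<le> \<eta> then - 2 * B * x else if \<bar>x\<bar> \<le> c then - 12 * x / (\<bar>x\<bar> * (\<bar>x\<bar> + \<delta>) ^ 3) else - k * x / \<bar>x\<bar>)"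
text \<open>
  The weight is \<open>U - U''/U\<close> on the interval: zero along the profile, equal to \<open>U\<close> on the tangent lines, and of
  size \<open>1/(\<eta> \<delta>)\<close> on the cap.
\<close>
definition M :: "real \<Rightarrow> real" where
  "M x = (if \<bar>x\<bar> \<le> \<eta> then (A - B * x\<^sup>2) + 2 * B / (A - B * x\<^sup>2)
     else if \<bar>x\<bar> \<le> c then 0 else if \<bar>x\<bar> \<le> 1 then k * (1 - \<bar>x\<bar>) else 0)"
definition W :: "real \<Rightarrow> real" where
  "W x = (if \<bar>x\<bar> \<le> \<eta> then - 2 * B else if \<bar>x\<bar> \<le> c then 36 / (\<bar>x\<bar> + \<delta>) ^ 4 else 0)"
definition K :: real where "K = A + B * r\<^sup>2 / 3 + k"

lemma parameters: "0 < \<eta>" "\<eta> < c" "c < 1" "0 < r" "0 < B" "0 < k" "0 < A" "0 < c" "0 < c + \<delta>"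
proof -
  show e: "0 < \<eta>" using \<delta> by (simp add: \<eta>_def)
  have "\<delta> * \<delta> < \<delta>" using \<delta> by simp
  also have "\<delta> < c" using \<delta> by (simp add: c_def)
  finally show "\<eta> < c" by (simp add: \<eta>_def power2_eq_square)
  show "c < 1" "0 < c" "0 < c + \<delta>" using \<delta> by (simp_all add: c_def field_simps)
  then show k: "0 < k" by (simp add: k_def)
  show r: "0 < r" using e \<delta> by (simp add: r_def)
  show B: "0 < B" using e r by (simp add: B_def)
  show "0 < A" using r B by (simp add: A_def add_pos_nonneg)
qed

lemma match_inner: "A - B * \<eta>\<^sup>2 = 6 / (\<eta> + \<delta>)\<^sup>2" by (simp add: A_def r_def)
lemma match_outer: "k * (1 - c) = 6 / (c + \<delta>)\<^sup>2"
proof -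
  have "1 - c = (c + \<delta>) / 2" by (simp add: c_def field_simps)
  then have k: "k * (1 - c) = 12 / (c + \<delta>) ^ 3 * ((c + \<delta>) / 2)" by (simp only: k_def)
  have *: "12 / y ^ 3 * (y / 2) = 6 / y\<^sup>2" if "y \<noteq> 0" for y :: real
    using that by (simp add: power2_eq_square power3_eq_cube)
  show ?thesis unfolding k by (rule *) (use parameters in simp)
qed

lemma cap_lower: "\<bar>x\<bar> \<le> \<eta> \<Longrightarrow> 6 / r\<^sup>2 \<le> A - B * x\<^sup>2"
proof -
  assume "\<bar>x\<bar> \<le> \<eta>"
  then have "\<bar>x\<bar>\<^sup>2 \<le> \<eta>\<^sup>2" by (rule power_mono) auto
  then have "B * x\<^sup>2 \<le> B * \<eta>\<^sup>2" using parameters by (intro mult_left_mono) auto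
  then show ?thesis by (simp add: A_def)
qed

lemma cap_pos: "\<bar>x\<bar> \<le> \<eta> \<Longrightarrow> 0 < A - B * x\<^sup>2"
  using less_le_trans[OF _ cap_lower, of 0 x] parameters by simp

lemma U_continuous: "continuous_on S U"
  unfolding U_def [abs_def]
proof (intro continuous_on_cases_le continuous_intros)
  fix x assume "\<bar>x\<bar> = \<eta>"
  moreover from this have "x\<^sup>2 = \<eta>\<^sup>2" by (metis power2_abs)
  ultimately show "A - B * x\<^sup>2 = (if \<bar>x\<bar> \<le> c then 6 / (\<bar>x\<bar> + \<delta>)\<^sup>2 else k * (1 - \<bar>x\<bar>))"
    using parameters match_inner by simp
next
  fix x assume "\<bar>x\<bar> = c"
  then show "6 / (\<bar>x\<bar> + \<delta>)\<^sup>2 = k * (1 - \<bar>x\<bar>)" using match_outer by simp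
qed (use \<delta> in auto)

lemma V_continuous: "continuous_on S V"
  unfolding V_def [abs_def]
proof (intro continuous_on_cases_le continuous_intros)
  fix x assume "\<bar>x\<bar> = \<eta>"
  then show "- 2 * B * x = (if \<bar>x\<bar> \<le> c then - 12 * x / (\<bar>x\<bar> * (\<bar>x\<bar> + \<delta>) ^ 3) else - k * x / \<bar>x\<bar>)"
    using parameters by (simp add: B_def r_def)
next
  fix x assume "\<bar>x\<bar> = c"
  then show "- 12 * x / (\<bar>x\<bar> * (\<bar>x\<bar> + \<delta>) ^ 3) = - k * x / \<bar>x\<bar>"
    using parameters by (simp add: k_def)
qed (use parameters \<delta> in auto)

lemma U_even: "U (-x) = U x" and V_odd: "V (-x) = - V x" and W_even: "W (-x) = W x" and M_even: "M (-x) = M x"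
  by (simp_all add: U_def V_def W_def M_def)

lemma DERIV_right:
  assumes "0 \<le> x" "x \<noteq> \<eta>" "x \<noteq> c"
  shows "(U has_real_derivative V x) (at x)" "(V has_real_derivative W x) (at x)"
proof -
  consider "x < \<eta>" | "\<eta> < x" "x < c" | "c < x" using assms by linarith
  then have "(U has_real_derivative V x) (at x) \<and> (V has_real_derivative W x) (at x)"
  proof cases
    case 1
    then have x: "x \<in> {-\<eta><..<\<eta>}" using assms parameters by auto
    have "((\<lambda>x. A - B * x\<^sup>2) has_real_derivative V x) (at x)" "((\<lambda>x. - 2 * B * x) has_real_derivative W x) (at x)"
      using x by (auto intro!: derivative_eq_intros simp: V_def W_def)
    then show ?thesis
      by (intro conjI; elim has_field_derivative_transform_within_open[OF _ open_greaterThanLessThan x])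
        (auto simp: U_def V_def)
  next
    case 2
    then have x: "x \<in> {\<eta><..<c}" by auto
    have y: "x + \<delta> \<noteq> 0" using 2 parameters \<delta> by auto
    have d: "((\<lambda>x. a / (x + \<delta>) ^ n) has_real_derivative (0 * (x + \<delta>) ^ n - a * (real n * (x + \<delta>) ^ (n - 1))) / ((x + \<delta>) ^ n * (x + \<delta>) ^ n)) (at x)"
      for a n
      by (rule DERIV_divide) (use y in \<open>auto intro!: derivative_eq_intros\<close>)
    have "((\<lambda>x. 6 / (x + \<delta>)\<^sup>2) has_real_derivative V x) (at x)"
    proof (rule DERIV_cong[OF d])
      have "(0 * y\<^sup>2 - 6 * (real 2 * y ^ (2 - 1))) / (y\<^sup>2 * y\<^sup>2) = - 12 / y ^ 3" if "y \<noteq> 0" for y :: real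
        using that by (simp add: power2_eq_square power3_eq_cube)
      from this[OF y] show "(0 * (x + \<delta>)\<^sup>2 - 6 * (real 2 * (x + \<delta>) ^ (2 - 1))) / ((x + \<delta>)\<^sup>2 * (x + \<delta>)\<^sup>2) = V x"
        using 2 parameters by (simp add: V_def)
    qed
    moreover have "((\<lambda>x. - 12 / (x + \<delta>) ^ 3) has_real_derivative W x) (at x)"
    proof (rule DERIV_cong[OF d])
      have "(0 * y ^ 3 - (- 12) * (real 3 * y ^ (3 - 1))) / (y ^ 3 * y ^ 3) = 36 / y ^ 4" if "y \<noteq> 0" for y :: real
        using that by (simp add: power2_eq_square power3_eq_cube power4_eq_xxxx)
      from this[OF y] show "(0 * (x + \<delta>) ^ 3 - (- 12) * (real 3 * (x + \<delta>) ^ (3 - 1))) / ((x + \<delta>) ^ 3 * (x + \<delta>) ^ 3) = W x"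
        using 2 parameters by (simp add: W_def)
    qed
    ultimately show ?thesis using parameters
      by (intro conjI; elim has_field_derivative_transform_within_open[OF _ open_greaterThanLessThan x])
        (auto simp: U_def V_def)
  next
    case 3
    then have x: "x \<in> {c<..}" by auto
    have "((\<lambda>x. k * (1 - x)) has_real_derivative V x) (at x)" "((\<lambda>x. - k) has_real_derivative W x) (at x)"
      using 3 parameters by (auto intro!: derivative_eq_intros simp: V_def W_def)
    then show ?thesis using parameters
      by (intro conjI; elim has_field_derivative_transform_within_open[OF _ open_greaterThan x])
        (auto simp: U_def V_def)
  qed
  then show "(U has_real_derivative V x) (at x)" "(V has_real_derivative W x) (at x)" by auto
qed

lemma DERIV_off_kinks:
  assumes "x \<notin> {-\<eta>, \<eta>, -c, c}"
  shows "(U has_real_derivative V x) (at x)" "(V has_real_derivative W x) (at x)"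
proof -
  have "(U has_real_derivative V x) (at x) \<and> (V has_real_derivative W x) (at x)"
  proof (cases "0 \<le> x")
    case True then show ?thesis using DERIV_right[of x] assms by auto
  next
    case False
    have d: "(U has_real_derivative V (-x)) (at (-x))" "(V has_real_derivative W (-x)) (at (-x))"
      using DERIV_right[of "-x"] assms False by auto
    have "((\<lambda>x. U (-x)) has_real_derivative - V (-x)) (at x)" "((\<lambda>x. - V (-x)) has_real_derivative W (-x)) (at x)"
      using d DERIV_minus[of "\<lambda>x. V (-x)" "- W (-x)" x UNIV] by (auto simp: DERIV_mirror)
    then show ?thesis by (simp add: U_even V_odd W_even)
  qed
  then show "(U has_real_derivative V x) (at x)" "(V has_real_derivative W x) (at x)" by auto
qed

lemma borel_imp_measurable: "f \<in> borel_measurable borel \<Longrightarrow> f \<in> borel_measurable (lebesgue_on {-1..1})"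
  for f :: "real \<Rightarrow> real"
  by (intro measurable_restrict_space1 measurable_completion) simp

lemma logistic_equation:
  assumes "x \<in> {-1..1}" shows "U x * (U x - M x) / 1 = W x"
proof -
  have cap: "a * (a - (a + 2 * b / a)) = - 2 * b" if "0 < a" for a b :: real using that by (simp add: field_simps)
  have mid: "6 / y\<^sup>2 * (6 / y\<^sup>2 - 0) = 36 / y ^ 4" for y :: real by (simp add: power2_eq_square power4_eq_xxxx)
  consider "\<bar>x\<bar> \<le> \<eta>" | "\<eta> < \<bar>x\<bar>" "\<bar>x\<bar> \<le> c" | "c < \<bar>x\<bar>" "\<bar>x\<bar> \<le> 1" using assms by fastforce
  then show ?thesis
  proof cases
    case 1 then show ?thesis using cap[OF cap_pos[OF 1]] by (simp add: U_def M_def W_def)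
  next
    case 2 then show ?thesis using mid[of "\<bar>x\<bar> + \<delta>"] by (simp add: U_def M_def W_def)
  next
    case 3 then show ?thesis using parameters by (simp add: U_def M_def W_def)
  qed
qed

lemma M_bounds: "0 \<le> M x" "M x \<le> K"
proof -
  have "0 \<le> M x \<and> M x \<le> K"
  proof (cases "\<bar>x\<bar> \<le> \<eta>")
    case True
    have p: "0 < 6 / r\<^sup>2" using parameters by simp
    have "2 * B / (A - B * x\<^sup>2) \<le> 2 * B / (6 / r\<^sup>2)"
      by (rule divide_left_mono[OF cap_lower[OF True]]) (use parameters p cap_pos[OF True] in auto)
    also have "\<dots> = B * r\<^sup>2 / 3" by simp
    finally have "2 * B / (A - B * x\<^sup>2) \<le> B * r\<^sup>2 / 3" .
    moreover have "0 \<le> 2 * B / (A - B * x\<^sup>2)" "0 \<le> B * x\<^sup>2" using parameters cap_pos[OF True] by simp_all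
    moreover have "M x = (A - B * x\<^sup>2) + 2 * B / (A - B * x\<^sup>2)" using True by (simp add: M_def)
    ultimately show ?thesis using cap_pos[OF True] parameters(6) unfolding K_def by linarith
  next
    case False
    have "k * (1 - \<bar>x\<bar>) \<le> k * 1" using parameters by (intro mult_left_mono) auto
    moreover have "0 \<le> A + B * r\<^sup>2 / 3" using parameters by (intro add_nonneg_nonneg) auto
    moreover have "0 \<le> M x" "M x \<le> max 0 (k * (1 - \<bar>x\<bar>))" using False parameters by (auto simp: M_def)
    ultimately show ?thesis using parameters(6) unfolding K_def by linarith
  qed
  then show "0 \<le> M x" "M x \<le> K" by auto
qed

lemma profile: "logistic_profile 1 K M U V"
proof
  show "M \<in> borel_measurable (lebesgue_on {-1..1})"
    unfolding M_def [abs_def] by (intro borel_imp_measurable) measurable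
  have W: "primitive_on (-1) 1 V W"
  proof (rule primitive_on_strong[where S = "{-\<eta>, \<eta>, -c, c}"])
    show "W \<in> borel_measurable (lebesgue_on {-1..1})"
      unfolding W_def [abs_def] by (intro borel_imp_measurable) measurable
    show "\<bar>W x\<bar> \<le> 2 * B + 36 / \<delta> ^ 4" for x
    proof -
      have "36 / (\<bar>x\<bar> + \<delta>) ^ 4 \<le> 36 / \<delta> ^ 4"
        using \<delta> by (intro divide_left_mono power_mono) auto
      then show ?thesis using parameters \<delta> by (auto simp: W_def intro: add_increasing)
    qed
  qed (use DERIV_off_kinks V_continuous in auto)
  then show "primitive_on (-1) 1 V (\<lambda>x. U x * (U x - M x) / 1)"
    by (rule primitive_on_cong) (use logistic_equation in auto)
  show "primitive_on (-1) 1 U V"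
  proof -
    obtain L where "\<And>x. x \<in> {-1..1} \<Longrightarrow> \<bar>V x\<bar> \<le> L" using continuous_on_Icc_bounded[OF V_continuous] by blast
    then show ?thesis
      by (intro primitive_on_strong[where S = "{-\<eta>, \<eta>, -c, c}"] continuous_on_Icc_measurable V_continuous U_continuous)
        (use DERIV_off_kinks in auto)
  qed
  show "U (-1) = 0" "U 1 = 0" using parameters by (auto simp: U_def)
  show "0 < U x" if "x \<in> Omega" for x
    using that cap_pos[of x] parameters \<delta> by (auto simp: U_def abs_if split: if_splits)
qed (use M_bounds in auto)



lemma integral_even:
  fixes f :: "real \<Rightarrow> real"
  assumes "\<And>x. f (-x) = f x" "f integrable_on {-1..1}"
  shows "integral {-1..1} f = 2 * integral {0..1} f"
proof -
  have "integral {-1..-0} (\<lambda>x. f (-x)) = integral {0..1} f"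
    by (rule Henstock_Kurzweil_Integration.integral_reflect_real)
  then have "integral {-1..0} f = integral {0..1} f" by (simp add: assms(1))
  then show ?thesis
    using Henstock_Kurzweil_Integration.integral_combine[of "-1" 0 1 f] assms(2) by simp
qed

lemma mass_of_U: "12 / r - 18 \<le> integral {-1..1} U"
proof -
  have Ui: "U integrable_on {x..y}" for x y by (rule integrable_continuous_real[OF U_continuous])
  have Unn: "0 \<le> U x" if "x \<in> {-1..1}" for x by (rule logistic_profile.u_nonneg[OF profile that])
  have "((\<lambda>x. 6 / (x + \<delta>)\<^sup>2) has_integral - 6 / (c + \<delta>) - (- 6 / (\<eta> + \<delta>))) {\<eta>..c}"
  proof (rule fundamental_theorem_of_calculus)
    fix x assume x: "x \<in> {\<eta>..c}"
    have "((\<lambda>x. - 6 / (x + \<delta>)) has_real_derivative 6 / (x + \<delta>)\<^sup>2) (at x within {\<eta>..c})"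
      using x parameters \<delta> by (auto intro!: derivative_eq_intros simp: power2_eq_square)
    then show "((\<lambda>x. - 6 / (x + \<delta>)) has_vector_derivative 6 / (x + \<delta>)\<^sup>2) (at x within {\<eta>..c})"
      by (simp add: has_real_derivative_iff_has_vector_derivative)
  qed (use parameters in auto)
  then have "(U has_integral - 6 / (c + \<delta>) - (- 6 / (\<eta> + \<delta>))) {\<eta>..c}"
  proof (rule has_integral_eq[rotated])
    fix x assume "x \<in> {\<eta>..c}"
    then show "6 / (x + \<delta>)\<^sup>2 = U x" using parameters match_inner by (cases "x = \<eta>") (auto simp: U_def)
  qed
  then have 1: "integral {\<eta>..c} U = 6 / r - 6 / (c + \<delta>)" by (simp add: integral_unique r_def)
  have "6 / (c + \<delta>) \<le> 9" using \<delta> by (simp add: c_def field_simps)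
  moreover have "integral {\<eta>..c} U \<le> integral {0..1} U"
    by (rule integral_subset_le) (use parameters Ui Unn in auto)
  ultimately show ?thesis using 1 integral_even[OF U_even Ui] by simp
qed

text \<open>
  Most of the mass is the contribution of \<open>- U''/U\<close> on the cap, which by symmetry is at most
  \<open>2 \<eta> B r\<^sup>2/3 = 4/r\<close>.
\<close>
lemma mass_of_M: "integral {-1..1} M \<le> 4 / r + 51"
proof -
  have Mi: "M integrable_on {x..y}" if "-1 \<le> x" "y \<le> 1" for x y
    using logistic_profile.m_measurable[OF profile] M_bounds that
    by (intro primitive_on_integrable[OF primitive_on_integral[of M "-1" 1 K 0]]) auto
  have M0: "integral {0..\<eta>} M + integral {\<eta>..c} M + integral {c..1} M = integral {0..1} M"
    using Henstock_Kurzweil_Integration.integral_combine[of 0 \<eta> c M] Henstock_Kurzweil_Integration.integral_combine[of 0 c 1 M]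
      parameters Mi[of 0 c] Mi[of 0 1] by simp
  have inner: "integral {0..\<eta>} M \<le> (A + B * r\<^sup>2 / 3) * \<eta>"
  proof -
    have "integral {0..\<eta>} M \<le> integral {0..\<eta>} (\<lambda>_. A + B * r\<^sup>2 / 3)"
    proof (rule integral_le)
      fix x assume x: "x \<in> {0..\<eta>}"
      then have xe: "\<bar>x\<bar> \<le> \<eta>" by simp
      have "2 * B / (A - B * x\<^sup>2) \<le> 2 * B / (6 / r\<^sup>2)"
        by (rule divide_left_mono[OF cap_lower[OF xe]]) (use parameters cap_pos[OF xe] in auto)
      moreover have "0 \<le> B * x\<^sup>2" using parameters by simp
      ultimately show "M x \<le> A + B * r\<^sup>2 / 3" using xe by (simp add: M_def)
    qed (use Mi parameters in auto)
    then show ?thesis using parameters by (simp add: mult.commute)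
  qed
  have mid: "integral {\<eta>..c} M = 0"
  proof -
    have "integral {\<eta><..<c} M = integral {\<eta><..<c} (\<lambda>_. 0)"
      by (rule integral_cong) (use parameters in \<open>auto simp: M_def\<close>)
    then show ?thesis by (simp add: integral_open_interval_real)
  qed
  have outer: "integral {c..1} M \<le> 27 / 2"
  proof -
    have "integral {c..1} M \<le> integral {c..1} (\<lambda>_. 27 / 2)"
    proof (rule integral_le)
      fix x assume x: "x \<in> {c..1}"
      have "M x \<le> k * (1 - c)"
        using x parameters by (auto simp: M_def intro!: mult_left_mono)
      also have "\<dots> = 6 / (c + \<delta>)\<^sup>2" by (rule match_outer)
      also have "\<dots> \<le> 6 / (2 / 3)\<^sup>2"
      proof -
        have "2 / 3 \<le> c + \<delta>" using \<delta> by (simp add: c_def field_simps)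
        then have "(2 / 3)\<^sup>2 \<le> (c + \<delta>)\<^sup>2" by (rule power_mono) simp
        then show ?thesis using parameters by (intro divide_left_mono) auto
      qed
      finally show "M x \<le> 27 / 2" by (simp add: power2_eq_square)
    qed (use Mi parameters in auto)
    also have "\<dots> \<le> 27 / 2" using parameters by simp
    finally show ?thesis .
  qed
  have re: "\<eta> \<le> r\<^sup>2" "\<eta> \<le> r"
  proof -
    have "\<delta>\<^sup>2 \<le> r\<^sup>2" using \<delta> parameters by (intro power_mono) (auto simp: r_def)
    then show "\<eta> \<le> r\<^sup>2" by (simp add: \<eta>_def)
    show "\<eta> \<le> r" using \<delta> by (simp add: r_def)
  qed
  have "A * \<eta> = 6 * (\<eta> / r\<^sup>2) + 6 * (\<eta> / r\<^sup>2) * (\<eta> / r)"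
    using parameters by (simp add: A_def B_def field_simps power2_eq_square power3_eq_cube)
  also have "\<dots> \<le> 6 * 1 + 6 * 1 * 1"
    using re parameters by (intro add_mono mult_mono) (auto simp: divide_le_eq_1)
  finally have "A * \<eta> \<le> 12" by simp
  moreover have "B * r\<^sup>2 / 3 * \<eta> = 2 / r"
    using parameters by (simp add: B_def field_simps power2_eq_square power3_eq_cube)
  ultimately have "integral {0..1} M \<le> 12 + 2 / r + 27 / 2"
    using inner mid outer M0 by (simp add: distrib_right)
  then show ?thesis using integral_even[OF M_even Mi[of "-1" 1]] by simp
qed

end

section \<open>The optimal constant\<close>

lemma L1_norm_bounded_nonneg:
  fixes f :: "real \<Rightarrow> real"
  assumes "f \<in> borel_measurable (lebesgue_on {-1..1})" "\<And>x. x \<in> {-1..1} \<Longrightarrow> 0 \<le> f x" "\<And>x. x \<in> {-1..1} \<Longrightarrow> f x \<le> K"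
  shows "L1_norm f = integral {-1..1} f"
proof -
  have "L1_norm f = (LINT x|lebesgue_on Omega. f x)"
    unfolding L1_norm_def by (rule Bochner_Integration.integral_cong) (use assms(2) in auto)
  also have "\<dots> = integral {-1..1} f"
    using assms by (intro lebesgue_on_Omega_integrable(2)[where K = K]) auto
  finally show ?thesis .
qed

context logistic_profile
begin

lemma L1_norm_u: "L1_norm u = integral {-1..1} u"
proof -
  obtain L where "\<And>x. x \<in> {-1..1} \<Longrightarrow> \<bar>u x\<bar> \<le> L" using continuous_on_Icc_bounded[OF u_continuous] by blast
  then show ?thesis
    using u_nonneg by (intro L1_norm_bounded_nonneg[where K = L] continuous_on_Icc_measurable[OF u_continuous]) (auto simp: abs_le_iff)
qed

lemma L1_norm_m: "L1_norm m = integral {-1..1} m"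
  using m_measurable m_bounds by (intro L1_norm_bounded_nonneg) auto

lemma mass_pos: "0 < integral {-1..1} m"
proof -
  have "0 \<le> integral {-1..1} u"
    using u_nonneg by (intro Henstock_Kurzweil_Integration.integral_nonneg integrable_continuous_real u_continuous) auto
  then show ?thesis using L1_bound by linarith
qed

lemma weight_in_Linf_plus: "m \<in> Linf_plus"
proof -
  have m: "m \<in> borel_measurable (lebesgue_on Omega)" by (rule measurable_Icc_imp_Omega[OF m_measurable])
  then have m': "(\<lambda>x. ereal \<bar>m x\<bar>) \<in> borel_measurable (lebesgue_on Omega)" by measurable
  have "Linf_norm m \<le> ereal K"
    unfolding Linf_norm_def using m' by (rule esssup_I) (use m_bounds in auto)
  moreover have "0 < Linf_norm m"
  proof (rule ccontr)
    assume "\<not> 0 < Linf_norm m"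
    then have le: "Linf_norm m \<le> 0" by simp
    have "AE x in lebesgue_on Omega. ereal \<bar>m x\<bar> \<le> Linf_norm m" unfolding Linf_norm_def by (rule esssup_AE)
    then have "AE x in lebesgue_on Omega. \<bar>m x\<bar> = 0"
    proof eventually_elim
      case (elim x)
      then have "ereal \<bar>m x\<bar> \<le> 0" using le by (rule order_trans)
      then show ?case by simp
    qed
    then have "L1_norm m = (LINT x|lebesgue_on Omega. 0)"
      unfolding L1_norm_def using m by (intro integral_cong_AE) auto
    then show False using L1_norm_m mass_pos by simp
  qed
  ultimately show ?thesis using m m_bounds by (auto simp: Linf_plus_def)
qed

lemma is_logistic_solution:
  assumes "0 < p" shows "logistic_solution p d m u"
  unfolding logistic_solution_def
proof (intro conjI ballI exI[of _ "\<lambda>x. u x * (u x - m x) / d"])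
  show "u \<in> dirichlet_space p" by (rule dirichlet_space_primitives[OF assms V u boundary])
  show "weak_second_derivative u (\<lambda>x. u x * (u x - m x) / d)"
    unfolding weak_second_derivative_def
    using primitive_on_imp_weak_derivative[OF u] primitive_on_imp_weak_derivative[OF V] by blast
  show "AE x in lebesgue_on Omega. d * (u x * (u x - m x) / d) + u x * (m x - u x) = 0"
    using d by (simp, simp add: algebra_simps)
qed (rule u_pos)

end

lemma logistic_solution_imp_profile:
  assumes m: "m \<in> Linf_plus" and d: "0 < d" and sol: "logistic_solution p d m u"
  obtains K m' V where "logistic_profile d K m' u V" "AE x in lebesgue_on Omega. m x = m' x"
proof -
  obtain m' K where m': "\<And>x. 0 \<le> m' x" "\<And>x. m' x \<le> K" "m' \<in> borel_measurable (lebesgue_on {-1..1})"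
    "AE x in lebesgue_on Omega. m x = m' x" using Linf_plus_representative[OF m] by blast
  obtain w where u: "u \<in> dirichlet_space p" "\<forall>x\<in>Omega. 0 < u x" and w: "weak_second_derivative u w"
    "AE x in lebesgue_on Omega. d * w x + u x * (m x - u x) = 0"
    using sol unfolding logistic_solution_def by blast
  have uc: "continuous_on {-1..1} u" and bc: "u (-1) = 0" "u 1 = 0" using u(1) by (auto simp: dirichlet_space_def)
  obtain L where L: "0 \<le> L" "\<And>x. x \<in> {-1..1} \<Longrightarrow> \<bar>u x\<bar> \<le> L" using continuous_on_Icc_bounded[OF uc] by blast
  have ae: "AE x in lebesgue_on Omega. w x = u x * (u x - m' x) / d"
    using w(2) m'(4)
  proof eventually_elim
    case (elim x)
    then have "d * w x = u x * (u x - m' x)" by (simp add: algebra_simps)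
    then show ?case using d by (simp add: field_simps)
  qed
  have meas: "(\<lambda>x. u x * (u x - m' x) / d) \<in> borel_measurable (lebesgue_on {-1..1})"
    using m'(3) continuous_on_Icc_measurable[OF uc] by measurable
  have bound: "\<bar>u x * (u x - m' x) / d\<bar> \<le> L * (L + K) / d" if "x \<in> {-1..1}" for x
  proof -
    have "\<bar>u x - m' x\<bar> \<le> L + K" using L(2)[OF that] m'(1)[of x] m'(2)[of x] by linarith
    then have "\<bar>u x * (u x - m' x)\<bar> \<le> L * (L + K)"
      unfolding abs_mult using L(1) L(2)[OF that] by (intro mult_mono) auto
    then show ?thesis using d by (simp add: abs_divide divide_right_mono)
  qed
  obtain V where "primitive_on (-1) 1 V (\<lambda>x. u x * (u x - m' x) / d)" "primitive_on (-1) 1 u V"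
    by (rule weak_second_derivative_imp_primitives[OF uc w(1) ae meas bound])
  then have "logistic_profile d K m' u V"
    using d m' bc u(2) by unfold_locales auto
  then show thesis using that m'(4) by blast
qed

lemma L1_norm_cong_AE:
  assumes "m \<in> borel_measurable (lebesgue_on Omega)" "m' \<in> borel_measurable (lebesgue_on Omega)"
    "AE x in lebesgue_on Omega. m x = m' x"
  shows "L1_norm m = L1_norm m'"
  unfolding L1_norm_def by (rule integral_cong_AE) (use assms in auto)

theorem theorem1p1:
  fixes p :: real
  assumes "1 < p"
  shows "(\<forall>m\<in>Linf_plus. \<forall>d\<in>{0<..<1 / lambda1 p m}. \<forall>u. logistic_solution p d m u \<longrightarrow>
            L1_norm u / L1_norm m < 3) \<and>
         Sup {ereal (L1_norm u / L1_norm m) | m d u.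
            m \<in> Linf_plus \<and> d \<in> {0<..<1 / lambda1 p m} \<and> logistic_solution p d m u} = 3"
proof -
  have upper: "L1_norm u / L1_norm m < 3"
    if m: "m \<in> Linf_plus" and d: "d \<in> {0<..<1 / lambda1 p m}" and sol: "logistic_solution p d m u" for m d u
  proof -
    obtain K m' V where prof: "logistic_profile d K m' u V" and ae: "AE x in lebesgue_on Omega. m x = m' x"
      using logistic_solution_imp_profile[OF m _ sol] d by auto
    interpret logistic_profile d K m' u V by (rule prof)
    have "L1_norm m = L1_norm m'"
      by (rule L1_norm_cong_AE[OF _ measurable_Icc_imp_Omega[OF m_measurable] ae]) (use m in \<open>simp add: Linf_plus_def\<close>)
    then show ?thesis using L1_bound L1_norm_u L1_norm_m mass_pos by (simp add: divide_less_eq)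
  qed
  let ?S = "{ereal (L1_norm u / L1_norm m) | m d u.
            m \<in> Linf_plus \<and> d \<in> {0<..<1 / lambda1 p m} \<and> logistic_solution p d m u}"
  have le: "Sup ?S \<le> 3"
  proof (rule Sup_least)
    fix y assume "y \<in> ?S"
    then obtain m d u where "y = ereal (L1_norm u / L1_norm m)" "m \<in> Linf_plus" "d \<in> {0<..<1 / lambda1 p m}"
      "logistic_solution p d m u" by blast
    then show "y \<le> 3" using upper[of m d u] by (simp add: less_imp_le)
  qed
  have ge: "3 \<le> Sup ?S"
  proof -
    define r where "r n = (1 / real (n + 5))\<^sup>2 + 1 / real (n + 5)" for n
    have rpos: "0 < r n" for n by (simp add: r_def add_nonneg_pos)
    have lower: "ereal ((12 - 18 * r n) / (4 + 51 * r n)) \<le> Sup ?S" for n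
    proof -
      define \<delta> where "\<delta> = 1 / real (n + 5)"
      interpret C: concentrated \<delta> by unfold_locales (auto simp: \<delta>_def field_simps)
      interpret P: logistic_profile 1 C.K C.M C.U C.V by (rule C.profile)
      have rn: "C.r = r n" unfolding C.r_def C.\<eta>_def r_def by (simp add: \<delta>_def)
      have "C.M \<in> Linf_plus" by (rule P.weight_in_Linf_plus)
      moreover have "1 \<in> {0<..<1 / lambda1 p C.M}"
        using P.lambda1_bound[of p C.M] assms by (simp add: less_divide_eq)
      moreover have "logistic_solution p 1 C.M C.U" using P.is_logistic_solution assms by simp
      ultimately have "ereal (L1_norm C.U / L1_norm C.M) \<in> ?S" by blast
      then have "ereal (L1_norm C.U / L1_norm C.M) \<le> Sup ?S" by (rule Sup_upper)
      moreover have "(12 - 18 * r n) / (4 + 51 * r n) \<le> L1_norm C.U / L1_norm C.M"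
      proof -
        have e: "(12 - 18 * r n) / (4 + 51 * r n) = (12 / r n - 18) / (4 / r n + 51)"
        proof -
          have "12 / r n - 18 = (12 - 18 * r n) / r n" "4 / r n + 51 = (4 + 51 * r n) / r n"
            using rpos[of n] by (simp_all add: field_simps)
          then show ?thesis using rpos[of n] by simp
        qed
        have "r n \<le> 1 / 2"
        proof -
          have "\<delta> * \<delta> \<le> 1 / 4 * (1 / 4)" using C.\<delta> by (intro mult_mono) auto
          moreover have "r n = \<delta> * \<delta> + \<delta>" by (simp add: r_def \<delta>_def power2_eq_square)
          ultimately show ?thesis using C.\<delta> by linarith
        qed
        then have "0 \<le> 12 / r n - 18" using rpos[of n] by (simp add: field_simps)
        then show ?thesis
          unfolding e P.L1_norm_u P.L1_norm_m
          using C.mass_of_U C.mass_of_M P.mass_pos rn by (intro frac_le) auto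
      qed
      ultimately show ?thesis by (meson ereal_less_eq(3) order_trans)
    qed
    have "r \<longlonglongrightarrow> 0" unfolding r_def [abs_def] by real_asymp
    then have "(\<lambda>n. (12 - 18 * r n) / (4 + 51 * r n)) \<longlonglongrightarrow> (12 - 18 * 0) / (4 + 51 * 0)"
      by (intro tendsto_intros) auto
    then have lim: "(\<lambda>n. ereal ((12 - 18 * r n) / (4 + 51 * r n))) \<longlonglongrightarrow> ereal 3" by simp
    have "ereal 3 \<le> Sup ?S" by (rule LIMSEQ_le_const2[OF lim]) (use lower in blast)
    then show ?thesis by simp
  qed
  show ?thesis using upper antisym[OF le ge] by blast
qed

end
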